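(* Let $\ell\ge2$ and let $\rho$ be a regular representation of ${\rm GL}_n(\mathfrak o_\ell)$. Then the restriction of $\rho$ to ${\rm SL}_n(\mathfrak o_\ell)$ is multiplicity free.
   Context: $\mathfrak o$ is the ring of integers of a non-archimedean local field with uniformizer $\varpi$ and residue field $\mathbb F_q$; $\mathfrak o_r=\mathfrak o/\varpi^r\mathfrak o$. Let $K_\ell^{\ell-1}=\ker({\rm GL}_n(\mathfrak o_\ell)\to{\rm GL}_n(\mathfrak o_{\ell-1}))=\{I+\varpi^{\ell-1}y\}$. Fix a character $\varphi$ of $(\mathfrak o_\ell,+)$ nontrivial on $\varpi^{\ell-1}\mathfrak o_\ell$; each $x\in M_n(\mathbb F_q)$ gives a character $\varphi_x(I+\varpi^{\ell-1}y)=\varphi(\varpi^{\ell-1}\mathrm{tr}(\hat xy))$ of $K_\ell^{\ell-1}$ ($\hat x$ any lift of $x$). $x\in M_n(\mathbb F_q)$ is regular if its characteristic polynomial equals its minimal polynomial. An irreducible representation of ${\rm GL}_n(\mathfrak o_\ell)$ is regular if its restriction to $K_\ell^{\ell-1}$ contains $\varphi_x$ for some regular $x$. *)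

theory Defs
  imports "Jordan_Normal_Form.Jordan_Normal_Form" "Jordan_Normal_Form.Char_Poly"
begin

definition trunc_dvr :: "'r::comm_ring_1 \<Rightarrow> nat \<Rightarrow> bool" where
  "trunc_dvr pw l \<longleftrightarrow> finite (UNIV :: 'r set) \<and> l \<ge> 1 \<and>
     pw ^ l = 0 \<and> pw ^ (l - 1) \<noteq> 0 \<and>
     (\<forall>a::'r. \<not> (a dvd 1) \<longleftrightarrow> pw dvd a)"

definition residue_map :: "'r::comm_ring_1 \<Rightarrow> ('r \<Rightarrow> 'k::field) \<Rightarrow> bool" where
  "residue_map pw \<pi> \<longleftrightarrow> \<pi> 0 = 0 \<and> \<pi> 1 = 1 \<and>
     (\<forall>a b. \<pi> (a + b) = \<pi> a + \<pi> b) \<and> (\<forall>a b. \<pi> (a * b) = \<pi> a * \<pi> b) \<and>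
     surj \<pi> \<and> (\<forall>a. \<pi> a = 0 \<longleftrightarrow> pw dvd a)"

definition GL :: "nat \<Rightarrow> 'r::comm_ring_1 mat set" where
  "GL n = {A \<in> carrier_mat n n. det A dvd 1}"

definition SL :: "nat \<Rightarrow> 'r::comm_ring_1 mat set" where
  "SL n = {A \<in> carrier_mat n n. det A = 1}"

definition poly_eval_mat :: "'a::comm_ring_1 poly \<Rightarrow> 'a mat \<Rightarrow> 'a mat" where
  "poly_eval_mat p A = mat (dim_row A) (dim_row A)
     (\<lambda>(i,j). \<Sum>k\<le>degree p. coeff p k * (A ^\<^sub>m k) $$ (i,j))"

definition is_minimal_poly :: "'a::field mat \<Rightarrow> 'a poly \<Rightarrow> bool" where
  "is_minimal_poly A p \<longleftrightarrow> monic p \<and> poly_eval_mat p A = 0\<^sub>m (dim_row A) (dim_row A) \<and>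
     (\<forall>q. q \<noteq> 0 \<longrightarrow> poly_eval_mat q A = 0\<^sub>m (dim_row A) (dim_row A) \<longrightarrow> degree p \<le> degree q)"

definition regular_mat :: "'a::field mat \<Rightarrow> bool" where
  "regular_mat A \<longleftrightarrow> is_minimal_poly A (char_poly A)"

definition is_rep :: "'r::comm_ring_1 mat set \<Rightarrow> nat \<Rightarrow> ('r mat \<Rightarrow> complex mat) \<Rightarrow> nat \<Rightarrow> bool" where
  "is_rep G n \<rho> d \<longleftrightarrow> (\<forall>g\<in>G. \<rho> g \<in> carrier_mat d d) \<and> \<rho> (1\<^sub>m n) = 1\<^sub>m d \<and>
     (\<forall>g\<in>G. \<forall>h\<in>G. \<rho> (g * h) = \<rho> g * \<rho> h)"

definition invariant_subspace :: "'r mat set \<Rightarrow> ('r mat \<Rightarrow> complex mat) \<Rightarrow> nat \<Rightarrow> complex vec set \<Rightarrow> bool" where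
  "invariant_subspace G \<rho> d W \<longleftrightarrow> W \<subseteq> carrier_vec d \<and> 0\<^sub>v d \<in> W \<and>
     (\<forall>v\<in>W. \<forall>w\<in>W. v + w \<in> W) \<and> (\<forall>c::complex. \<forall>v\<in>W. c \<cdot>\<^sub>v v \<in> W) \<and>
     (\<forall>g\<in>G. \<forall>v\<in>W. \<rho> g *\<^sub>v v \<in> W)"

definition irreducible_rep :: "'r::comm_ring_1 mat set \<Rightarrow> nat \<Rightarrow> ('r mat \<Rightarrow> complex mat) \<Rightarrow> nat \<Rightarrow> bool" where
  "irreducible_rep G n \<rho> d \<longleftrightarrow> is_rep G n \<rho> d \<and> d > 0 \<and>
     (\<forall>W. invariant_subspace G \<rho> d W \<longrightarrow> W = {0\<^sub>v d} \<or> W = carrier_vec d)"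

definition intertwiners :: "'r mat set \<Rightarrow> ('r mat \<Rightarrow> complex mat) \<Rightarrow> nat \<Rightarrow> ('r mat \<Rightarrow> complex mat) \<Rightarrow> nat \<Rightarrow> complex mat set" where
  "intertwiners H \<sigma> e \<rho> d = {T \<in> carrier_mat d e. \<forall>h\<in>H. T * \<sigma> h = \<rho> h * T}"

text \<open>The restriction of rho to H is multiplicity free: every irreducible
  representation sigma of H occurs with multiplicity dim Hom_H(sigma, rho) at most 1.\<close>
definition multiplicity_free_restriction :: "'r::comm_ring_1 mat set \<Rightarrow> nat \<Rightarrow> ('r mat \<Rightarrow> complex mat) \<Rightarrow> nat \<Rightarrow> bool" where
  "multiplicity_free_restriction H n \<rho> d \<longleftrightarrow>
     (\<forall>\<sigma> e. irreducible_rep H n \<sigma> e \<longrightarrow>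
        (\<forall>T1\<in>intertwiners H \<sigma> e \<rho> d. \<forall>T2\<in>intertwiners H \<sigma> e \<rho> d.
           \<exists>a b::complex. (a \<noteq> 0 \<or> b \<noteq> 0) \<and> a \<cdot>\<^sub>m T1 + b \<cdot>\<^sub>m T2 = 0\<^sub>m d e))"

definition mat_trace :: "'a::comm_ring_1 mat \<Rightarrow> 'a" where
  "mat_trace A = (\<Sum>i<dim_row A. A $$ (i,i))"


definition add_char :: "('r::comm_ring_1 \<Rightarrow> complex) \<Rightarrow> bool" where
  "add_char \<phi> \<longleftrightarrow> \<phi> 0 = 1 \<and> (\<forall>a b. \<phi> (a + b) = \<phi> a * \<phi> b)"

text \<open>rho restricted to K^(ell-1) = {I + varpi^(ell-1) y} contains phi_x, where x is
  the reduction of the lift xh, phi_x(I + varpi^(ell-1) y) = phi(varpi^(ell-1) tr(xh y)).\<close>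
definition contains_phi_x :: "'r::comm_ring_1 \<Rightarrow> nat \<Rightarrow> ('r \<Rightarrow> complex) \<Rightarrow> nat \<Rightarrow>
     ('r mat \<Rightarrow> complex mat) \<Rightarrow> nat \<Rightarrow> 'r mat \<Rightarrow> bool" where
  "contains_phi_x pw l \<phi> n \<rho> d xh \<longleftrightarrow>
     (\<exists>v\<in>carrier_vec d. v \<noteq> 0\<^sub>v d \<and>
        (\<forall>y\<in>carrier_mat n n.
           \<rho> (1\<^sub>m n + (pw ^ (l - 1)) \<cdot>\<^sub>m y) *\<^sub>v v = \<phi> (pw ^ (l - 1) * mat_trace (xh * y)) \<cdot>\<^sub>v v))"

definition regular_rep :: "'r::comm_ring_1 \<Rightarrow> nat \<Rightarrow> ('r \<Rightarrow> 'k::field) \<Rightarrow> ('r \<Rightarrow> complex) \<Rightarrow> nat \<Rightarrow>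
     ('r mat \<Rightarrow> complex mat) \<Rightarrow> nat \<Rightarrow> bool" where
  "regular_rep pw l \<pi> \<phi> n \<rho> d \<longleftrightarrow> irreducible_rep (GL n) n \<rho> d \<and>
     (\<exists>xh\<in>carrier_mat n n. regular_mat (map_mat \<pi> xh) \<and> contains_phi_x pw l \<phi> n \<rho> d xh)"

end

theory Submission
  imports Defs
begin

text \<open>
  Let \<open>U\<close> be the upper unitriangular group and \<open>\<psi> u = \<phi> (\<Sum>i. u $$ (i, i+1))\<close>.
  It suffices that the \<open>\<psi>\<close>-eigenspace of \<open>U\<close> in \<open>\<rho>\<close> is a line: since \<open>U\<close> lies in the normal subgroup \<open>SL\<close>,
  an irreducible constituent of multiplicity at least 2 would contribute at least 2 dimensions.

  At most one dimension (Gelfand's trick, valid for every irreducible \<open>\<rho>\<close>): character duality shows that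
  \<open>g\<close> intertwines \<open>\<psi>\<close> only if \<open>g A = A' g\<close> for matrices \<open>A, A'\<close> that are upper triangular
  up to 1s on the subdiagonal. Such matrices are \<open>U\<close>-conjugate to companion matrices, and a
  matrix intertwining two companion matrices is symmetric after multiplication by a Hankel matrix. Hence the double
  coset \<open>U g U\<close> is stable under transposition at the antidiagonal, and the Hecke algebra of \<open>\<psi>\<close> is commutative.

  At least one dimension: a regular \<open>x\<close> has a cyclic vector, so after conjugation the socle group
  \<open>{1 + pw\<^sup>l\<^sup>-\<^sup>1 Y}\<close> acts on some vector by \<open>\<phi>\<^sub>C\<close> with a companion matrix \<open>C\<close>. From it,
  \<open>\<psi>\<close>-eigenvectors of the groups \<open>{1 + pw\<^sup>j X | X strictly upper triangular}\<close> are produced for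
  \<open>j = l - 1, ..., 0\<close> by averaging, where the matrices \<open>1 + pw\<^sup>l\<^sup>-\<^sup>j Y\<close> are used to shift characters.
\<close>

section \<open>Additive characters and matrix submodules\<close>

text \<open>Over a field the Bruhat decomposition lists the double cosets of \<open>U\<close>; for
  \<open>l \<ge> 2\<close> it fails over \<open>'r\<close> as soon as \<open>n \<ge> 2\<close>.
  Duality takes its place: \<open>\<phi>\<close> is nontrivial on the smallest nonzero ideal, hence
  on every nonzero ideal, so a submodule of matrices can be recovered from its annihilator under the
  trace. Compatibility of \<open>g\<close> with \<open>\<psi>\<close>, a condition on character
  values, thereby becomes a linear equation between matrices. The descent in the existence half
  works because the exponents \<open>j - 1\<close> and \<open>l - j\<close> add up to
  \<open>l - 1\<close>: commutators of the two families land in the socle group, where the action is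
  known. Regularity enters through one fact about the residue field: a strictly upper matrix that
  commutes with a companion matrix is 0. Hence different terms of the average acquire different
  characters of \<open>Y\<close> and cannot all cancel. The passage to \<open>SL\<close> has its own
  obstacle: a constituent of the restriction need not meet the \<open>\<psi>\<close>-line. Some
  \<open>g\<close> in \<open>GL\<close> moves it there, and normality of \<open>SL\<close> allows
  the averaging to be pulled back through \<open>g\<close>.\<close>

lemma finite_carrier_mat:
  assumes "finite (UNIV :: 'r set)"
  shows "finite (carrier_mat n m :: 'r mat set)"
proof (rule finite_subset)
  show "carrier_mat n m \<subseteq> mat n m ` (({..<n} \<times> {..<m}) \<rightarrow>\<^sub>E (UNIV :: 'r set))"
  proof
    fix A :: "'r mat" assume "A \<in> carrier_mat n m"
    then have "A = mat n m (restrict (\<lambda>p. A $$ p) ({..<n} \<times> {..<m}))"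
      by (intro eq_matI) auto
    then show "A \<in> mat n m ` (({..<n} \<times> {..<m}) \<rightarrow>\<^sub>E UNIV)"
      by (rule image_eqI[of _ "mat n m"]) auto
  qed
  show "finite (mat n m ` (({..<n} \<times> {..<m}) \<rightarrow>\<^sub>E (UNIV :: 'r set)))"
    using assms by (intro finite_imageI finite_PiE) auto
qed

lemma mat_trace_mult:
  assumes "A \<in> carrier_mat n n" "B \<in> carrier_mat n n"
  shows "mat_trace (A * B) = (\<Sum>i<n. \<Sum>j<n. A $$ (i,j) * B $$ (j,i))"
  using assms by (auto simp: mat_trace_def scalar_prod_def lessThan_atLeast0 intro!: sum.cong)

lemma mat_trace_comm:
  assumes "A \<in> carrier_mat n n" "B \<in> carrier_mat n n"
  shows "mat_trace (A * B) = mat_trace (B * A)"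
  unfolding mat_trace_mult[OF assms] mat_trace_mult[OF assms(2,1)]
  by (subst sum.swap) (simp add: mult.commute)

lemma mat_trace_add:
  assumes "A \<in> carrier_mat n n" "B \<in> carrier_mat n n"
  shows "mat_trace (A + B) = mat_trace A + mat_trace B"
  using assms by (simp add: mat_trace_def sum.distrib)

lemma mat_trace_minus:
  assumes "A \<in> carrier_mat n n" "B \<in> carrier_mat n n"
  shows "mat_trace (A - B) = mat_trace A - mat_trace B"
  using assms by (simp add: mat_trace_def sum_subtractf)

lemma mat_trace_smult: "A \<in> carrier_mat n n \<Longrightarrow> mat_trace (a \<cdot>\<^sub>m A) = a * mat_trace A"
  by (simp add: mat_trace_def sum_distrib_left)

definition mat_unit :: "nat \<Rightarrow> nat \<Rightarrow> nat \<Rightarrow> 'a::comm_ring_1 mat" where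
  "mat_unit n a b = mat n n (\<lambda>(i,j). if i = a \<and> j = b then 1 else 0)"

lemma mat_unit_carrier [simp]: "mat_unit n a b \<in> carrier_mat n n"
  by (simp add: mat_unit_def)

lemma mat_trace_mat_unit:
  assumes "X \<in> carrier_mat n n" "a < n" "b < n"
  shows "mat_trace (mat_unit n a b * X) = X $$ (b,a)"
proof -
  have "mat_trace (mat_unit n a b * X) = (\<Sum>i<n. \<Sum>j<n. if i = a then (if j = b then X $$ (j,i) else 0) else 0)"
    unfolding mat_trace_mult[OF mat_unit_carrier assms(1)]
    by (intro sum.cong) (auto simp: mat_unit_def)
  also have "\<dots> = (\<Sum>i<n. if i = a then (\<Sum>j<n. if j = b then X $$ (j,i) else 0) else 0)"
    by (intro sum.cong) auto
  also have "\<dots> = X $$ (b,a)"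
    using assms by (simp add: sum.delta)
  finally show ?thesis .
qed

definition mat_submodule :: "nat \<Rightarrow> 'a::comm_ring_1 mat set \<Rightarrow> bool" where
  "mat_submodule n S \<longleftrightarrow> S \<subseteq> carrier_mat n n \<and> 0\<^sub>m n n \<in> S \<and>
     (\<forall>A\<in>S. \<forall>B\<in>S. A + B \<in> S) \<and> (\<forall>a. \<forall>A\<in>S. a \<cdot>\<^sub>m A \<in> S)"

lemma mat_submodule_carrier: "mat_submodule n (carrier_mat n n)"
  by (auto simp: mat_submodule_def)

text \<open>A generating character: no nonzero ideal lies in its kernel. This turns statements about
  character values of traces into statements about the traces themselves, and makes
  \<open>\<phi> (mat_trace (A * X))\<close> a perfect pairing.\<close>

locale primitive_char =
  fixes \<phi> :: "'r::comm_ring_1 \<Rightarrow> complex"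
  assumes finite_ring: "finite (UNIV :: 'r set)"
    and add_char: "add_char \<phi>"
    and primitive: "x \<noteq> 0 \<Longrightarrow> \<exists>r. \<phi> (x * r) \<noteq> 1"
begin

lemma char_zero [simp]: "\<phi> 0 = 1"
  and char_add: "\<phi> (a + b) = \<phi> a * \<phi> b"
  using add_char by (auto simp: add_char_def)

lemma char_nonzero [simp]: "\<phi> a \<noteq> 0"
  using char_add[of a "- a"] by auto

lemma char_minus: "\<phi> (- a) = inverse (\<phi> a)"
  using char_add[of a "- a"] by (simp add: field_simps)

text \<open>Orthogonality by translation. If some trace is nonzero, \<open>primitive\<close> scales
  it inside \<open>S\<close> to one on which \<open>\<phi>\<close> is not 1; adding that element
  permutes \<open>S\<close> and multiplies the sum by a factor other than 1. Closure under scalars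
  is what lets the case distinction speak of traces rather than of values of
  \<open>\<phi>\<close>.\<close>

lemma char_sum_submodule:
  assumes S: "mat_submodule n S" and X: "X \<in> carrier_mat n n"
  shows "(\<Sum>A\<in>S. \<phi> (mat_trace (A * X))) =
    (if \<forall>A\<in>S. mat_trace (A * X) = 0 then of_nat (card S) else 0)"
proof (cases "\<forall>A\<in>S. mat_trace (A * X) = 0")
  case False
  then obtain A0 where A0: "A0 \<in> S" "mat_trace (A0 * X) \<noteq> 0" by blast
  from S have SC: "S \<subseteq> carrier_mat n n" by (simp add: mat_submodule_def)
  then have fS: "finite S" using finite_carrier_mat[OF finite_ring] finite_subset by blast
  from primitive[OF A0(2)] obtain r where r: "\<phi> (mat_trace (A0 * X) * r) \<noteq> 1" by blast
  define A1 where "A1 = r \<cdot>\<^sub>m A0"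
  have A1: "A1 \<in> S" using S A0 by (auto simp: A1_def mat_submodule_def)
  have A1c: "A1 \<in> carrier_mat n n" and A0c: "A0 \<in> carrier_mat n n" using A1 A0 SC by auto
  have "A1 * X = r \<cdot>\<^sub>m (A0 * X)" unfolding A1_def by (rule mult_smult_assoc_mat[OF A0c X])
  then have "mat_trace (A1 * X) = mat_trace (A0 * X) * r"
    using A0c X by (simp add: mat_trace_smult[of _ n] mult.commute)
  with r have r1: "\<phi> (mat_trace (A1 * X)) \<noteq> 1" by simp
  have inj: "inj_on (\<lambda>A. A1 + A) S"
  proof (rule inj_onI)
    fix A B assume AB: "A \<in> S" "B \<in> S" "A1 + A = A1 + B"
    then have c: "A \<in> carrier_mat n n" "B \<in> carrier_mat n n" using SC by auto
    show "A = B"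
    proof (rule eq_matI)
      fix i j assume ij: "i < dim_row B" "j < dim_col B"
      have "(A1 + A) $$ (i,j) = (A1 + B) $$ (i,j)" using AB by simp
      then show "A $$ (i,j) = B $$ (i,j)" using ij c A1c by simp
    qed (use c in auto)
  qed
  have "(\<lambda>A. A1 + A) ` S \<subseteq> S" using S A1 by (auto simp: mat_submodule_def)
  then have im: "(\<lambda>A. A1 + A) ` S = S" using fS inj by (simp add: endo_inj_surj)
  have "(\<Sum>A\<in>S. \<phi> (mat_trace (A * X))) = (\<Sum>A\<in>S. \<phi> (mat_trace ((A1 + A) * X)))"
    using sum.reindex[OF inj, of "\<lambda>A. \<phi> (mat_trace (A * X))"] im by simp
  also have "\<dots> = (\<Sum>A\<in>S. \<phi> (mat_trace (A1 * X)) * \<phi> (mat_trace (A * X)))"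
  proof (rule sum.cong[OF refl])
    fix A assume "A \<in> S"
    then have Ac: "A \<in> carrier_mat n n" using SC by auto
    show "\<phi> (mat_trace ((A1 + A) * X)) = \<phi> (mat_trace (A1 * X)) * \<phi> (mat_trace (A * X))"
      unfolding add_mult_distrib_mat[OF A1c Ac X] char_add[symmetric]
      using A1c Ac X by (subst mat_trace_add[of _ n]) auto
  qed
  also have "\<dots> = \<phi> (mat_trace (A1 * X)) * (\<Sum>A\<in>S. \<phi> (mat_trace (A * X)))"
    by (simp add: sum_distrib_left)
  finally have "(\<phi> (mat_trace (A1 * X)) - 1) * (\<Sum>A\<in>S. \<phi> (mat_trace (A * X))) = 0"
    by (simp add: algebra_simps)
  with r1 False show ?thesis by auto
qed auto

lemma char_sum_carrier:
  assumes X: "X \<in> carrier_mat n n"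
  shows "(\<Sum>A\<in>carrier_mat n n. \<phi> (mat_trace (A * X))) =
    (if X = 0\<^sub>m n n then of_nat (card (carrier_mat n n :: 'r mat set)) else 0)"
proof -
  have "(\<forall>A\<in>carrier_mat n n. mat_trace (A * X) = 0) \<longleftrightarrow> X = 0\<^sub>m n n"
  proof
    assume *: "\<forall>A\<in>carrier_mat n n. mat_trace (A * X) = 0"
    show "X = 0\<^sub>m n n"
    proof (rule eq_matI)
      fix i j assume "i < dim_row (0\<^sub>m n n :: 'r mat)" "j < dim_col (0\<^sub>m n n :: 'r mat)"
      then show "X $$ (i,j) = (0\<^sub>m n n) $$ (i,j)"
        using mat_trace_mat_unit[OF X, of j i] * mat_unit_carrier by fastforce
    qed (use X in auto)
  next
    assume "X = 0\<^sub>m n n"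
    then show "\<forall>A\<in>carrier_mat n n. mat_trace (A * X) = 0"
      by (auto simp: mat_trace_def)
  qed
  then show ?thesis unfolding char_sum_submodule[OF mat_submodule_carrier X] by simp
qed

text \<open>Double counting of the sum of \<open>\<phi> (mat_trace (X * (A - D)))\<close> over
  \<open>A\<close> in \<open>S\<close> and all \<open>X\<close>. Summed over \<open>X\<close> first
  it is 0, because \<open>A - D\<close> never vanishes. If every \<open>X\<close> that annihilates
  \<open>S\<close> gave \<open>D\<close> the value 1, summing over \<open>A\<close> first would
  yield the size of \<open>S\<close> times the size of its annihilator.\<close>

lemma double_annihilator:
  assumes S: "mat_submodule n S" and D: "D \<in> carrier_mat n n" "D \<notin> S"
  obtains X where "X \<in> carrier_mat n n" "\<And>A. A \<in> S \<Longrightarrow> mat_trace (A * X) = 0"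
    "\<phi> (mat_trace (D * X)) \<noteq> 1"
proof (rule ccontr)
  assume "\<not> thesis"
  with that have *: "\<phi> (mat_trace (D * X)) = 1"
    if "X \<in> carrier_mat n n" "\<forall>A\<in>S. mat_trace (A * X) = 0" for X using that by blast
  let ?M = "carrier_mat n n :: 'r mat set"
  have fM: "finite ?M" using finite_carrier_mat[OF finite_ring] .
  from S have SC: "S \<subseteq> ?M" by (simp add: mat_submodule_def)
  then have fS: "finite S" using fM finite_subset by blast
  have S0: "S \<noteq> {}" using S by (auto simp: mat_submodule_def)
  have "(\<Sum>A\<in>S. \<Sum>X\<in>?M. \<phi> (mat_trace (X * (A - D)))) = 0"
  proof (rule sum.neutral, rule ballI)
    fix A assume A: "A \<in> S"
    then have Ac: "A \<in> ?M" using SC by auto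
    have "A - D \<noteq> 0\<^sub>m n n"
    proof
      assume e: "A - D = 0\<^sub>m n n"
      have "A = D"
      proof (rule eq_matI)
        fix i j assume ij: "i < dim_row D" "j < dim_col D"
        have "(A - D) $$ (i,j) = 0" using ij D e by simp
        then show "A $$ (i,j) = D $$ (i,j)" using ij D Ac by simp
      qed (use Ac D in auto)
      with A D show False by simp
    qed
    then show "(\<Sum>X\<in>?M. \<phi> (mat_trace (X * (A - D)))) = 0"
      using char_sum_carrier[of "A - D" n] minus_carrier_mat[OF D(1), of A] by simp
  qed
  moreover have "(\<Sum>A\<in>S. \<Sum>X\<in>?M. \<phi> (mat_trace (X * (A - D)))) =
      (\<Sum>X\<in>?M. inverse (\<phi> (mat_trace (D * X))) * (\<Sum>A\<in>S. \<phi> (mat_trace (A * X))))"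
  proof (subst sum.swap, rule sum.cong[OF refl])
    fix X assume X: "X \<in> ?M"
    have "\<phi> (mat_trace (X * (A - D))) = inverse (\<phi> (mat_trace (D * X))) * \<phi> (mat_trace (A * X))"
      if "A \<in> S" for A
    proof -
      have Ac: "A \<in> ?M" using that SC by auto
      have "mat_trace (X * (A - D)) = mat_trace (A * X) - mat_trace (D * X)"
        using X Ac D by (simp add: mult_minus_distrib_mat[of _ n n] mat_trace_minus[of _ n] mat_trace_comm[of X n])
      then show ?thesis
        using char_add[of "- mat_trace (D * X)" "mat_trace (A * X)"] by (simp add: char_minus)
    qed
    then show "(\<Sum>A\<in>S. \<phi> (mat_trace (X * (A - D)))) =
        inverse (\<phi> (mat_trace (D * X))) * (\<Sum>A\<in>S. \<phi> (mat_trace (A * X)))"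
      by (simp add: sum_distrib_left)
  qed
  also have "\<dots> = (\<Sum>X\<in>?M. if \<forall>A\<in>S. mat_trace (A * X) = 0 then of_nat (card S) else 0)"
    by (rule sum.cong[OF refl]) (auto simp: char_sum_submodule[OF S] *)
  also have "\<dots> = of_nat (card {X \<in> ?M. \<forall>A\<in>S. mat_trace (A * X) = 0}) * of_nat (card S)"
    by (simp add: sum.inter_filter[OF fM, symmetric])
  also have "\<dots> \<noteq> 0"
  proof -
    have "0\<^sub>m n n \<in> {X \<in> ?M. \<forall>A\<in>S. mat_trace (A * X) = 0}"
      using SC by (auto simp: mat_trace_def dest!: subsetD)
    then have "card {X \<in> ?M. \<forall>A\<in>S. mat_trace (A * X) = 0} \<noteq> 0"
      using fM by (subst card_0_eq) (auto intro: exI[of _ "0\<^sub>m n n"])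
    then show ?thesis using fS S0 by simp
  qed
  ultimately show False by simp
qed

end

section \<open>Unitriangular and companion matrices\<close>

definition unitriangular :: "nat \<Rightarrow> 'a::comm_ring_1 mat set" where
  "unitriangular n = {A \<in> carrier_mat n n. \<forall>i<n. \<forall>j\<le>i. A $$ (i,j) = (if i = j then 1 else 0)}"

definition strictly_upper :: "nat \<Rightarrow> 'a::comm_ring_1 mat set" where
  "strictly_upper n = {X \<in> carrier_mat n n. \<forall>i<n. \<forall>j\<le>i. X $$ (i,j) = 0}"

definition superdiag_sum :: "'a::comm_ring_1 mat \<Rightarrow> 'a" where
  "superdiag_sum A = (\<Sum>i<dim_row A - 1. A $$ (i, Suc i))"

text \<open>Ordinary transposition would send \<open>U\<close> to lower triangular matrices; this
  anti-automorphism keeps \<open>U\<close> and merely reverses the superdiagonal, so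
  \<open>\<psi>\<close> is invariant under it.\<close>

definition anti_transpose :: "nat \<Rightarrow> 'a mat \<Rightarrow> 'a mat" where
  "anti_transpose n A = mat n n (\<lambda>(i,j). A $$ (n - 1 - j, n - 1 - i))"

text \<open>Precisely the matrices whose trace pairing with strictly upper matrices is
  \<open>superdiag_sum\<close>.\<close>

definition hessenberg :: "nat \<Rightarrow> 'a::comm_ring_1 mat \<Rightarrow> bool" where
  "hessenberg n A \<longleftrightarrow> A \<in> carrier_mat n n \<and>
     (\<forall>i<n. \<forall>j<i. A $$ (i,j) = (if i = Suc j then 1 else 0))"

text \<open>The last column is left free; it holds the coefficients of the recurrence below.\<close>

definition companion :: "nat \<Rightarrow> 'a::comm_ring_1 mat \<Rightarrow> bool" where
  "companion n C \<longleftrightarrow> C \<in> carrier_mat n n \<and>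
     (\<forall>i<n. \<forall>j. Suc j < n \<longrightarrow> C $$ (i,j) = (if i = Suc j then 1 else 0))"

definition krylov :: "nat \<Rightarrow> 'a::comm_ring_1 mat \<Rightarrow> 'a vec \<Rightarrow> 'a mat" where
  "krylov n A v = mat n n (\<lambda>(i,j). (((*\<^sub>v) A ^^ j) v) $ i)"

lemma index_mult_mat_sum:
  assumes "A \<in> carrier_mat n n" "B \<in> carrier_mat n n" "i < n" "j < n"
  shows "(A * B) $$ (i,j) = (\<Sum>k<n. A $$ (i,k) * B $$ (k,j))"
  using assms by (simp add: scalar_prod_def lessThan_atLeast0)

lemmas square_mult_carrier [simp] = mult_carrier_mat[of _ n n _ n] for n

lemma unitriangular_carrier: "A \<in> unitriangular n \<Longrightarrow> A \<in> carrier_mat n n"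
  by (simp add: unitriangular_def)

lemma strictly_upper_carrier: "A \<in> strictly_upper n \<Longrightarrow> A \<in> carrier_mat n n"
  by (simp add: strictly_upper_def)

lemma one_unitriangular: "1\<^sub>m n \<in> unitriangular n"
  by (auto simp: unitriangular_def)

lemma unitriangular_entry_mult:
  assumes A: "A \<in> unitriangular n" and B: "B \<in> unitriangular n" and ij: "i < n" "j < n"
  shows "(A * B) $$ (i,j) = (if i < j then A $$ (i,j) + B $$ (i,j) + (\<Sum>k\<in>{i<..<j}. A $$ (i,k) * B $$ (k,j))
    else if i = j then 1 else 0)"
proof -
  have c: "A \<in> carrier_mat n n" "B \<in> carrier_mat n n" using A B unitriangular_carrier by auto
  have a: "A $$ (i,k) = (if i = k then 1 else 0)" if "k \<le> i" for k
    using A ij that by (auto simp: unitriangular_def)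
  have b: "B $$ (k,j) = (if k = j then 1 else 0)" if "j \<le> k" "k < n" for k
    using B ij that by (auto simp: unitriangular_def)
  have "(A * B) $$ (i,j) = (\<Sum>k<n. A $$ (i,k) * B $$ (k,j))"
    using index_mult_mat_sum[OF c ij] .
  also have "\<dots> = (\<Sum>k\<in>{i..j}. A $$ (i,k) * B $$ (k,j))"
    using ij a b by (intro sum.mono_neutral_right) auto
  also have "\<dots> = (if i < j then A $$ (i,j) + B $$ (i,j) + (\<Sum>k\<in>{i<..<j}. A $$ (i,k) * B $$ (k,j))
    else if i = j then 1 else 0)"
  proof (cases "i < j")
    case True
    then have "{i..j} = insert i (insert j {i<..<j})" by auto
    then have "(\<Sum>k\<in>{i..j}. A $$ (i,k) * B $$ (k,j)) =
      A $$ (i,i) * B $$ (i,j) + (A $$ (i,j) * B $$ (j,j) + (\<Sum>k\<in>{i<..<j}. A $$ (i,k) * B $$ (k,j)))"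
      using True by simp
    then show ?thesis using True a[of i] b[of j] ij by (simp add: algebra_simps)
  next
    case False
    then show ?thesis using a[of i] b[of j] ij by (cases "i = j") auto
  qed
  finally show ?thesis .
qed

lemma unitriangular_mult:
  assumes "A \<in> unitriangular n" "B \<in> unitriangular n"
  shows "A * B \<in> unitriangular n"
  using assms unitriangular_entry_mult[OF assms]
  by (auto simp: unitriangular_def[of n] simp del: index_mult_mat(1))

lemma superdiag_sum_mult:
  assumes A: "A \<in> unitriangular n" and B: "B \<in> unitriangular n"
  shows "superdiag_sum (A * B) = superdiag_sum A + superdiag_sum B"
proof -
  have c: "A \<in> carrier_mat n n" "B \<in> carrier_mat n n" using A B unitriangular_carrier by auto
  have "(A * B) $$ (i, Suc i) = A $$ (i, Suc i) + B $$ (i, Suc i)" if "i < n - 1" for i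
  proof -
    have "{i<..<Suc i} = {}" by auto
    then show ?thesis using unitriangular_entry_mult[OF assms, of i "Suc i"] that by simp
  qed
  then show ?thesis using c by (simp add: superdiag_sum_def sum.distrib del: index_mult_mat(1))
qed

lemma superdiag_sum_one: "superdiag_sum (1\<^sub>m n) = 0"
  by (auto simp: superdiag_sum_def intro!: sum.neutral)

lemma unitriangular_det:
  assumes "A \<in> unitriangular n" shows "det A = 1"
proof -
  have c: "A \<in> carrier_mat n n" using assms unitriangular_carrier by auto
  have "upper_triangular A" using assms by (auto simp: unitriangular_def upper_triangular_def)
  then have "det A = prod_list (diag_mat A)" by (rule det_upper_triangular[OF _ c])
  also have "diag_mat A = map (\<lambda>_. 1) [0..<n]"
    using assms c by (auto simp: diag_mat_def unitriangular_def)
  also have "prod_list \<dots> = 1" by (induct n) auto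
  finally show ?thesis .
qed

lemma GL_inverse:
  assumes "A \<in> GL n"
  obtains B where "B \<in> GL n" "A * B = 1\<^sub>m n" "B * A = 1\<^sub>m n"
proof -
  from assms have A: "A \<in> carrier_mat n n" and "det A dvd 1" by (auto simp: GL_def)
  then obtain c where c: "det A * c = 1" by (metis dvd_def)
  define B where "B = c \<cdot>\<^sub>m adj_mat A"
  have adj: "adj_mat A \<in> carrier_mat n n" "A * adj_mat A = det A \<cdot>\<^sub>m 1\<^sub>m n" "adj_mat A * A = det A \<cdot>\<^sub>m 1\<^sub>m n"
    using adj_mat[OF A] by auto
  have Bc: "B \<in> carrier_mat n n" using adj by (simp add: B_def)
  have AB: "A * B = 1\<^sub>m n"
    unfolding B_def mult_smult_distrib[OF A adj(1)] adj(2) using c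
    by (auto simp: mult.commute)
  have BA: "B * A = 1\<^sub>m n"
    unfolding B_def mult_smult_assoc_mat[OF adj(1) A] adj(3) using c
    by (auto simp: mult.commute)
  have "det B * det A = 1" using det_mult[OF Bc A] BA by simp
  then have "B \<in> GL n" using Bc by (auto simp: GL_def dvd_def)
  with AB BA that show thesis by blast
qed

lemma GL_mult: "A \<in> GL n \<Longrightarrow> B \<in> GL n \<Longrightarrow> A * B \<in> GL n"
  using is_unit_mult_iff by (auto simp: GL_def det_mult[of _ n])

lemma GL_carrier: "A \<in> GL n \<Longrightarrow> A \<in> carrier_mat n n"
  by (simp add: GL_def)

lemma unitriangular_SL: "A \<in> unitriangular n \<Longrightarrow> A \<in> SL n"
  by (simp add: SL_def unitriangular_det unitriangular_carrier)

lemma SL_GL: "A \<in> SL n \<Longrightarrow> A \<in> GL n"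
  by (simp add: SL_def GL_def)

lemma unitriangular_GL: "A \<in> unitriangular n \<Longrightarrow> A \<in> GL n"
  using unitriangular_SL SL_GL by blast

lemma GL_if_right_inverse:
  assumes "A \<in> carrier_mat n n" "B \<in> carrier_mat n n" "A * B = 1\<^sub>m n"
  shows "A \<in> GL n" "B \<in> GL n"
  using det_mult[OF assms(1,2)] assms by (auto simp: GL_def dvd_def) (metis mult.commute)

lemma mat_mult_left_cancel:
  fixes A B K :: "'a::comm_ring_1 mat"
  assumes "K \<in> carrier_mat n n" "A \<in> carrier_mat n n" "K * A = 1\<^sub>m n" "B \<in> carrier_mat n n"
  shows "K * (A * B) = B"
  using assms left_mult_one_mat[OF assms(4)] by (simp flip: assoc_mult_mat[of _ n n _ n])

lemma mult_left_inj_on_carrier: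
  assumes "A \<in> GL n" shows "inj_on (\<lambda>B. A * B) (carrier_mat n n)"
proof -
  obtain K where K: "K \<in> GL n" "K * A = 1\<^sub>m n" using GL_inverse[OF assms] by blast
  show ?thesis
    by (rule inj_on_inverseI[of _ "\<lambda>B. K * B"]) (use K assms GL_carrier in \<open>auto intro: mat_mult_left_cancel\<close>)
qed

text \<open>Finiteness replaces a formula for the inverse: left multiplication by \<open>A\<close>
  is an injective, hence surjective, map of \<open>U\<close> into itself.\<close>

lemma unitriangular_inverse:
  fixes A :: "'r::comm_ring_1 mat"
  assumes fin: "finite (UNIV :: 'r set)" and A: "A \<in> unitriangular n"
  obtains B where "B \<in> unitriangular n" "A * B = 1\<^sub>m n" "B * A = 1\<^sub>m n"
proof -
  have sub: "unitriangular n \<subseteq> (carrier_mat n n :: 'r mat set)" using unitriangular_carrier by auto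
  have "inj_on (\<lambda>B. A * B) (unitriangular n)"
    using mult_left_inj_on_carrier[OF unitriangular_GL[OF A]] sub inj_on_subset by blast
  moreover have "(\<lambda>B. A * B) ` unitriangular n \<subseteq> unitriangular n" using unitriangular_mult[OF A] by auto
  moreover have "finite (unitriangular n :: 'r mat set)"
    using finite_subset[OF sub finite_carrier_mat[OF fin]] .
  ultimately have "(\<lambda>B. A * B) ` unitriangular n = unitriangular n" by (simp add: endo_inj_surj)
  then obtain B where B: "B \<in> unitriangular n" "A * B = 1\<^sub>m n"
    using one_unitriangular by (metis (no_types, lifting) imageE)
  obtain K where K: "K \<in> GL n" "K * A = 1\<^sub>m n" using GL_inverse[OF unitriangular_GL[OF A]] by blast
  have "K = B"
    using mat_mult_left_cancel[of K n A B] K A B unitriangular_carrier GL_carrier by fastforce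
  with B K that show thesis by blast
qed

section \<open>Reflection at the antidiagonal\<close>

lemma anti_transpose_carrier [simp]: "anti_transpose n A \<in> carrier_mat n n"
  by (simp add: anti_transpose_def)

lemma anti_transpose_mult:
  fixes A B :: "'a::comm_ring_1 mat"
  assumes "A \<in> carrier_mat n n" "B \<in> carrier_mat n n"
  shows "anti_transpose n (A * B) = anti_transpose n B * anti_transpose n A"
proof (rule eq_matI)
  fix i j assume "i < dim_row (anti_transpose n B * anti_transpose n A)"
    "j < dim_col (anti_transpose n B * anti_transpose n A)"
  then have ij: "i < n" "j < n" by (auto simp: anti_transpose_def)
  have "anti_transpose n (A * B) $$ (i,j) = (A * B) $$ (n - 1 - j, n - 1 - i)"
    using ij by (simp add: anti_transpose_def)
  also have "\<dots> = (\<Sum>k<n. A $$ (n - 1 - j, k) * B $$ (k, n - 1 - i))"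
    using ij by (intro index_mult_mat_sum[OF assms]) auto
  also have "\<dots> = (\<Sum>k<n. A $$ (n - 1 - j, n - Suc k) * B $$ (n - Suc k, n - 1 - i))"
    by (rule sum.nat_diff_reindex[symmetric])
  also have "\<dots> = (\<Sum>k<n. anti_transpose n B $$ (i,k) * anti_transpose n A $$ (k,j))"
    using ij by (intro sum.cong) (auto simp: anti_transpose_def mult.commute)
  also have "\<dots> = (anti_transpose n B * anti_transpose n A) $$ (i,j)"
    using ij by (intro index_mult_mat_sum[symmetric]) auto
  finally show "anti_transpose n (A * B) $$ (i,j) = (anti_transpose n B * anti_transpose n A) $$ (i,j)" .
qed (auto simp: anti_transpose_def)

lemma anti_transpose_anti_transpose:
  "A \<in> carrier_mat n n \<Longrightarrow> anti_transpose n (anti_transpose n A) = A"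
  by (rule eq_matI) (auto simp: anti_transpose_def)

lemma anti_transpose_one: "anti_transpose n (1\<^sub>m n) = 1\<^sub>m n"
  by (rule eq_matI) (auto simp: anti_transpose_def)

lemma anti_transpose_GL:
  assumes "A \<in> GL n" shows "anti_transpose n A \<in> GL n"
proof -
  obtain B where B: "B \<in> GL n" "B * A = 1\<^sub>m n" using GL_inverse[OF assms] by blast
  have "anti_transpose n A * anti_transpose n B = 1\<^sub>m n"
    using anti_transpose_mult[OF GL_carrier[OF B(1)] GL_carrier[OF assms]] B by (simp add: anti_transpose_one)
  then show ?thesis by (rule GL_if_right_inverse(1)[rotated 2]) auto
qed

lemma anti_transpose_unitriangular:
  assumes "A \<in> unitriangular n" shows "anti_transpose n A \<in> unitriangular n"
proof -
  have "anti_transpose n A $$ (i,j) = (if i = j then 1 else 0)" if "i < n" "j \<le> i" for i j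
  proof -
    have "A $$ (n - 1 - j, n - 1 - i) = (if n - 1 - j = n - 1 - i then 1 else 0)"
      using assms that by (auto simp: unitriangular_def)
    then show ?thesis using that by (auto simp: anti_transpose_def split: if_splits)
  qed
  then show ?thesis by (simp add: unitriangular_def)
qed

lemma superdiag_sum_anti_transpose:
  assumes "A \<in> carrier_mat n n"
  shows "superdiag_sum (anti_transpose n A) = superdiag_sum A"
proof -
  have "superdiag_sum A = (\<Sum>i<n - 1. A $$ (n - 1 - Suc i, Suc (n - 1 - Suc i)))"
    using assms unfolding superdiag_sum_def
    by (simp add: sum.nat_diff_reindex[of "\<lambda>i. A $$ (i, Suc i)" "n - 1", simplified])
  also have "\<dots> = superdiag_sum (anti_transpose n A)"
    unfolding superdiag_sum_def by (intro sum.cong) (auto simp: anti_transpose_def Suc_diff_Suc)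
  finally show ?thesis by simp
qed

section \<open>Krylov matrices and companion form\<close>

lemma krylov_carrier [simp]: "krylov n A v \<in> carrier_mat n n"
  by (simp add: krylov_def)

lemma iter_mult_mat_vec_carrier:
  assumes "A \<in> carrier_mat n n" "v \<in> carrier_vec n"
  shows "((*\<^sub>v) A ^^ k) v \<in> carrier_vec n"
  by (induct k) (use assms in auto)

lemma mult_krylov:
  assumes A: "A \<in> carrier_mat n n" and v: "v \<in> carrier_vec n" and "i < n" "Suc j < n"
  shows "(A * krylov n A v) $$ (i,j) = krylov n A v $$ (i, Suc j)"
proof -
  have "col (krylov n A v) j = ((*\<^sub>v) A ^^ j) v"
    using assms iter_mult_mat_vec_carrier[OF A v, of j] by (intro eq_vecI) (auto simp: krylov_def)
  moreover have "dim_col (krylov n A v) = n" by (simp add: krylov_def)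
  ultimately show ?thesis using assms by (simp add: krylov_def)
qed

text \<open>The columns of the Krylov matrix are the iterates of \<open>v\<close>, so
  \<open>A\<close> moves each column to the next; in that basis \<open>A\<close> is a companion
  matrix.\<close>

lemma companion_krylov:
  assumes A: "A \<in> carrier_mat n n" and v: "v \<in> carrier_vec n"
    and K: "K \<in> carrier_mat n n" "K * krylov n A v = 1\<^sub>m n"
  shows "companion n (K * (A * krylov n A v))"
  unfolding companion_def
proof (intro conjI allI impI)
  fix i j assume ij: "i < n" "Suc j < n"
  have c: "A * krylov n A v \<in> carrier_mat n n" using A by auto
  have "(K * (A * krylov n A v)) $$ (i,j) = (\<Sum>k<n. K $$ (i,k) * (A * krylov n A v) $$ (k,j))"
    using ij by (intro index_mult_mat_sum[OF K(1) c]) auto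
  also have "\<dots> = (\<Sum>k<n. K $$ (i,k) * krylov n A v $$ (k, Suc j))"
    using mult_krylov[OF A v _ ij(2)] by (intro sum.cong) auto
  also have "\<dots> = (K * krylov n A v) $$ (i, Suc j)"
    using ij by (intro index_mult_mat_sum[OF K(1), symmetric]) auto
  finally show "(K * (A * krylov n A v)) $$ (i,j) = (if i = Suc j then 1 else 0)"
    using K(2) ij by simp
qed (use A K in auto)

text \<open>The \<open>j\<close>-th iterate of the first unit vector is the \<open>j\<close>-th unit
  vector plus earlier ones. So this vector is cyclic, and the change to companion form stays inside
  \<open>U\<close>.\<close>

lemma krylov_hessenberg:
  assumes A: "hessenberg n A"
  shows "krylov n A (unit_vec n 0) \<in> unitriangular n"
proof -
  have Ac: "A \<in> carrier_mat n n" using A by (simp add: hessenberg_def)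
  have *: "(((*\<^sub>v) A ^^ j) (unit_vec n 0)) $ i = (if i = j then 1 else 0)" if "i < n" "j \<le> i" for i j
    using that
  proof (induct j arbitrary: i)
    case (Suc j)
    let ?w = "((*\<^sub>v) A ^^ j) (unit_vec n 0)"
    have w: "?w \<in> carrier_vec n" by (rule iter_mult_mat_vec_carrier[OF Ac]) auto
    have "(A *\<^sub>v ?w) $ i = (\<Sum>k<n. A $$ (i,k) * ?w $ k)"
      using Ac w Suc by (simp add: scalar_prod_def lessThan_atLeast0)
    also have "\<dots> = (\<Sum>k<n. if k = j then A $$ (i,k) else 0)"
    proof (rule sum.cong[OF refl])
      fix k assume k: "k \<in> {..<n}"
      show "A $$ (i,k) * ?w $ k = (if k = j then A $$ (i,k) else 0)"
      proof (cases "k < j")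
        case True
        then have "A $$ (i,k) = 0" using A Suc k by (auto simp: hessenberg_def)
        with True show ?thesis by simp
      next
        case False
        then show ?thesis using Suc.hyps[of k] k by simp
      qed
    qed
    also have "\<dots> = A $$ (i,j)" using Suc by simp
    also have "\<dots> = (if i = Suc j then 1 else 0)"
      using A Suc by (auto simp: hessenberg_def)
    finally show ?case by simp
  qed (auto simp: unit_vec_def)
  then show ?thesis by (simp add: unitriangular_def krylov_def)
qed

text \<open>The impulse response of the recurrence with coefficients \<open>c\<close>. The seeds 0,
  ..., 0, 1 are what makes the Hankel matrix below unitriangular once its rows are reversed.\<close>

function linear_recurrence :: "nat \<Rightarrow> (nat \<Rightarrow> 'a::comm_ring_1) \<Rightarrow> nat \<Rightarrow> 'a" where
  "linear_recurrence n c k = (if k < n then (if Suc k = n then 1 else 0)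
     else \<Sum>t<n. c t * linear_recurrence n c (k - n + t))"
  by pat_completeness auto
termination by (relation "measure (\<lambda>(n,c,k). k)") auto

declare linear_recurrence.simps [simp del]

lemma mult_companion:
  assumes N: "N \<in> carrier_mat n n" and C: "companion n C" and ij: "i < n" "Suc j < n"
  shows "(N * C) $$ (i,j) = N $$ (i, Suc j)"
proof -
  have Cc: "C \<in> carrier_mat n n" using C by (simp add: companion_def)
  have "(N * C) $$ (i,j) = (\<Sum>k<n. N $$ (i,k) * C $$ (k,j))"
    using ij by (intro index_mult_mat_sum[OF N Cc]) auto
  also have "\<dots> = (\<Sum>k<n. if k = Suc j then N $$ (i,k) else 0)"
    using C ij by (intro sum.cong) (auto simp: companion_def)
  finally show ?thesis using ij by simp
qed

text \<open>Away from the last column and the last row, \<open>C\<close> on the right shifts the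
  columns of \<open>N\<close>, and the transpose of \<open>C'\<close> on the left shifts its rows.
  The equation thus makes \<open>N\<close> constant along antidiagonals, and Hankel matrices are
  symmetric.\<close>

lemma symmetric_if_companion_intertwines:
  assumes N: "N \<in> carrier_mat n n" and C: "companion n C" and C': "companion n C'"
    and NC: "N * C = C'\<^sup>T * N" and ij: "i < n" "j < n"
  shows "N $$ (i,j) = N $$ (j,i)"
proof -
  have C'c: "C' \<in> carrier_mat n n" using C' by (simp add: companion_def)
  have step: "N $$ (i, Suc j) = N $$ (Suc i, j)" if "Suc i < n" "Suc j < n" for i j
  proof -
    have "N $$ (i, Suc j) = (C'\<^sup>T * N) $$ (i,j)"
      using mult_companion[OF N C] NC that by (simp del: index_mult_mat(1))
    also have "\<dots> = (\<Sum>k<n. C'\<^sup>T $$ (i,k) * N $$ (k,j))"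
      using that C'c N by (intro index_mult_mat_sum) auto
    also have "\<dots> = (\<Sum>k<n. if k = Suc i then N $$ (k,j) else 0)"
      using C' C'c that by (intro sum.cong) (auto simp: companion_def)
    finally show ?thesis using that by simp
  qed
  have shift: "N $$ (i,j) = N $$ (i + d, j - d)" if "i + d \<le> j" "j < n" for i j d
    using that
  proof (induct d)
    case (Suc d)
    then show ?case using step[of "i + d" "j - Suc d"] by (simp add: Suc_diff_Suc)
  qed simp
  show ?thesis
  proof (cases "i \<le> j")
    case True
    then show ?thesis using shift[of i "j - i" j] ij by simp
  next
    case False
    then show ?thesis using shift[of j "i - j" i] ij by simp
  qed
qed

text \<open>Let \<open>S\<close> have the entries \<open>h (i + j)\<close>, where \<open>h\<close>
  solves the recurrence given by the last column of \<open>C\<close>. Multiplication by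
  \<open>C\<close> replaces \<open>h (i + j)\<close> by \<open>h (i + j + 1)\<close>; the result is
  again symmetric, and that is the intertwining relation.\<close>

lemma companion_hankel:
  assumes C: "companion n C"
  obtains S where "S \<in> carrier_mat n n" "S * C = C\<^sup>T * S"
    "mat n n (\<lambda>(i,j). S $$ (n - 1 - i, j)) \<in> unitriangular n"
proof
  have Cc: "C \<in> carrier_mat n n" using C by (simp add: companion_def)
  define h where "h = linear_recurrence n (\<lambda>t. C $$ (t, n - 1))"
  define S where "S = mat n n (\<lambda>(i,j). h (i + j))"
  show S: "S \<in> carrier_mat n n" by (simp add: S_def)
  have SC: "(S * C) $$ (i,j) = h (Suc (i + j))" if ij: "i < n" "j < n" for i j
  proof (cases "Suc j < n")
    case True
    then show ?thesis using mult_companion[OF S C] ij by (simp add: S_def del: index_mult_mat(1))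
  next
    case False
    \<comment> \<open>Only the last column uses the recurrence: with \<open>n = Suc j\<close> the
      index \<open>Suc (i + j)\<close> is at least \<open>n\<close>.\<close>
    then have j: "n = Suc j" using ij by simp
    have "(S * C) $$ (i,j) = (\<Sum>k<n. S $$ (i,k) * C $$ (k,j))"
      by (rule index_mult_mat_sum[OF S Cc ij])
    also have "\<dots> = (\<Sum>k<n. C $$ (k, n - 1) * h (Suc (i + j) - n + k))"
      using ij j by (intro sum.cong) (auto simp: S_def mult.commute)
    also have "\<dots> = h (Suc (i + j))"
      unfolding h_def by (subst (2) linear_recurrence.simps) (use j in auto)
    finally show ?thesis .
  qed
  have "C\<^sup>T * S = (S\<^sup>T * C)\<^sup>T" using Cc S by (simp add: transpose_mult[of _ n n _ n])
  also have "S\<^sup>T = S" by (rule eq_matI) (auto simp: S_def add.commute)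
  also have "(S * C)\<^sup>T = S * C"
    by (rule eq_matI) (use SC S Cc in \<open>auto simp del: index_mult_mat(1) simp: add.commute\<close>)
  finally show "S * C = C\<^sup>T * S" by simp
  show "mat n n (\<lambda>(i,j). S $$ (n - 1 - i, j)) \<in> unitriangular n"
    by (auto simp: unitriangular_def S_def h_def linear_recurrence.simps)
qed

text \<open>A matrix intertwining two companion matrices becomes a Hankel matrix, hence symmetric,
  after multiplication by the Hankel form of the second one.\<close>
lemma anti_transpose_if_intertwines_companions:
  assumes g: "g \<in> carrier_mat n n" and C: "companion n C" and C': "companion n C'"
    and gC: "g * C = C' * g"
  obtains s where "s \<in> unitriangular n" "s * g = anti_transpose n g * anti_transpose n s"
proof -
  have c: "C \<in> carrier_mat n n" "C' \<in> carrier_mat n n" using C C' by (auto simp: companion_def)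
  obtain S where S: "S \<in> carrier_mat n n" "S * C' = C'\<^sup>T * S"
    "mat n n (\<lambda>(i,j). S $$ (n - 1 - i, j)) \<in> unitriangular n"
    using companion_hankel[OF C'] .
  define s where "s = mat n n (\<lambda>(i,j). S $$ (n - 1 - i, j))"
  have Sg: "S * g \<in> carrier_mat n n" using S g by auto
  have "(S * g) * C = C'\<^sup>T * (S * g)"
    using S g c gC by (smt (verit) assoc_mult_mat transpose_carrier_mat)
  then have sym: "(S * g) $$ (i,j) = (S * g) $$ (j,i)" if "i < n" "j < n" for i j
    using symmetric_if_companion_intertwines[OF Sg C C'] that by blast
  have sc: "s \<in> carrier_mat n n" by (simp add: s_def)
  have sg: "(s * g) $$ (i,j) = (S * g) $$ (n - 1 - i, j)" if "i < n" "j < n" for i j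
    unfolding index_mult_mat_sum[OF sc g that]
    using that by (subst index_mult_mat_sum[OF S(1) g]) (auto simp: s_def intro!: sum.cong)
  have "s * g = anti_transpose n (s * g)"
    by (rule eq_matI) (use sc g in \<open>auto simp: anti_transpose_def sg sym simp del: index_mult_mat(1)\<close>)
  then have "s * g = anti_transpose n g * anti_transpose n s" using anti_transpose_mult[OF sc g] by simp
  with S(3) that show thesis by (simp add: s_def)
qed

section \<open>Double cosets of the unitriangular group\<close>

lemma companion_hessenberg: "companion n C \<Longrightarrow> hessenberg n C"
  by (auto simp: companion_def hessenberg_def)

lemma mat_trace_hessenberg:
  assumes C: "hessenberg n C" and X: "X \<in> strictly_upper n"
  shows "mat_trace (C * X) = superdiag_sum X"
proof -
  have c: "C \<in> carrier_mat n n" "X \<in> carrier_mat n n"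
    using C X by (auto simp: hessenberg_def strictly_upper_def)
  have "mat_trace (C * X) = (\<Sum>j<n. \<Sum>i<n. C $$ (i,j) * X $$ (j,i))"
    unfolding mat_trace_mult[OF c] by (rule sum.swap)
  also have "\<dots> = (\<Sum>j<n. \<Sum>i<n. if i = Suc j then X $$ (j,i) else 0)"
  proof (intro sum.cong refl)
    fix i j assume "j \<in> {..<n}" "i \<in> {..<n}"
    then show "C $$ (i,j) * X $$ (j,i) = (if i = Suc j then X $$ (j,i) else 0)"
      using C X by (cases "j < i") (auto simp: hessenberg_def strictly_upper_def)
  qed
  also have "\<dots> = (\<Sum>j<n. if j < n - 1 then X $$ (j, Suc j) else 0)"
    by (intro sum.cong) auto
  also have "\<dots> = (\<Sum>j<n - 1. X $$ (j, Suc j))"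
    by (rule sum.mono_neutral_cong_right) auto
  finally show ?thesis using c by (simp add: superdiag_sum_def)
qed

lemma one_add_unitriangular: "X \<in> strictly_upper n \<Longrightarrow> 1\<^sub>m n + X \<in> unitriangular n"
  by (auto simp: unitriangular_def strictly_upper_def)

lemma superdiag_sum_one_add: "X \<in> carrier_mat n n \<Longrightarrow> superdiag_sum (1\<^sub>m n + X) = superdiag_sum X"
  by (auto simp: superdiag_sum_def intro!: sum.cong)

definition upper_tri :: "nat \<Rightarrow> 'a::comm_ring_1 mat set" where
  "upper_tri n = {B \<in> carrier_mat n n. \<forall>i<n. \<forall>j<i. B $$ (i,j) = 0}"

lemma mat_submodule_upper_tri: "mat_submodule n (upper_tri n)"
  by (auto simp: mat_submodule_def upper_tri_def)

lemma mat_submodule_sum_conj: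
  fixes g :: "'a::comm_ring_1 mat"
  assumes S: "mat_submodule n S" and g: "g \<in> carrier_mat n n" and k: "k \<in> carrier_mat n n"
  shows "mat_submodule n {A + k * B * g | A B. A \<in> S \<and> B \<in> S}"
  unfolding mat_submodule_def
proof (intro conjI ballI allI)
  have SC: "\<And>A. A \<in> S \<Longrightarrow> A \<in> carrier_mat n n" using S by (auto simp: mat_submodule_def)
  show "{A + k * B * g | A B. A \<in> S \<and> B \<in> S} \<subseteq> carrier_mat n n" using SC g k by auto
  show "0\<^sub>m n n \<in> {A + k * B * g | A B. A \<in> S \<and> B \<in> S}"
  proof -
    have "0\<^sub>m n n \<in> S" using S by (simp add: mat_submodule_def)
    moreover have "0\<^sub>m n n = 0\<^sub>m n n + k * 0\<^sub>m n n * g" using g k by simp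
    ultimately show ?thesis by blast
  qed
  fix X Y a
  assume "X \<in> {A + k * B * g | A B. A \<in> S \<and> B \<in> S}"
  then obtain A B where X: "X = A + k * B * g" "A \<in> S" "B \<in> S" by auto
  have c: "A \<in> carrier_mat n n" "B \<in> carrier_mat n n" using X SC by auto
  have "a \<cdot>\<^sub>m X = a \<cdot>\<^sub>m A + k * (a \<cdot>\<^sub>m B) * g"
    unfolding X using c g k
    by (simp add: add_smult_distrib_left_mat[of _ n n] mult_smult_distrib[of _ n n _ n] mult_smult_assoc_mat[of _ n n _ n])
  moreover have "a \<cdot>\<^sub>m A \<in> S" "a \<cdot>\<^sub>m B \<in> S" using S X by (auto simp: mat_submodule_def)
  ultimately show "a \<cdot>\<^sub>m X \<in> {A + k * B * g | A B. A \<in> S \<and> B \<in> S}" by blast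
  assume "Y \<in> {A + k * B * g | A B. A \<in> S \<and> B \<in> S}"
  then obtain A' B' where Y: "Y = A' + k * B' * g" "A' \<in> S" "B' \<in> S" by auto
  have c': "A' \<in> carrier_mat n n" "B' \<in> carrier_mat n n" using Y SC by auto
  have kg: "k * B * g \<in> carrier_mat n n" "k * B' * g \<in> carrier_mat n n" using c c' g k by auto
  have "k * (B + B') * g = k * B * g + k * B' * g"
    using c c' g k by (simp add: mult_add_distrib_mat[of _ n n _ n] add_mult_distrib_mat[of _ n n _ _ n])
  then have "X + Y = (A + A') + k * (B + B') * g"
    unfolding X Y by (intro eq_matI) (use c c' kg g k in \<open>auto simp del: index_mult_mat(1)\<close>)
  moreover have "A + A' \<in> S" "B + B' \<in> S" using S X Y by (auto simp: mat_submodule_def)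
  ultimately show "X + Y \<in> {A + k * B * g | A B. A \<in> S \<and> B \<in> S}" by blast
qed

lemma strictly_upper_if_annihilates_upper_tri:
  assumes X: "X \<in> carrier_mat n n" and "\<And>B. B \<in> upper_tri n \<Longrightarrow> mat_trace (B * X) = 0"
  shows "X \<in> strictly_upper n"
proof -
  have "X $$ (i,j) = 0" if "i < n" "j \<le> i" for i j
    using assms(2)[of "mat_unit n j i"] mat_trace_mat_unit[OF X, of j i] that
    by (auto simp: upper_tri_def mat_unit_def)
  with X show ?thesis by (simp add: strictly_upper_def)
qed

context primitive_char
begin

text \<open>If conjugation by \<open>g\<close> respects \<open>\<psi>\<close> wherever it maps
  \<open>U\<close> into \<open>U\<close>, duality yields Hessenberg matrices with
  \<open>g * M = M' * g\<close>; in Krylov bases \<open>g\<close> intertwines companion matrices,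
  and the Hankel argument applies. The equation between superdiagonal sums records that
  \<open>g\<close> and its reflection carry the same character value within their double
  coset.\<close>

lemma unitriangular_double_coset_dichotomy:
  fixes g :: "'r mat"
  assumes g: "g \<in> GL n"
  shows "(\<exists>h\<in>unitriangular n. \<exists>h'\<in>unitriangular n. g * h = h' * g \<and>
      \<phi> (superdiag_sum h) \<noteq> \<phi> (superdiag_sum h')) \<or>
    (\<exists>u1\<in>unitriangular n. \<exists>u2\<in>unitriangular n. \<exists>u3\<in>unitriangular n. \<exists>u4\<in>unitriangular n.
      u1 * (g * u2) = u3 * (anti_transpose n g * u4) \<and>
      superdiag_sum u1 + superdiag_sum u2 = superdiag_sum u3 + superdiag_sum u4)"
proof -
  have gc: "g \<in> carrier_mat n n" using g GL_carrier by blast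
  obtain k where k: "k \<in> GL n" "g * k = 1\<^sub>m n" "k * g = 1\<^sub>m n" using GL_inverse[OF g] by blast
  have kc: "k \<in> carrier_mat n n" using k GL_carrier by blast
  define E :: "'r mat" where "E = mat n n (\<lambda>(i,j). if i = Suc j then 1 else 0)"
  have Ec: "E \<in> carrier_mat n n" and Eh: "hessenberg n E" by (auto simp: E_def hessenberg_def)
  \<comment> \<open>A matrix \<open>X\<close> annihilates \<open>S\<close> under the trace exactly
    when \<open>X\<close> and \<open>g * X * k\<close> are both strictly upper, that is, when
    \<open>1 + X\<close> and its conjugate by \<open>g\<close> both lie in \<open>U\<close>.\<close>
  define S where "S = {A + k * B * g | A B. A \<in> upper_tri n \<and> B \<in> upper_tri n}"
  have S: "mat_submodule n S" unfolding S_def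
    by (rule mat_submodule_sum_conj[OF mat_submodule_upper_tri gc kc])
  \<comment> \<open>\<open>E\<close> represents \<open>superdiag_sum\<close>, so pairing
    \<open>D\<close> with an \<open>X\<close> that annihilates \<open>S\<close> measures the change
    of \<open>superdiag_sum\<close> under conjugation by \<open>g\<close>.\<close>
  define D where "D = k * E * g - E"
  have Dc: "D \<in> carrier_mat n n" using Ec by (simp add: D_def minus_carrier_mat)
  show ?thesis
  proof (cases "D \<in> S")
    case False
    then obtain X where X: "X \<in> carrier_mat n n" "\<And>A. A \<in> S \<Longrightarrow> mat_trace (A * X) = 0"
      "\<phi> (mat_trace (D * X)) \<noteq> 1" using double_annihilator[OF S Dc] by blast
    have z: "0\<^sub>m n n \<in> upper_tri n" by (simp add: upper_tri_def)
    have conj: "mat_trace (k * B * g * X) = mat_trace (B * (g * X * k))" if B: "B \<in> carrier_mat n n" for B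
    proof -
      have "k * B * g * X = k * (B * g * X)" using kc gc X B
        by (simp add: assoc_mult_mat[of _ n n _ n _ n])
      then have "mat_trace (k * B * g * X) = mat_trace (B * g * X * k)"
        using mat_trace_comm[of k n "B * g * X"] kc gc X B by simp
      also have "B * g * X * k = B * (g * X * k)" using kc gc X B
        by (simp add: assoc_mult_mat[of _ n n _ n _ n])
      finally show ?thesis .
    qed
    have X1: "X \<in> strictly_upper n"
    proof (rule strictly_upper_if_annihilates_upper_tri[OF X(1)])
      fix B :: "'r mat" assume B: "B \<in> upper_tri n"
      have "B + k * 0\<^sub>m n n * g \<in> S" using B z unfolding S_def by blast
      moreover have "B + k * 0\<^sub>m n n * g = B" using B kc gc by (simp add: upper_tri_def)
      ultimately show "mat_trace (B * X) = 0" using X(2) by simp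
    qed
    have Y: "g * X * k \<in> carrier_mat n n" using gc kc X by auto
    have X2: "g * X * k \<in> strictly_upper n"
    proof (rule strictly_upper_if_annihilates_upper_tri[OF Y])
      fix B :: "'r mat" assume B: "B \<in> upper_tri n"
      then have Bc: "B \<in> carrier_mat n n" by (simp add: upper_tri_def)
      have "0\<^sub>m n n + k * B * g \<in> S" using B z unfolding S_def by blast
      moreover have "0\<^sub>m n n + k * B * g = k * B * g" using Bc kc gc by simp
      ultimately show "mat_trace (B * (g * X * k)) = 0" using X(2) conj[OF Bc] by simp
    qed
    have "mat_trace (D * X) = mat_trace (k * E * g * X) - mat_trace (E * X)"
    proof -
      have kEg: "k * E * g \<in> carrier_mat n n" using kc gc Ec by auto
      show ?thesis
        unfolding D_def minus_mult_distrib_mat[OF kEg Ec X(1)]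
        by (rule mat_trace_minus[of _ n]) (use kEg Ec X in auto)
    qed
    also have "\<dots> = superdiag_sum (g * X * k) - superdiag_sum X"
      using conj[OF Ec] mat_trace_hessenberg[OF Eh X1] mat_trace_hessenberg[OF Eh X2] by simp
    finally have tr: "mat_trace (D * X) = superdiag_sum (g * X * k) - superdiag_sum X" .
    have "\<phi> (superdiag_sum (g * X * k)) \<noteq> \<phi> (superdiag_sum X)"
    proof
      assume "\<phi> (superdiag_sum (g * X * k)) = \<phi> (superdiag_sum X)"
      then have "\<phi> (mat_trace (D * X)) = 1" unfolding tr diff_conv_add_uminus char_add char_minus by simp
      with X(3) show False by simp
    qed
    moreover have "g * (1\<^sub>m n + X) = (1\<^sub>m n + g * X * k) * g"
    proof -
      have "g * X * k * g = g * X" using gc kc X k by (simp add: assoc_mult_mat[of _ n n _ n _ n])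
      then show ?thesis using gc kc X
        by (simp add: mult_add_distrib_mat[of _ n n _ n] add_mult_distrib_mat[of _ n n _ _ n])
    qed
    ultimately show ?thesis
      using one_add_unitriangular[OF X1] one_add_unitriangular[OF X2]
        superdiag_sum_one_add[OF X(1)] superdiag_sum_one_add[OF Y] by metis
  next
    case True
    then obtain A B where AB: "D = A + k * B * g" "A \<in> upper_tri n" "B \<in> upper_tri n"
      unfolding S_def by auto
    have c: "A \<in> carrier_mat n n" "B \<in> carrier_mat n n" using AB by (auto simp: upper_tri_def)
    \<comment> \<open>\<open>D = A + k * B * g\<close> rearranges to
      \<open>k * (E - B) * g = E + A\<close>; upper triangular corrections leave the 1s below the
      diagonal intact.\<close>
    define M where "M = E + A"
    define M' where "M' = E - B"
    have M: "hessenberg n M" "hessenberg n M'"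
      using AB Eh c unfolding M_def M'_def by (auto simp: hessenberg_def upper_tri_def)
    then have Mc: "M \<in> carrier_mat n n" "M' \<in> carrier_mat n n" by (auto simp: hessenberg_def)
    have "k * M' * g = k * E * g - k * B * g"
      unfolding M'_def using kc gc Ec c
      by (simp add: mult_minus_distrib_mat[of _ n n _ n] minus_mult_distrib_mat[of _ n n _ _ n])
    also have "\<dots> = M"
    proof (rule eq_matI)
      fix i j assume "i < dim_row M" "j < dim_col M"
      then have ij: "i < n" "j < n" using Mc by auto
      have kg: "k * E * g \<in> carrier_mat n n" "k * B * g \<in> carrier_mat n n" using kc gc Ec c by auto
      have "D $$ (i,j) = (A + k * B * g) $$ (i,j)" using AB by simp
      then show "(k * E * g - k * B * g) $$ (i,j) = M $$ (i,j)"
        unfolding D_def M_def using ij Ec c kc gc by (simp add: algebra_simps del: index_mult_mat(1))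
    qed (use kc gc Mc in auto)
    finally have kM: "k * M' * g = M" .
    have gM: "g * M = M' * g"
      unfolding kM[symmetric] using gc kc Mc mat_mult_left_cancel[OF gc kc k(2), of "M' * g"]
      by (simp add: assoc_mult_mat[of _ n n _ n _ n])
    define K where "K = krylov n M (unit_vec n 0)"
    define K' where "K' = krylov n M' (unit_vec n 0)"
    have KU: "K \<in> unitriangular n" "K' \<in> unitriangular n"
      using krylov_hessenberg M by (auto simp: K_def K'_def)
    then have Kc: "K \<in> carrier_mat n n" "K' \<in> carrier_mat n n" using unitriangular_carrier by auto
    obtain L where L: "L \<in> unitriangular n" "K * L = 1\<^sub>m n" "L * K = 1\<^sub>m n"
      using unitriangular_inverse[OF finite_ring KU(1)] by blast
    obtain L' where L': "L' \<in> unitriangular n" "K' * L' = 1\<^sub>m n" "L' * K' = 1\<^sub>m n"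
      using unitriangular_inverse[OF finite_ring KU(2)] by blast
    have Lc: "L \<in> carrier_mat n n" "L' \<in> carrier_mat n n" using L L' unitriangular_carrier by auto
    have comp: "companion n (L * (M * K))" "companion n (L' * (M' * K'))"
      using companion_krylov[OF Mc(1) unit_vec_carrier Lc(1) L(3)[unfolded K_def]]
        companion_krylov[OF Mc(2) unit_vec_carrier Lc(2) L'(3)[unfolded K'_def]]
      by (auto simp: K_def K'_def)
    \<comment> \<open>\<open>g\<close> written in the two Krylov bases. The base changes lie in
      \<open>U\<close>, so \<open>f\<close> stays in the double coset of \<open>g\<close>.\<close>
    define f where "f = L' * (g * K)"
    have fc: "f \<in> carrier_mat n n" using Lc gc Kc by (simp add: f_def)
    have "f * (L * (M * K)) = L' * (g * (M * K))"
      unfolding f_def using gc Kc Lc Mc mat_mult_left_cancel[OF Kc(1) Lc(1) L(2)]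
      by (simp add: assoc_mult_mat[of _ n n _ n _ n])
    also have "\<dots> = L' * (M' * (g * K))"
      using gM assoc_mult_mat[OF gc Mc(1) Kc(1)] assoc_mult_mat[OF Mc(2) gc Kc(1)] by simp
    also have "\<dots> = (L' * (M' * K')) * f"
      unfolding f_def using gc Kc Lc Mc mat_mult_left_cancel[OF Kc(2) Lc(2) L'(2)]
      by (simp add: assoc_mult_mat[of _ n n _ n _ n])
    finally obtain s where s: "s \<in> unitriangular n" "s * f = anti_transpose n f * anti_transpose n s"
      using anti_transpose_if_intertwines_companions[OF fc comp] by blast
    have sc: "s \<in> carrier_mat n n" using s unitriangular_carrier by blast
    let ?t = "anti_transpose n"
    have "?t f = ?t K * (?t g * ?t L')"
      unfolding f_def using gc Kc Lc by (simp add: anti_transpose_mult assoc_mult_mat[of _ n n _ n _ n])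
    \<comment> \<open>Unfolding \<open>f\<close> leaves unitriangular factors on both sides of
      \<open>g\<close> and of its reflection: these are the four witnesses.\<close>
    with s have "(s * L') * (g * K) = ?t K * (?t g * (?t L' * ?t s))"
      using gc Kc Lc sc unfolding f_def by (simp add: assoc_mult_mat[of _ n n _ n _ n])
    moreover have "superdiag_sum (s * L') + superdiag_sum K = superdiag_sum (?t K) + superdiag_sum (?t L' * ?t s)"
      using superdiag_sum_mult[OF s(1) L'(1)] Kc sc Lc
        superdiag_sum_mult[OF anti_transpose_unitriangular[OF L'(1)] anti_transpose_unitriangular[OF s(1)]]
      by (simp add: superdiag_sum_anti_transpose)
    moreover have "s * L' \<in> unitriangular n" "?t K \<in> unitriangular n" "?t L' * ?t s \<in> unitriangular n"
      using s L' KU by (auto intro!: unitriangular_mult anti_transpose_unitriangular)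
    ultimately show ?thesis using KU by blast
  qed
qed

end

section \<open>Cyclic vectors and eigenvectors\<close>

definition poly_act :: "nat \<Rightarrow> 'a::comm_ring_1 mat \<Rightarrow> 'a poly \<Rightarrow> 'a vec \<Rightarrow> 'a vec" where
  "poly_act n A p v = vec n (\<lambda>i. \<Sum>k\<le>degree p. coeff p k * (((*\<^sub>v) A ^^ k) v) $ i)"

lemma poly_act_carrier [simp]: "poly_act n A p v \<in> carrier_vec n"
  by (simp add: poly_act_def)

lemma poly_act_eq:
  assumes "degree p \<le> N"
  shows "poly_act n A p v = vec n (\<lambda>i. \<Sum>k\<le>N. coeff p k * (((*\<^sub>v) A ^^ k) v) $ i)"
  unfolding poly_act_def
proof (rule eq_vecI)
  fix i assume "i < dim_vec (vec n (\<lambda>i. \<Sum>k\<le>N. coeff p k * (((*\<^sub>v) A ^^ k) v) $ i))"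
  moreover have "(\<Sum>k\<le>degree p. coeff p k * (((*\<^sub>v) A ^^ k) v) $ i) =
      (\<Sum>k\<le>N. coeff p k * (((*\<^sub>v) A ^^ k) v) $ i)"
    using assms by (intro sum.mono_neutral_left) (auto simp: coeff_eq_0)
  ultimately show "vec n (\<lambda>i. \<Sum>k\<le>degree p. coeff p k * (((*\<^sub>v) A ^^ k) v) $ i) $ i =
      vec n (\<lambda>i. \<Sum>k\<le>N. coeff p k * (((*\<^sub>v) A ^^ k) v) $ i) $ i" by simp
qed simp

lemma poly_act_0 [simp]: "poly_act n A 0 v = 0\<^sub>v n"
  by (rule eq_vecI) (auto simp: poly_act_def)

lemma poly_act_add: "poly_act n A (p + q) v = poly_act n A p v + poly_act n A q v"
proof -
  let ?N = "max (degree p) (degree q)"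
  have "degree (p + q) \<le> ?N" by (rule degree_add_le_max)
  then show ?thesis
    using poly_act_eq[of p ?N n A v] poly_act_eq[of q ?N n A v] poly_act_eq[of "p + q" ?N n A v]
    by (intro eq_vecI) (auto simp: sum.distrib algebra_simps)
qed

lemma poly_act_smult: "poly_act n A (Polynomial.smult a p) v = a \<cdot>\<^sub>v poly_act n A p v"
  using poly_act_eq[of "Polynomial.smult a p" "degree p" n A v] degree_smult_le[of a p]
  by (intro eq_vecI) (auto simp: poly_act_def[of n A p] sum_distrib_left algebra_simps)

lemma poly_act_pCons:
  assumes A: "A \<in> carrier_mat n n" and v: "v \<in> carrier_vec n"
  shows "poly_act n A (pCons a p) v = a \<cdot>\<^sub>v v + A *\<^sub>v poly_act n A p v"
proof (rule eq_vecI)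
  fix i assume "i < dim_vec (a \<cdot>\<^sub>v v + A *\<^sub>v poly_act n A p v)"
  then have i: "i < n" using A by simp
  let ?w = "\<lambda>k. ((*\<^sub>v) A ^^ k) v"
  have w: "?w k \<in> carrier_vec n" for k by (rule iter_mult_mat_vec_carrier[OF A v])
  have "poly_act n A (pCons a p) v $ i = (\<Sum>k\<le>Suc (degree p). coeff (pCons a p) k * ?w k $ i)"
    using poly_act_eq[of "pCons a p" "Suc (degree p)" n A v] i by (simp add: degree_pCons_le)
  also have "\<dots> = a * v $ i + (\<Sum>k\<le>degree p. coeff p k * (A *\<^sub>v ?w k) $ i)"
    by (simp add: sum.atMost_Suc_shift del: sum.atMost_Suc)
  also have "(\<Sum>k\<le>degree p. coeff p k * (A *\<^sub>v ?w k) $ i) =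
      (\<Sum>k\<le>degree p. \<Sum>t<n. A $$ (i,t) * (coeff p k * ?w k $ t))"
  proof (intro sum.cong refl)
    fix k
    have "(A *\<^sub>v ?w k) $ i = (\<Sum>t<n. A $$ (i,t) * ?w k $ t)"
      using A i w[of k] by (simp add: scalar_prod_def lessThan_atLeast0)
    then show "coeff p k * (A *\<^sub>v ?w k) $ i = (\<Sum>t<n. A $$ (i,t) * (coeff p k * ?w k $ t))"
      by (simp add: sum_distrib_left algebra_simps)
  qed
  also have "\<dots> = (\<Sum>t<n. A $$ (i,t) * poly_act n A p v $ t)"
    by (subst sum.swap) (simp add: poly_act_def sum_distrib_left)
  also have "\<dots> = (A *\<^sub>v poly_act n A p v) $ i"
    using A i by (simp add: scalar_prod_def lessThan_atLeast0 poly_act_def)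
  finally show "poly_act n A (pCons a p) v $ i = (a \<cdot>\<^sub>v v + A *\<^sub>v poly_act n A p v) $ i"
    using A v i by simp
qed (use A in \<open>auto simp: poly_act_def\<close>)

lemma poly_act_mult:
  assumes A: "A \<in> carrier_mat n n" and v: "v \<in> carrier_vec n"
  shows "poly_act n A (p * q) v = poly_act n A p (poly_act n A q v)"
proof (induct p)
  case (pCons a p)
  have "poly_act n A (pCons a p * q) v = poly_act n A (Polynomial.smult a q) v + poly_act n A (pCons 0 (p * q)) v"
    by (simp add: poly_act_add)
  also have "poly_act n A (pCons 0 (p * q)) v = A *\<^sub>v poly_act n A (p * q) v"
    unfolding poly_act_pCons[OF A v] by (rule eq_vecI) (use A v in auto)
  finally show ?case using pCons by (simp add: poly_act_smult poly_act_pCons[OF A])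
qed simp

lemma poly_act_zero_vec:
  assumes A: "A \<in> carrier_mat n n" shows "poly_act n A p (0\<^sub>v n) = 0\<^sub>v n"
  using poly_act_mult[OF A zero_carrier_vec, of p 0] by simp

lemma poly_act_add_vec:
  assumes A: "A \<in> carrier_mat n n" and v: "v \<in> carrier_vec n" and w: "w \<in> carrier_vec n"
  shows "poly_act n A p (v + w) = poly_act n A p v + poly_act n A p w"
proof (induct p)
  case (pCons a p)
  show ?case
    by (rule eq_vecI) (use A v w in \<open>auto simp: poly_act_pCons[OF A] pCons
      mult_add_distrib_mat_vec[OF A poly_act_carrier poly_act_carrier] algebra_simps
      simp del: index_mult_mat_vec\<close>)
qed simp

lemma poly_eval_mat_poly_act:
  assumes A: "A \<in> carrier_mat n n" and v: "v \<in> carrier_vec n"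
  shows "poly_eval_mat p A *\<^sub>v v = poly_act n A p v"
proof (rule eq_vecI)
  fix i assume "i < dim_vec (poly_act n A p v)"
  then have i: "i < n" by (simp add: poly_act_def)
  have pow: "A ^\<^sub>m k *\<^sub>v w = ((*\<^sub>v) A ^^ k) w" if "w \<in> carrier_vec n" for k w
    using that
  proof (induct k arbitrary: w)
    case (Suc k)
    have "A ^\<^sub>m Suc k *\<^sub>v w = A ^\<^sub>m k *\<^sub>v (A *\<^sub>v w)"
      using assoc_mult_mat_vec[OF pow_carrier_mat[OF A, of k] A Suc(2)] by simp
    then show ?case using Suc A by (simp add: funpow_swap1)
  qed (use A in auto)
  have "(poly_eval_mat p A *\<^sub>v v) $ i = (\<Sum>t<n. (\<Sum>k\<le>degree p. coeff p k * (A ^\<^sub>m k) $$ (i,t)) * v $ t)"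
    using A v i by (simp add: poly_eval_mat_def scalar_prod_def lessThan_atLeast0)
  also have "\<dots> = (\<Sum>k\<le>degree p. \<Sum>t<n. coeff p k * ((A ^\<^sub>m k) $$ (i,t) * v $ t))"
    by (simp add: sum_distrib_right mult.assoc) (rule sum.swap)
  also have "\<dots> = (\<Sum>k\<le>degree p. coeff p k * (((*\<^sub>v) A ^^ k) v) $ i)"
  proof (intro sum.cong refl)
    fix k
    have "(A ^\<^sub>m k *\<^sub>v v) $ i = (\<Sum>t<n. (A ^\<^sub>m k) $$ (i,t) * v $ t)"
      using A v i by (simp add: scalar_prod_def lessThan_atLeast0 carrier_matD[OF pow_carrier_mat[OF A]])
    then show "(\<Sum>t<n. coeff p k * ((A ^\<^sub>m k) $$ (i,t) * v $ t)) = coeff p k * (((*\<^sub>v) A ^^ k) v) $ i"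
      unfolding pow[OF v, symmetric] by (simp add: sum_distrib_left)
  qed
  finally show "(poly_eval_mat p A *\<^sub>v v) $ i = poly_act n A p v $ i"
    using i by (simp add: poly_act_def)
qed (use A in \<open>auto simp: poly_act_def poly_eval_mat_def\<close>)

text \<open>A nonzero element of least degree generates: the remainder of any member on division by
  it stays in the ideal.\<close>

lemma poly_ideal_generator:
  fixes I :: "'a::field poly set"
  assumes "p0 \<in> I" "p0 \<noteq> 0" and add: "\<And>p q. p \<in> I \<Longrightarrow> q \<in> I \<Longrightarrow> p + q \<in> I"
    and mult: "\<And>p q. p \<in> I \<Longrightarrow> q * p \<in> I"
  obtains g where "g \<in> I" "g \<noteq> 0" "\<And>p. p \<in> I \<Longrightarrow> g dvd p"
proof -
  obtain g where g: "g \<in> I" "g \<noteq> 0" and min: "\<And>p. p \<in> I \<Longrightarrow> p \<noteq> 0 \<Longrightarrow> degree g \<le> degree p"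
    using ex_has_least_nat[of "\<lambda>p. p \<in> I \<and> p \<noteq> 0" p0 degree] assms(1,2) by blast
  have "g dvd p" if "p \<in> I" for p
  proof -
    have "p mod g = p + (- (p div g)) * g"
      by (simp add: minus_div_mult_eq_mod[symmetric])
    then have "p mod g \<in> I" using add[OF that mult[OF g(1)]] by metis
    moreover have "p mod g = 0 \<or> degree (p mod g) < degree g" by (rule degree_mod_less[OF g(2)])
    ultimately have "p mod g = 0" using min[of "p mod g"] by fastforce
    then show ?thesis by (simp add: mod_eq_0_iff_dvd)
  qed
  with g that show thesis by blast
qed

lemma poly_bezout:
  fixes a b :: "'a::field poly"
  assumes "a \<noteq> 0"
  obtains g r s where "g = r * a + s * b" "g dvd a" "g dvd b" "g \<noteq> 0"
proof -
  let ?I = "{r * a + s * b | r s. True}"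
  have a: "a \<in> ?I" "b \<in> ?I"
    by (rule CollectI, rule exI[of _ 1], rule exI[of _ 0], simp)
      (rule CollectI, rule exI[of _ 0], rule exI[of _ 1], simp)
  have add: "p + q \<in> ?I" if pq: "p \<in> ?I" "q \<in> ?I" for p q
  proof -
    obtain r s r' s' where "p = r * a + s * b" "q = r' * a + s' * b" using pq by blast
    then have "p + q = (r + r') * a + (s + s') * b" by (simp add: algebra_simps)
    then show ?thesis by blast
  qed
  have mult: "q * p \<in> ?I" if p: "p \<in> ?I" for p q
  proof -
    obtain r s where "p = r * a + s * b" using p by blast
    then have "q * p = (q * r) * a + (q * s) * b" by (simp add: algebra_simps)
    then show ?thesis by blast
  qed
  obtain g where g: "g \<in> ?I" "g \<noteq> 0" "\<And>p. p \<in> ?I \<Longrightarrow> g dvd p"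
    using poly_ideal_generator[OF a(1) assms add mult] by blast
  then show thesis using a that by blast
qed

lemma mult_mat_unit_vec:
  fixes A :: "'a::comm_ring_1 mat"
  assumes "A \<in> carrier_mat nr nc" "j < nc"
  shows "A *\<^sub>v unit_vec nc j = col A j"
  using assms by (intro eq_vecI) auto

lemma mat_mult_zero_vec:
  fixes A :: "'a::comm_ring_1 mat"
  shows "A \<in> carrier_mat n m \<Longrightarrow> A *\<^sub>v 0\<^sub>v m = 0\<^sub>v n"
  by (rule eq_vecI) auto

lemma zero_mat_mult_vec: "w \<in> carrier_vec m \<Longrightarrow> 0\<^sub>m n m *\<^sub>v w = 0\<^sub>v n"
  by (rule eq_vecI) auto

text \<open>The order of \<open>v\<close> in the module defined by \<open>A\<close>. It is fixed
  only up to a nonzero constant, so the arguments use only its divisibility and its degree.\<close>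

definition annihilator_gen :: "nat \<Rightarrow> 'a::field mat \<Rightarrow> 'a vec \<Rightarrow> 'a poly \<Rightarrow> bool" where
  "annihilator_gen n A v a \<longleftrightarrow> a \<noteq> 0 \<and> (\<forall>p. poly_act n A p v = 0\<^sub>v n \<longleftrightarrow> a dvd p)"

lemma annihilator_gen_exists:
  assumes A: "A \<in> carrier_mat n n" and v: "v \<in> carrier_vec n"
    and p0: "p0 \<noteq> 0" "poly_act n A p0 v = 0\<^sub>v n"
  obtains a where "annihilator_gen n A v a"
proof -
  let ?I = "{p. poly_act n A p v = 0\<^sub>v n}"
  obtain g where g: "g \<in> ?I" "g \<noteq> 0" "\<And>p. p \<in> ?I \<Longrightarrow> g dvd p"
  proof (rule poly_ideal_generator[of p0 ?I])
    show "p + q \<in> ?I" if "p \<in> ?I" "q \<in> ?I" for p q using that by (simp add: poly_act_add)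
    show "q * p \<in> ?I" if "p \<in> ?I" for p q
      using that poly_act_mult[OF A v] poly_act_zero_vec[OF A] by simp
  qed (use p0 that in auto)
  have "poly_act n A p v = 0\<^sub>v n" if "g dvd p" for p
  proof -
    from that obtain q where "p = g * q" by (rule dvdE)
    then have "p = q * g" by simp
    then show ?thesis using g(1) poly_act_mult[OF A v] poly_act_zero_vec[OF A] by simp
  qed
  with g that show thesis unfolding annihilator_gen_def by blast
qed

lemma annihilator_gen_poly_act:
  assumes A: "A \<in> carrier_mat n n" and v: "v \<in> carrier_vec n" and a: "annihilator_gen n A v (r * s)"
  shows "annihilator_gen n A (poly_act n A r v) s"
proof -
  have "r \<noteq> 0" "s \<noteq> 0" using a by (auto simp: annihilator_gen_def)
  moreover have "poly_act n A p (poly_act n A r v) = 0\<^sub>v n \<longleftrightarrow> r * s dvd r * p" for p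
    using a by (simp add: annihilator_gen_def poly_act_mult[OF A v, symmetric] mult.commute)
  ultimately show ?thesis by (simp add: annihilator_gen_def)
qed

text \<open>Coprime orders multiply. Applying \<open>b * p\<close> removes \<open>w\<close> and
  forces \<open>a\<close> to divide \<open>b * p\<close>; symmetrically \<open>b\<close> divides
  \<open>a * p\<close>, and the Bezout relation combines the two.\<close>

lemma annihilator_gen_add:
  assumes A: "A \<in> carrier_mat n n" and v: "v \<in> carrier_vec n" and w: "w \<in> carrier_vec n"
    and a: "annihilator_gen n A v a" and b: "annihilator_gen n A w b" and rs: "r * a + s * b = 1"
    and p: "poly_act n A p (v + w) = 0\<^sub>v n"
  shows "a * b dvd p"
proof -
  have sum: "poly_act n A q (v + w) = poly_act n A q v + poly_act n A q w" for q
    by (rule poly_act_add_vec[OF A v w])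
  have z: "poly_act n A (q * p) (v + w) = 0\<^sub>v n" for q
    using p poly_act_mult[OF A, of "v + w" q p] poly_act_zero_vec[OF A] v w by simp
  have "poly_act n A (b * p) w = 0\<^sub>v n" using b by (simp add: annihilator_gen_def)
  with z[of b] sum[of "b * p"] have "poly_act n A (b * p) v = 0\<^sub>v n" by simp
  then have ab: "a dvd b * p" using a by (simp add: annihilator_gen_def)
  have "poly_act n A (a * p) v = 0\<^sub>v n" using a by (simp add: annihilator_gen_def)
  with z[of a] sum[of "a * p"] have "poly_act n A (a * p) w = 0\<^sub>v n" by simp
  then have ba: "b dvd a * p" using b by (simp add: annihilator_gen_def)
  have p: "p = r * (a * p) + s * (b * p)"
    using arg_cong[OF rs, of "\<lambda>x. x * p"] by (simp add: algebra_simps)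
  have "b dvd r * (a * p) + s * (b * p)" by (rule dvd_add[OF dvd_mult[OF ba] dvd_mult[OF dvd_triv_left]])
  then have bp: "b dvd p" using p by simp
  have "a dvd r * (a * p) + s * (b * p)" by (rule dvd_add[OF dvd_mult[OF dvd_triv_left] dvd_mult[OF ab]])
  then have ap: "a dvd p" using p by simp
  have "a * b dvd r * (a * p) + s * (b * p)"
    using mult_dvd_mono[OF dvd_refl bp, of a] mult_dvd_mono[OF ap dvd_refl, of b]
    by (intro dvd_add[OF dvd_mult dvd_mult]) (auto simp: mult.commute)
  then show ?thesis using p by simp
qed

text \<open>Take \<open>v\<close> with an order \<open>a\<close> of largest degree. Were this degree
  below \<open>n\<close>, some vector would survive \<open>a\<close>; a survivor \<open>w\<close>
  whose order \<open>b\<close> has least degree improves \<open>v\<close>: with \<open>g\<close> the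
  gcd of \<open>a\<close> and \<open>b\<close>, the vectors \<open>g v\<close> and \<open>w\<close>
  have coprime orders, and their product has larger degree than \<open>a\<close>. Minimality of
  \<open>b\<close> does the work of a factorisation into primes.\<close>

lemma cyclic_vector_exists:
  fixes A :: "'a::field mat"
  assumes A: "A \<in> carrier_mat n n" and p0: "p0 \<noteq> 0"
    and p0A: "\<And>w. w \<in> carrier_vec n \<Longrightarrow> poly_act n A p0 w = 0\<^sub>v n"
    and min: "\<And>q. q \<noteq> 0 \<Longrightarrow> degree q < n \<Longrightarrow> \<exists>w\<in>carrier_vec n. poly_act n A q w \<noteq> 0\<^sub>v n"
  obtains v where "v \<in> carrier_vec n"
    "\<And>q. q \<noteq> 0 \<Longrightarrow> degree q < n \<Longrightarrow> poly_act n A q v \<noteq> 0\<^sub>v n"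
proof -
  have ex: "\<exists>a. annihilator_gen n A w a" if "w \<in> carrier_vec n" for w
    using annihilator_gen_exists[OF A that p0 p0A[OF that]] by blast
  \<comment> \<open>Pairs of a vector and its order. All orders divide \<open>p0\<close>, which
    bounds their degrees.\<close>
  define Q where "Q va \<longleftrightarrow> fst va \<in> carrier_vec n \<and> annihilator_gen n A (fst va) (snd va)" for va
  obtain a0 where "annihilator_gen n A (0\<^sub>v n) a0" using ex[of "0\<^sub>v n"] by auto
  then have Q0: "Q (0\<^sub>v n, a0)" by (simp add: Q_def)
  have bound: "\<forall>va. Q va \<longrightarrow> degree (snd va) \<le> degree p0"
    using p0 p0A by (auto simp: Q_def annihilator_gen_def intro!: dvd_imp_degree_le)
  obtain va where va: "Q va" "\<And>wb. Q wb \<Longrightarrow> degree (snd wb) \<le> degree (snd va)"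
    using Lattices_Big.ex_has_greatest_nat[of Q "(0\<^sub>v n, a0)" "\<lambda>va. degree (snd va)" "Suc (degree p0)"]
      Q0 bound by (auto simp: less_Suc_eq_le)
  define v a where "v = fst va" and "a = snd va"
  have v: "v \<in> carrier_vec n" and a: "annihilator_gen n A v a" using va by (auto simp: Q_def v_def a_def)
  have max: "degree b \<le> degree a" if "w \<in> carrier_vec n" "annihilator_gen n A w b" for w b
    using va(2)[of "(w,b)"] that by (simp add: Q_def a_def)
  have a0: "a \<noteq> 0" using a by (simp add: annihilator_gen_def)
  show thesis
  proof (cases "degree a < n")
    case False
    have "poly_act n A q v \<noteq> 0\<^sub>v n" if "q \<noteq> 0" "degree q < n" for q
    proof
      assume "poly_act n A q v = 0\<^sub>v n"
      then have "a dvd q" using a by (simp add: annihilator_gen_def)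
      then have "degree a \<le> degree q" using that(1) by (rule dvd_imp_degree_le)
      with False that show False by simp
    qed
    with v show thesis by (rule that)
  next
    case True
    define P where "P wb \<longleftrightarrow> Q wb \<and> poly_act n A a (fst wb) \<noteq> 0\<^sub>v n" for wb
    obtain w0 where w0: "w0 \<in> carrier_vec n" "poly_act n A a w0 \<noteq> 0\<^sub>v n" using min[OF a0 True] by blast
    obtain b0 where "annihilator_gen n A w0 b0" using ex[OF w0(1)] by auto
    with w0 have P0: "P (w0, b0)" by (simp add: P_def Q_def)
    obtain wb where wb: "P wb" "\<And>x. P x \<Longrightarrow> degree (snd wb) \<le> degree (snd x)"
      using ex_has_least_nat[of P "(w0,b0)" "\<lambda>wb. degree (snd wb)"] P0 by blast
    define w b where "w = fst wb" and "b = snd wb"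
    have w: "w \<in> carrier_vec n" and b: "annihilator_gen n A w b" and aw: "poly_act n A a w \<noteq> 0\<^sub>v n"
      using wb by (auto simp: P_def Q_def w_def b_def)
    have minb: "degree b \<le> degree b'" if "w' \<in> carrier_vec n" "annihilator_gen n A w' b'"
      "poly_act n A a w' \<noteq> 0\<^sub>v n" for w' b'
      using wb(2)[of "(w',b')"] that by (simp add: P_def Q_def b_def)
    have b0: "b \<noteq> 0" and nab: "\<not> b dvd a" using b aw by (auto simp: annihilator_gen_def)
    \<comment> \<open>For a nonconstant divisor \<open>r\<close> of \<open>b\<close> the vector
      \<open>r w\<close> has an order of smaller degree, so by minimality \<open>a\<close> kills
      it.\<close>
    have proper: "b dvd r * a" if r: "r dvd b" "degree r > 0" for r
    proof -
      obtain s where s: "b = r * s" using r(1) by (rule dvdE)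
      have "degree s < degree b" using r(2) b0 unfolding s by (simp add: degree_mult_eq)
      moreover have "annihilator_gen n A (poly_act n A r w) s"
        using annihilator_gen_poly_act[OF A w] b s by simp
      ultimately have "poly_act n A a (poly_act n A r w) = 0\<^sub>v n"
        using minb[OF poly_act_carrier] by fastforce
      then have "poly_act n A (a * r) w = 0\<^sub>v n" by (simp add: poly_act_mult[OF A w])
      then show ?thesis using b by (simp add: annihilator_gen_def mult.commute)
    qed
    obtain g x y where g: "g = x * a + y * b" "g dvd a" "g dvd b" "g \<noteq> 0" using poly_bezout[OF a0] by blast
    obtain a' where a': "a = g * a'" using g(2) by (rule dvdE)
    obtain b' where b': "b = g * b'" using g(3) by (rule dvdE)
    have "g * (x * a' + y * b') = g * 1" using g(1) unfolding a' b' by (simp add: algebra_simps)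
    then have one: "x * a' + y * b' = 1" using g(4) mult_left_cancel by blast
    \<comment> \<open>A constant \<open>b'\<close> would make \<open>b\<close> a divisor of
      \<open>a\<close>, but \<open>a\<close> does not kill \<open>w\<close>.\<close>
    have deg0: "degree b' > 0"
    proof (rule ccontr)
      assume "\<not> degree b' > 0"
      moreover have "b' \<noteq> 0" using b0 b' by auto
      ultimately have "is_unit b'" by (simp add: is_unit_iff_degree)
      then have "b dvd g" unfolding b' by simp
      with g(2) nab show False using dvd_trans by blast
    qed
    \<comment> \<open>Cancelling \<open>g\<close> gives \<open>b' dvd r * a'\<close>, and
      \<open>a'\<close> and \<open>b'\<close> are coprime: \<open>b'\<close> divides every
      nonconstant divisor of \<open>b\<close>.\<close>
    have b'dvd: "b' dvd r" if "r dvd b" "degree r > 0" for r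
    proof -
      have "g * b' dvd g * (r * a')" using proper[OF that] unfolding a' b' by (simp add: algebra_simps)
      then have "b' dvd r * a'" using g(4) by simp
      then have "b' dvd x * (r * a') + (y * r) * b'" by (intro dvd_add[OF dvd_mult dvd_mult]) auto
      also have "x * (r * a') + (y * r) * b' = r"
        using arg_cong[OF one, of "\<lambda>z. r * z"] by (simp add: algebra_simps)
      finally show ?thesis .
    qed
    have va': "annihilator_gen n A (poly_act n A g v) a'"
      using annihilator_gen_poly_act[OF A v] a a' by simp
    have a'0: "a' \<noteq> 0" using a0 a' by auto
    obtain h x2 y2 where h: "h = x2 * a' + y2 * b" "h dvd a'" "h dvd b" "h \<noteq> 0" using poly_bezout[OF a'0] by blast
    \<comment> \<open>A nonconstant common divisor of \<open>a'\<close> and \<open>b\<close> would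
      be a multiple of \<open>b'\<close>, against the coprimality of \<open>a'\<close> and
      \<open>b'\<close>.\<close>
    have "degree h = 0"
    proof (rule ccontr)
      assume "degree h \<noteq> 0"
      then have "b' dvd a'" using b'dvd[OF h(3)] h(2) dvd_trans by blast
      then have "b' dvd x * a' + y * b'" by (intro dvd_add[OF dvd_mult dvd_mult]) auto
      then have "is_unit b'" using one by simp
      with deg0 show False by (simp add: is_unit_iff_degree split: if_splits)
    qed
    then have "is_unit h" using h(4) by (simp add: is_unit_iff_degree)
    then obtain i where i: "h * i = 1" by (metis dvdE)
    have rs: "(i * x2) * a' + (i * y2) * b = 1" using i unfolding h(1) by (simp add: algebra_simps)
    have vw: "poly_act n A g v + w \<in> carrier_vec n" using w by simp
    obtain c where c: "annihilator_gen n A (poly_act n A g v + w) c" using ex[OF vw] by blast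
    then have "a' * b dvd c"
      using annihilator_gen_add[OF A poly_act_carrier w va' b rs] by (simp add: annihilator_gen_def)
    moreover have "c \<noteq> 0" using c by (simp add: annihilator_gen_def)
    ultimately have "degree (a' * b) \<le> degree c" by (rule dvd_imp_degree_le)
    also have "\<dots> \<le> degree a" using max[OF vw c] .
    also have "\<dots> < degree (a' * b)"
      using a0 b0 deg0 unfolding a' b' by (auto simp: degree_mult_eq)
    finally show thesis by simp
  qed
qed

text \<open>Turns a linear relation among the first \<open>N\<close> iterates into a polynomial. It
  serves Krylov matrices with \<open>N = n\<close> and the eigenvector argument with
  \<open>N = d + 1\<close>.\<close>

lemma poly_act_coeff_vec:
  fixes A :: "'a::comm_ring_1 mat" and c :: "'a vec"
  assumes c: "c \<in> carrier_vec N" "c \<noteq> 0\<^sub>v N"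
  obtains q where "q \<noteq> 0" "degree q < N"
    "\<And>v. poly_act n A q v = vec n (\<lambda>i. \<Sum>k<N. c $ k * (((*\<^sub>v) A ^^ k) v) $ i)"
proof -
  have N: "N > 0"
  proof (rule ccontr)
    assume "\<not> N > 0"
    then have "c = 0\<^sub>v N" using c by (intro eq_vecI) auto
    with c show False by simp
  qed
  define q where "q = (\<Sum>k<N. monom (c $ k) k)"
  have q: "coeff q k = (if k < N then c $ k else 0)" for k
    unfolding q_def coeff_sum by simp
  have "q \<noteq> 0"
  proof
    assume "q = 0"
    then have "c = 0\<^sub>v N" using q c by (intro eq_vecI) (auto, metis coeff_0)
    with c show False by simp
  qed
  moreover have deg: "degree q \<le> N - 1" using q by (intro degree_le) auto
  moreover have "poly_act n A q v = vec n (\<lambda>i. \<Sum>k<N. c $ k * (((*\<^sub>v) A ^^ k) v) $ i)" for v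
  proof -
    have "{..N - 1} = {..<N}" using N by auto
    then show ?thesis unfolding poly_act_eq[OF deg] by (simp add: q)
  qed
  ultimately show thesis using N that[of q] by fastforce
qed

text \<open>The iterates of a cyclic vector are independent: a kernel vector of the Krylov matrix
  would be a nonzero polynomial of degree below \<open>n\<close> that kills
  \<open>v\<close>.\<close>

lemma regular_mat_krylov:
  fixes A :: "'a::field mat"
  assumes A: "A \<in> carrier_mat n n" and reg: "regular_mat A"
  obtains v where "v \<in> carrier_vec n" "det (krylov n A v) \<noteq> 0"
proof -
  have dim: "dim_row A = n" using A by simp
  have pe: "poly_eval_mat p A \<in> carrier_mat n n" for p by (simp add: poly_eval_mat_def dim)
  have deg: "degree (char_poly A) = n" and cp0: "char_poly A \<noteq> 0"
    using degree_monic_char_poly[OF A] by auto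
  have zero: "poly_act n A (char_poly A) w = 0\<^sub>v n" if "w \<in> carrier_vec n" for w
    using reg that zero_mat_mult_vec[OF that]
    by (simp add: regular_mat_def is_minimal_poly_def dim poly_eval_mat_poly_act[OF A, symmetric])
  have min: "\<exists>w\<in>carrier_vec n. poly_act n A q w \<noteq> 0\<^sub>v n" if q: "q \<noteq> 0" "degree q < n" for q
  proof (rule ccontr)
    assume *: "\<not> ?thesis"
    have "poly_eval_mat q A = 0\<^sub>m n n"
    proof (rule mat_col_eqI)
      fix j assume "j < dim_col (0\<^sub>m n n :: 'a mat)"
      then have j: "j < n" by simp
      have "col (poly_eval_mat q A) j = poly_eval_mat q A *\<^sub>v unit_vec n j"
        using mult_mat_unit_vec[OF pe] j by simp
      then show "col (poly_eval_mat q A) j = col (0\<^sub>m n n) j"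
        using * j by (simp add: poly_eval_mat_poly_act[OF A])
    qed (use pe in auto)
    then have "degree (char_poly A) \<le> degree q"
      using reg q by (simp add: regular_mat_def is_minimal_poly_def dim)
    with deg q show False by simp
  qed
  obtain v where v: "v \<in> carrier_vec n"
    "\<And>q. q \<noteq> 0 \<Longrightarrow> degree q < n \<Longrightarrow> poly_act n A q v \<noteq> 0\<^sub>v n"
    using cyclic_vector_exists[OF A cp0 zero min] by blast
  have "det (krylov n A v) \<noteq> 0"
  proof
    assume "det (krylov n A v) = 0"
    then obtain c where c: "c \<in> carrier_vec n" "c \<noteq> 0\<^sub>v n" "krylov n A v *\<^sub>v c = 0\<^sub>v n"
      using det_0_iff_vec_prod_zero_field[OF krylov_carrier] by blast
    obtain q where q: "q \<noteq> 0" "degree q < n"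
      "\<And>v. poly_act n A q v = vec n (\<lambda>i. \<Sum>k<n. c $ k * (((*\<^sub>v) A ^^ k) v) $ i)"
      using poly_act_coeff_vec[OF c(1,2), where A = A and n = n] by blast
    have "poly_act n A q v = krylov n A v *\<^sub>v c"
      unfolding q(3) by (rule eq_vecI)
        (use c(1) in \<open>auto simp: krylov_def scalar_prod_def lessThan_atLeast0 mult.commute\<close>)
    with c(3) v(2)[OF q(1,2)] show False by simp
  qed
  with v that show thesis by blast
qed

text \<open>The iterates of \<open>w\<close> under \<open>T\<close> are dependent, so a nonzero
  polynomial kills \<open>w\<close>. Splitting a root \<open>z\<close> off one of least degree
  leaves \<open>q\<close> such that \<open>q(T) w\<close> is nonzero and killed by
  \<open>T - z\<close>; closure keeps it in \<open>W\<close>.\<close>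

lemma invariant_subset_eigenvector:
  fixes T :: "complex mat"
  assumes T: "T \<in> carrier_mat d d" and w: "w \<in> W" "w \<noteq> 0\<^sub>v d" and W: "W \<subseteq> carrier_vec d"
    and add: "\<And>x y. x \<in> W \<Longrightarrow> y \<in> W \<Longrightarrow> x + y \<in> W" and smult: "\<And>c x. x \<in> W \<Longrightarrow> c \<cdot>\<^sub>v x \<in> W"
    and inv: "\<And>x. x \<in> W \<Longrightarrow> T *\<^sub>v x \<in> W"
  obtains y c where "y \<in> W" "y \<noteq> 0\<^sub>v d" "T *\<^sub>v y = c \<cdot>\<^sub>v y"
proof -
  have wc: "w \<in> carrier_vec d" using w W by auto
  have "0 \<cdot>\<^sub>v w = 0\<^sub>v d" using wc by auto
  then have zero: "0\<^sub>v d \<in> W" using smult[OF w(1), of 0] by simp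
  have mem: "poly_act d T p w \<in> W" for p
    by (induct p) (auto simp: poly_act_pCons[OF T wc] zero intro!: add smult inv w)
  \<comment> \<open>The \<open>d + 1\<close> iterates as columns, padded by a zero row to a square
    matrix, so that a vanishing determinant yields the relation.\<close>
  define M where "M = mat (Suc d) (Suc d) (\<lambda>(i,j). if i < d then (((*\<^sub>v) T ^^ j) w) $ i else 0)"
  have M: "M \<in> carrier_mat (Suc d) (Suc d)" by (simp add: M_def)
  have "M\<^sup>T *\<^sub>v unit_vec (Suc d) d = 0\<^sub>v (Suc d)"
  proof (rule eq_vecI)
    fix i assume "i < dim_vec (0\<^sub>v (Suc d) :: complex vec)"
    then show "(M\<^sup>T *\<^sub>v unit_vec (Suc d) d) $ i = (0\<^sub>v (Suc d)) $ i"
      by (simp add: mult_mat_unit_vec[of _ "Suc d" "Suc d"] M_def)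
  qed (simp add: M_def)
  then have "det (M\<^sup>T) = 0"
    using det_0_iff_vec_prod_zero_field[of "M\<^sup>T" "Suc d"] M
    by (metis lessI transpose_carrier_mat unit_vec_carrier unit_vec_nonzero)
  then have "det M = 0" using det_transpose[OF M] by simp
  then obtain c where c: "c \<in> carrier_vec (Suc d)" "c \<noteq> 0\<^sub>v (Suc d)" "M *\<^sub>v c = 0\<^sub>v (Suc d)"
    using det_0_iff_vec_prod_zero_field[OF M] by blast
  obtain p0 where p0: "p0 \<noteq> 0"
    "\<And>v. poly_act d T p0 v = vec d (\<lambda>i. \<Sum>k<Suc d. c $ k * (((*\<^sub>v) T ^^ k) v) $ i)"
    using poly_act_coeff_vec[OF c(1,2), where A = T and n = d] by blast
  have "poly_act d T p0 w = 0\<^sub>v d"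
  proof (rule eq_vecI)
    fix i assume "i < dim_vec (0\<^sub>v d :: complex vec)"
    then have i: "i < d" by simp
    have "(M *\<^sub>v c) $ i = (\<Sum>k<Suc d. c $ k * (((*\<^sub>v) T ^^ k) w) $ i)"
      using c(1) i by (simp add: M_def scalar_prod_def lessThan_atLeast0 mult.commute del: sum.lessThan_Suc sum.op_ivl_Suc)
    then show "poly_act d T p0 w $ i = 0\<^sub>v d $ i" unfolding p0 using c i by simp
  qed (simp add: poly_act_def)
  then obtain p where p: "p \<noteq> 0" "poly_act d T p w = 0\<^sub>v d"
    and min: "\<And>q. q \<noteq> 0 \<Longrightarrow> poly_act d T q w = 0\<^sub>v d \<Longrightarrow> degree p \<le> degree q"
    using ex_has_least_nat[of "\<lambda>p. p \<noteq> 0 \<and> poly_act d T p w = 0\<^sub>v d" p0 degree] p0(1) by blast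
  have "degree p \<noteq> 0"
  proof
    assume "degree p = 0"
    then obtain a where a: "p = [:a:]" by (rule degree_eq_zeroE)
    have "poly_act d T p w = a \<cdot>\<^sub>v w" unfolding a poly_act_pCons[OF T wc] using wc mat_mult_zero_vec[OF T] by simp
    with p have "a \<cdot>\<^sub>v w = 0\<^sub>v d" by simp
    then have "inverse a \<cdot>\<^sub>v (a \<cdot>\<^sub>v w) = 0\<^sub>v d" by auto
    then show False using a p w by (simp add: smult_smult_assoc)
  qed
  then obtain z where "poly p z = 0"
    using fundamental_theorem_of_algebra[of p] constant_degree[of p] by auto
  then obtain q where q: "p = [:- z, 1:] * q" by (auto simp: poly_eq_0_iff_dvd elim: dvdE)
  have q0: "q \<noteq> 0" using q p by auto
  have "degree q < degree p" unfolding q using q0 by (simp add: degree_mult_eq del: mult_pCons_left)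
  then have y: "poly_act d T q w \<noteq> 0\<^sub>v d" using min[OF q0] by fastforce
  let ?y = "poly_act d T q w"
  have "0\<^sub>v d = poly_act d T [:- z, 1:] ?y" using p(2) poly_act_mult[OF T wc, of "[:- z, 1:]" q] q by simp
  also have "\<dots> = (- z) \<cdot>\<^sub>v ?y + T *\<^sub>v (1 \<cdot>\<^sub>v ?y + T *\<^sub>v 0\<^sub>v d)"
    by (simp only: poly_act_pCons[OF T poly_act_carrier] poly_act_0)
  also have "1 \<cdot>\<^sub>v ?y + T *\<^sub>v 0\<^sub>v d = ?y" using mat_mult_zero_vec[OF T] by simp
  finally have e: "(- z) \<cdot>\<^sub>v ?y + T *\<^sub>v ?y = 0\<^sub>v d" by simp
  have "T *\<^sub>v ?y = z \<cdot>\<^sub>v ?y"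
  proof (rule eq_vecI)
    fix i assume "i < dim_vec (z \<cdot>\<^sub>v ?y)"
    then have i: "i < d" by (simp add: poly_act_def)
    have "((- z) \<cdot>\<^sub>v ?y + T *\<^sub>v ?y) $ i = 0" using e i by simp
    then show "(T *\<^sub>v ?y) $ i = (z \<cdot>\<^sub>v ?y) $ i"
      using i T by (simp add: poly_act_def[of d T q] del: index_mult_mat_vec)
  qed (use T in \<open>simp add: poly_act_def\<close>)
  with y mem that show thesis by blast
qed

section \<open>Multiplicity one for the generic character\<close>

definition vsum :: "nat \<Rightarrow> ('s \<Rightarrow> 'a::comm_ring_1 vec) \<Rightarrow> 's set \<Rightarrow> 'a vec" where
  "vsum d f S = vec d (\<lambda>i. \<Sum>s\<in>S. f s $ i)"

lemma vsum_carrier [simp]: "vsum d f S \<in> carrier_vec d"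
  by (simp add: vsum_def)

lemma vsum_cong: "(\<And>s. s \<in> S \<Longrightarrow> f s = g s) \<Longrightarrow> vsum d f S = vsum d g S"
  by (auto simp: vsum_def)

lemma vsum_reindex: "inj_on h S \<Longrightarrow> vsum d f (h ` S) = vsum d (\<lambda>s. f (h s)) S"
  by (auto simp: vsum_def sum.reindex)

lemma vsum_swap: "vsum d (\<lambda>s. vsum d (f s) T) S = vsum d (\<lambda>t. vsum d (\<lambda>s. f s t) S) T"
  by (auto simp: vsum_def sum.swap[of _ S T])

lemma vsum_const: "v \<in> carrier_vec d \<Longrightarrow> vsum d (\<lambda>_. v) S = of_nat (card S) \<cdot>\<^sub>v v"
  by (rule eq_vecI) (auto simp: vsum_def)

lemma vsum_smult_const: "v \<in> carrier_vec d \<Longrightarrow> vsum d (\<lambda>s. c s \<cdot>\<^sub>v v) S = (\<Sum>s\<in>S. c s) \<cdot>\<^sub>v v"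
  by (rule eq_vecI) (auto simp: vsum_def sum_distrib_right)

lemma smult_vsum:
  assumes "\<And>s. s \<in> S \<Longrightarrow> f s \<in> carrier_vec d"
  shows "c \<cdot>\<^sub>v vsum d f S = vsum d (\<lambda>s. c \<cdot>\<^sub>v f s) S"
proof (rule eq_vecI)
  fix i assume "i < dim_vec (vsum d (\<lambda>s. c \<cdot>\<^sub>v f s) S)"
  then have i: "i < d" by (simp add: vsum_def)
  have "(\<Sum>s\<in>S. (c \<cdot>\<^sub>v f s) $ i) = (\<Sum>s\<in>S. c * f s $ i)"
    using assms i by (intro sum.cong refl) (metis carrier_vecD index_smult_vec(1))
  then show "(c \<cdot>\<^sub>v vsum d f S) $ i = vsum d (\<lambda>s. c \<cdot>\<^sub>v f s) S $ i"
    using i by (simp add: vsum_def sum_distrib_left)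
qed (simp add: vsum_def)

lemma mult_mat_vsum:
  assumes A: "A \<in> carrier_mat e d" and f: "\<And>s. s \<in> S \<Longrightarrow> f s \<in> carrier_vec d"
  shows "A *\<^sub>v vsum d f S = vsum e (\<lambda>s. A *\<^sub>v f s) S"
proof (rule eq_vecI)
  fix i assume "i < dim_vec (vsum e (\<lambda>s. A *\<^sub>v f s) S)"
  then have i: "i < e" by (simp add: vsum_def)
  have "(A *\<^sub>v vsum d f S) $ i = (\<Sum>t<d. A $$ (i,t) * (\<Sum>s\<in>S. f s $ t))"
    using A i by (simp add: vsum_def scalar_prod_def lessThan_atLeast0)
  also have "\<dots> = (\<Sum>s\<in>S. \<Sum>t<d. A $$ (i,t) * f s $ t)"
    by (simp add: sum_distrib_left) (rule sum.swap)
  also have "\<dots> = (\<Sum>s\<in>S. (A *\<^sub>v f s) $ i)"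
  proof (rule sum.cong[OF refl])
    fix s assume "s \<in> S"
    then show "(\<Sum>t<d. A $$ (i,t) * f s $ t) = (A *\<^sub>v f s) $ i"
      using A i f[of s] by (simp add: scalar_prod_def lessThan_atLeast0)
  qed
  finally show "(A *\<^sub>v vsum d f S) $ i = vsum e (\<lambda>s. A *\<^sub>v f s) S $ i" using i by (simp add: vsum_def)
qed (use A in \<open>simp add: vsum_def\<close>)

lemma smult_zero_vec: "c \<cdot>\<^sub>v 0\<^sub>v d = (0\<^sub>v d :: 'a::comm_ring_1 vec)"
  by auto

lemma smult_vec_eq_zero_iff:
  fixes v :: "'a::field vec"
  assumes "v \<in> carrier_vec d" shows "c \<cdot>\<^sub>v v = 0\<^sub>v d \<longleftrightarrow> c = 0 \<or> v = 0\<^sub>v d"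
proof
  assume *: "c \<cdot>\<^sub>v v = 0\<^sub>v d"
  show "c = 0 \<or> v = 0\<^sub>v d"
  proof (rule disjCI)
    assume "v \<noteq> 0\<^sub>v d"
    then obtain i where "i < d" "v $ i \<noteq> 0" using assms by (metis carrier_vecD eq_vecI index_zero_vec)
    then show "c = 0" using * assms by (metis carrier_vecD index_smult_vec(1) index_zero_vec(1) mult_eq_0_iff)
  qed
qed (use assms in auto)

section \<open>The averaging operator of \<open>\<psi>\<close>\<close>

locale irreducible_GL_rep = primitive_char \<phi>
  for \<phi> :: "'r::comm_ring_1 \<Rightarrow> complex" +
  fixes n d :: nat and \<rho> :: "'r mat \<Rightarrow> complex mat"
  assumes irreducible: "irreducible_rep (GL n) n \<rho> d"
begin

lemma rep_carrier: "g \<in> GL n \<Longrightarrow> \<rho> g \<in> carrier_mat d d"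
  and rep_one: "\<rho> (1\<^sub>m n) = 1\<^sub>m d"
  and rep_mult: "g \<in> GL n \<Longrightarrow> h \<in> GL n \<Longrightarrow> \<rho> (g * h) = \<rho> g * \<rho> h"
  using irreducible by (auto simp: irreducible_rep_def is_rep_def)

lemma rep_vec_carrier: "g \<in> GL n \<Longrightarrow> v \<in> carrier_vec d \<Longrightarrow> \<rho> g *\<^sub>v v \<in> carrier_vec d"
  by (rule mult_mat_vec_carrier[OF rep_carrier])

lemma rep_mult_vec:
  "g \<in> GL n \<Longrightarrow> h \<in> GL n \<Longrightarrow> v \<in> carrier_vec d \<Longrightarrow> \<rho> (g * h) *\<^sub>v v = \<rho> g *\<^sub>v (\<rho> h *\<^sub>v v)"
  by (simp add: rep_mult assoc_mult_mat_vec[OF rep_carrier rep_carrier])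

lemma rep_one_vec: "v \<in> carrier_vec d \<Longrightarrow> \<rho> (1\<^sub>m n) *\<^sub>v v = v"
  by (simp add: rep_one)

lemma one_GL: "1\<^sub>m n \<in> GL n"
  by (simp add: GL_def)

lemma rep_vec_smult:
  "g \<in> GL n \<Longrightarrow> v \<in> carrier_vec d \<Longrightarrow> \<rho> g *\<^sub>v (c \<cdot>\<^sub>v v) = c \<cdot>\<^sub>v (\<rho> g *\<^sub>v v)"
  by (rule mult_mat_vec[OF rep_carrier])

lemma invariant_subspace_everything:
  assumes "W \<subseteq> carrier_vec d" "w \<in> W" "w \<noteq> 0\<^sub>v d"
    and "\<And>v w. v \<in> W \<Longrightarrow> w \<in> W \<Longrightarrow> v + w \<in> W" "\<And>c v. v \<in> W \<Longrightarrow> c \<cdot>\<^sub>v v \<in> W"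
    and "\<And>g v. g \<in> GL n \<Longrightarrow> v \<in> W \<Longrightarrow> \<rho> g *\<^sub>v v \<in> W"
  shows "W = carrier_vec d"
proof -
  have "w \<in> carrier_vec d" using assms(1,2) by blast
  then have "0 \<cdot>\<^sub>v w = 0\<^sub>v d" by auto
  then have "0\<^sub>v d \<in> W" using assms(5)[OF assms(2), of 0] by simp
  then have "invariant_subspace (GL n) \<rho> d W" using assms by (auto simp: invariant_subspace_def)
  then show ?thesis using irreducible assms by (auto simp: irreducible_rep_def)
qed

definition \<psi> :: "'r mat \<Rightarrow> complex" where "\<psi> u = \<phi> (superdiag_sum u)"

lemma psi_nonzero [simp]: "\<psi> u \<noteq> 0"
  by (simp add: \<psi>_def)

lemma psi_mult: "u \<in> unitriangular n \<Longrightarrow> u' \<in> unitriangular n \<Longrightarrow> \<psi> (u * u') = \<psi> u * \<psi> u'"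
  by (simp add: \<psi>_def superdiag_sum_mult char_add)

text \<open>The projector onto the \<open>\<psi>\<close>-eigenspace of \<open>U\<close>, multiplied
  by the order of \<open>U\<close>. The normalisation is dropped, since only rank and commutation
  relations matter. It is written \<open>P\<close> in the comments below.\<close>

definition whittaker :: "complex mat" where
  "whittaker = mat d d (\<lambda>(i,j). \<Sum>u\<in>unitriangular n. inverse (\<psi> u) * \<rho> u $$ (i,j))"

lemma whittaker_carrier: "whittaker \<in> carrier_mat d d"
  by (simp add: whittaker_def)

lemma whittaker_vec_carrier [simp]: "whittaker *\<^sub>v v \<in> carrier_vec d"
  by (rule carrier_vecI) (simp add: whittaker_def)

lemma finite_unitriangular: "finite (unitriangular n :: 'r mat set)"
  by (rule finite_subset[OF _ finite_carrier_mat[OF finite_ring, of n n]]) (rule subsetI, erule unitriangular_carrier)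

lemma whittaker_apply:
  assumes v: "v \<in> carrier_vec d"
  shows "whittaker *\<^sub>v v = vsum d (\<lambda>u. inverse (\<psi> u) \<cdot>\<^sub>v (\<rho> u *\<^sub>v v)) (unitriangular n)"
proof (rule eq_vecI)
  fix i assume "i < dim_vec (vsum d (\<lambda>u. inverse (\<psi> u) \<cdot>\<^sub>v (\<rho> u *\<^sub>v v)) (unitriangular n))"
  then have i: "i < d" by (simp add: vsum_def)
  have "(whittaker *\<^sub>v v) $ i =
      (\<Sum>t<d. (\<Sum>u\<in>unitriangular n. inverse (\<psi> u) * \<rho> u $$ (i,t)) * v $ t)"
    using v i by (simp add: whittaker_def scalar_prod_def lessThan_atLeast0)
  also have "\<dots> = (\<Sum>u\<in>unitriangular n. inverse (\<psi> u) * (\<Sum>t<d. \<rho> u $$ (i,t) * v $ t))"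
    by (simp add: sum_distrib_left sum_distrib_right mult.assoc) (rule sum.swap)
  also have "\<dots> = (\<Sum>u\<in>unitriangular n. (inverse (\<psi> u) \<cdot>\<^sub>v (\<rho> u *\<^sub>v v)) $ i)"
  proof (rule sum.cong[OF refl])
    fix u :: "'r mat" assume "u \<in> unitriangular n"
    then have "\<rho> u \<in> carrier_mat d d" using rep_carrier unitriangular_GL by blast
    then show "inverse (\<psi> u) * (\<Sum>t<d. \<rho> u $$ (i,t) * v $ t) = (inverse (\<psi> u) \<cdot>\<^sub>v (\<rho> u *\<^sub>v v)) $ i"
      using v i by (simp add: scalar_prod_def lessThan_atLeast0)
  qed
  finally show "(whittaker *\<^sub>v v) $ i = vsum d (\<lambda>u. inverse (\<psi> u) \<cdot>\<^sub>v (\<rho> u *\<^sub>v v)) (unitriangular n) $ i"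
    using i by (simp add: vsum_def)
qed (simp add: whittaker_def vsum_def)

lemma whittaker_smult: "v \<in> carrier_vec d \<Longrightarrow> whittaker *\<^sub>v (c \<cdot>\<^sub>v v) = c \<cdot>\<^sub>v (whittaker *\<^sub>v v)"
  by (rule mult_mat_vec[OF whittaker_carrier])

lemma rep_whittaker:
  assumes a: "a \<in> unitriangular n" and v: "v \<in> carrier_vec d"
  shows "\<rho> a *\<^sub>v (whittaker *\<^sub>v v) = \<psi> a \<cdot>\<^sub>v (whittaker *\<^sub>v v)"
proof -
  let ?U = "unitriangular n :: 'r mat set"
  have aG: "a \<in> GL n" using a unitriangular_GL by blast
  have uc: "\<rho> u *\<^sub>v v \<in> carrier_vec d" if "u \<in> ?U" for u
    using that v rep_vec_carrier unitriangular_GL by blast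
  have inj: "inj_on (\<lambda>u. a * u) ?U"
    using mult_left_inj_on_carrier[OF aG] unitriangular_carrier by (auto intro: inj_on_subset)
  have "(\<lambda>u. a * u) ` ?U \<subseteq> ?U" using unitriangular_mult[OF a] by auto
  then have im: "(\<lambda>u. a * u) ` ?U = ?U" using inj finite_unitriangular by (simp add: endo_inj_surj)
  have "\<rho> a *\<^sub>v (whittaker *\<^sub>v v) = vsum d (\<lambda>u. \<rho> a *\<^sub>v (inverse (\<psi> u) \<cdot>\<^sub>v (\<rho> u *\<^sub>v v))) ?U"
    unfolding whittaker_apply[OF v] using uc by (intro mult_mat_vsum[OF rep_carrier[OF aG]]) auto
  also have "\<dots> = vsum d (\<lambda>u. \<psi> a \<cdot>\<^sub>v (inverse (\<psi> (a * u)) \<cdot>\<^sub>v (\<rho> (a * u) *\<^sub>v v))) ?U"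
  proof (rule vsum_cong)
    fix u assume u: "u \<in> ?U"
    then have uG: "u \<in> GL n" using unitriangular_GL by blast
    show "\<rho> a *\<^sub>v (inverse (\<psi> u) \<cdot>\<^sub>v (\<rho> u *\<^sub>v v)) =
        \<psi> a \<cdot>\<^sub>v (inverse (\<psi> (a * u)) \<cdot>\<^sub>v (\<rho> (a * u) *\<^sub>v v))"
      using rep_vec_smult[OF aG uc[OF u]] rep_mult_vec[OF aG uG v] psi_mult[OF a u]
      by (simp add: smult_smult_assoc field_simps)
  qed
  also have "\<dots> = \<psi> a \<cdot>\<^sub>v vsum d (\<lambda>u. inverse (\<psi> (a * u)) \<cdot>\<^sub>v (\<rho> (a * u) *\<^sub>v v)) ?U"
    using unitriangular_mult[OF a] uc by (intro smult_vsum[symmetric]) auto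
  also have "vsum d (\<lambda>u. inverse (\<psi> (a * u)) \<cdot>\<^sub>v (\<rho> (a * u) *\<^sub>v v)) ?U = whittaker *\<^sub>v v"
    unfolding whittaker_apply[OF v] using vsum_reindex[OF inj, of d "\<lambda>u. inverse (\<psi> u) \<cdot>\<^sub>v (\<rho> u *\<^sub>v v)"] im
    by simp
  finally show ?thesis .
qed

lemma whittaker_rep:
  assumes a: "a \<in> unitriangular n" and v: "v \<in> carrier_vec d"
  shows "whittaker *\<^sub>v (\<rho> a *\<^sub>v v) = \<psi> a \<cdot>\<^sub>v (whittaker *\<^sub>v v)"
proof -
  let ?U = "unitriangular n :: 'r mat set"
  have aG: "a \<in> GL n" using a unitriangular_GL by blast
  have uc: "\<rho> u *\<^sub>v v \<in> carrier_vec d" if "u \<in> ?U" for u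
    using that v rep_vec_carrier unitriangular_GL by blast
  obtain b where b: "b \<in> unitriangular n" "a * b = 1\<^sub>m n"
    using unitriangular_inverse[OF finite_ring a] by blast
  have inj: "inj_on (\<lambda>u. u * a) ?U"
  proof (rule inj_on_inverseI[of _ "\<lambda>u. u * b"])
    fix u assume "u \<in> ?U"
    then have "u \<in> carrier_mat n n" by (rule unitriangular_carrier)
    then show "u * a * b = u"
      using assoc_mult_mat[of u n n a n b n] unitriangular_carrier[OF a] unitriangular_carrier[OF b(1)] b(2)
      by simp
  qed
  have "(\<lambda>u. u * a) ` ?U \<subseteq> ?U" using unitriangular_mult[OF _ a] by auto
  then have im: "(\<lambda>u. u * a) ` ?U = ?U" using inj finite_unitriangular by (simp add: endo_inj_surj)
  have "whittaker *\<^sub>v (\<rho> a *\<^sub>v v) = vsum d (\<lambda>u. inverse (\<psi> u) \<cdot>\<^sub>v (\<rho> u *\<^sub>v (\<rho> a *\<^sub>v v))) ?U"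
    by (rule whittaker_apply[OF rep_vec_carrier[OF aG v]])
  also have "\<dots> = vsum d (\<lambda>u. \<psi> a \<cdot>\<^sub>v (inverse (\<psi> (u * a)) \<cdot>\<^sub>v (\<rho> (u * a) *\<^sub>v v))) ?U"
  proof (rule vsum_cong)
    fix u assume u: "u \<in> ?U"
    then have uG: "u \<in> GL n" using unitriangular_GL by blast
    show "inverse (\<psi> u) \<cdot>\<^sub>v (\<rho> u *\<^sub>v (\<rho> a *\<^sub>v v)) =
        \<psi> a \<cdot>\<^sub>v (inverse (\<psi> (u * a)) \<cdot>\<^sub>v (\<rho> (u * a) *\<^sub>v v))"
      using rep_mult_vec[OF uG aG v] psi_mult[OF u a] by (simp add: smult_smult_assoc field_simps)
  qed
  also have "\<dots> = \<psi> a \<cdot>\<^sub>v vsum d (\<lambda>u. inverse (\<psi> (u * a)) \<cdot>\<^sub>v (\<rho> (u * a) *\<^sub>v v)) ?U"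
    using unitriangular_mult[OF _ a] uc by (intro smult_vsum[symmetric]) auto
  also have "vsum d (\<lambda>u. inverse (\<psi> (u * a)) \<cdot>\<^sub>v (\<rho> (u * a) *\<^sub>v v)) ?U = whittaker *\<^sub>v v"
    unfolding whittaker_apply[OF v] using vsum_reindex[OF inj, of d "\<lambda>u. inverse (\<psi> u) \<cdot>\<^sub>v (\<rho> u *\<^sub>v v)"] im
    by simp
  finally show ?thesis .
qed

text \<open>The compressed operator \<open>P \<rho>(g) P\<close> is determined by one representative
  of each double coset of \<open>U\<close>: this is the Hecke algebra of \<open>\<psi>\<close> in
  operator form.\<close>

lemma whittaker_bi_equivariant:
  assumes a: "a \<in> unitriangular n" and b: "b \<in> unitriangular n" and g: "g \<in> GL n" and v: "v \<in> carrier_vec d"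
  shows "whittaker *\<^sub>v (\<rho> (a * (g * b)) *\<^sub>v (whittaker *\<^sub>v v)) =
    (\<psi> a * \<psi> b) \<cdot>\<^sub>v (whittaker *\<^sub>v (\<rho> g *\<^sub>v (whittaker *\<^sub>v v)))"
proof -
  have G: "a \<in> GL n" "b \<in> GL n" "g * b \<in> GL n" using a b g unitriangular_GL by (auto intro: GL_mult)
  have w: "whittaker *\<^sub>v v \<in> carrier_vec d" by simp
  have c: "\<rho> g *\<^sub>v (whittaker *\<^sub>v v) \<in> carrier_vec d" "\<rho> (g * b) *\<^sub>v (whittaker *\<^sub>v v) \<in> carrier_vec d"
    using rep_vec_carrier G g w by auto
  have "whittaker *\<^sub>v (\<rho> (a * (g * b)) *\<^sub>v (whittaker *\<^sub>v v)) =
      \<psi> a \<cdot>\<^sub>v (whittaker *\<^sub>v (\<rho> (g * b) *\<^sub>v (whittaker *\<^sub>v v)))"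
    unfolding rep_mult_vec[OF G(1,3) w] by (rule whittaker_rep[OF a c(2)])
  also have "\<rho> (g * b) *\<^sub>v (whittaker *\<^sub>v v) = \<psi> b \<cdot>\<^sub>v (\<rho> g *\<^sub>v (whittaker *\<^sub>v v))"
    unfolding rep_mult_vec[OF g G(2) w] rep_whittaker[OF b v] by (rule rep_vec_smult[OF g w])
  finally show ?thesis unfolding whittaker_smult[OF c(1)] by (simp add: smult_smult_assoc)
qed

text \<open>Where \<open>\<psi>\<close> is incompatible with \<open>g\<close> both sides are 0,
  since the reflected witnesses, in exchanged order, are witnesses for the reflected element.
  Otherwise \<open>g\<close> and its reflection share a double coset with equal character
  values.\<close>

lemma whittaker_anti_transpose:
  assumes g: "g \<in> GL n" and v: "v \<in> carrier_vec d"
  shows "whittaker *\<^sub>v (\<rho> g *\<^sub>v (whittaker *\<^sub>v v)) =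
    whittaker *\<^sub>v (\<rho> (anti_transpose n g) *\<^sub>v (whittaker *\<^sub>v v))"
  using unitriangular_double_coset_dichotomy[OF g]
proof (elim disjE bexE conjE)
  note tG = anti_transpose_GL[OF g]
  have vanish: "whittaker *\<^sub>v (\<rho> k *\<^sub>v (whittaker *\<^sub>v v)) = 0\<^sub>v d"
    if k: "k \<in> GL n" and hh: "h \<in> unitriangular n" "h' \<in> unitriangular n" "k * h = h' * k" "\<psi> h \<noteq> \<psi> h'"
    for k h h'
  proof -
    let ?y = "whittaker *\<^sub>v (\<rho> k *\<^sub>v (whittaker *\<^sub>v v))"
    have c: "k \<in> carrier_mat n n" "h \<in> carrier_mat n n" "h' \<in> carrier_mat n n"
      using k hh GL_carrier unitriangular_carrier by auto
    have "1\<^sub>m n * (k * h) = h' * (k * 1\<^sub>m n)" using c hh(3) by simp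
    then have "(\<psi> (1\<^sub>m n) * \<psi> h) \<cdot>\<^sub>v ?y = (\<psi> h' * \<psi> (1\<^sub>m n)) \<cdot>\<^sub>v ?y"
      using whittaker_bi_equivariant[OF one_unitriangular hh(1) k v]
        whittaker_bi_equivariant[OF hh(2) one_unitriangular k v] by simp
    then have e: "\<psi> h \<cdot>\<^sub>v ?y = \<psi> h' \<cdot>\<^sub>v ?y" by (simp add: \<psi>_def superdiag_sum_one)
    have "(\<psi> h - \<psi> h') \<cdot>\<^sub>v ?y = 0\<^sub>v d"
    proof (rule eq_vecI)
      fix i assume "i < dim_vec (0\<^sub>v d :: complex vec)"
      then have i: "i < dim_vec ?y" using whittaker_carrier by simp
      have "(\<psi> h \<cdot>\<^sub>v ?y) $ i = (\<psi> h' \<cdot>\<^sub>v ?y) $ i" using e by simp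
      then show "((\<psi> h - \<psi> h') \<cdot>\<^sub>v ?y) $ i = 0\<^sub>v d $ i"
        using i \<open>i < dim_vec (0\<^sub>v d)\<close> by (simp add: algebra_simps del: index_mult_mat_vec)
    qed (use whittaker_carrier in simp)
    then show ?thesis using smult_vec_eq_zero_iff[of ?y d] hh(4) by simp
  qed
  {
    fix h h' :: "'r mat"
    assume h: "h \<in> unitriangular n" "h' \<in> unitriangular n" "g * h = h' * g"
      "\<phi> (superdiag_sum h) \<noteq> \<phi> (superdiag_sum h')"
    have c: "g \<in> carrier_mat n n" "h \<in> carrier_mat n n" "h' \<in> carrier_mat n n"
      using g h GL_carrier unitriangular_carrier by auto
    have "anti_transpose n g * anti_transpose n h' = anti_transpose n h * anti_transpose n g"
      using arg_cong[OF h(3), of "anti_transpose n"] c by (simp add: anti_transpose_mult)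
    moreover have "\<psi> (anti_transpose n h') \<noteq> \<psi> (anti_transpose n h)"
      using h c by (simp add: \<psi>_def superdiag_sum_anti_transpose)
    ultimately show ?thesis
      using vanish[OF g h(1,2,3)] h(4)
        vanish[OF tG anti_transpose_unitriangular[OF h(2)] anti_transpose_unitriangular[OF h(1)]]
      by (simp add: \<psi>_def)
  next
    fix u1 u2 u3 u4 :: "'r mat"
    assume u: "u1 \<in> unitriangular n" "u2 \<in> unitriangular n" "u3 \<in> unitriangular n" "u4 \<in> unitriangular n"
      "u1 * (g * u2) = u3 * (anti_transpose n g * u4)"
      "superdiag_sum u1 + superdiag_sum u2 = superdiag_sum u3 + superdiag_sum u4"
    let ?y = "whittaker *\<^sub>v (\<rho> g *\<^sub>v (whittaker *\<^sub>v v))"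
    let ?z = "whittaker *\<^sub>v (\<rho> (anti_transpose n g) *\<^sub>v (whittaker *\<^sub>v v))"
    have p: "\<psi> u1 * \<psi> u2 = \<psi> u3 * \<psi> u4" using u(6) by (simp add: \<psi>_def flip: char_add)
    have "(\<psi> u1 * \<psi> u2) \<cdot>\<^sub>v ?y = (\<psi> u1 * \<psi> u2) \<cdot>\<^sub>v ?z"
      using whittaker_bi_equivariant[OF u(1,2) g v] whittaker_bi_equivariant[OF u(3,4) tG v] u(5) p by simp
    then have "inverse (\<psi> u1 * \<psi> u2) \<cdot>\<^sub>v ((\<psi> u1 * \<psi> u2) \<cdot>\<^sub>v ?y) = inverse (\<psi> u1 * \<psi> u2) \<cdot>\<^sub>v ((\<psi> u1 * \<psi> u2) \<cdot>\<^sub>v ?z)"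
      by simp
    then show ?thesis by (simp add: smult_smult_assoc del: inverse_mult_distrib)
  }
qed

text \<open>Expanding the middle \<open>P\<close> writes a product of two Hecke operators as a
  combination of single ones, the shape to which invariance under reflection applies.\<close>

lemma whittaker_triple_sum:
  assumes g: "g \<in> GL n" and h: "h \<in> GL n" and v: "v \<in> carrier_vec d"
  shows "whittaker *\<^sub>v (\<rho> g *\<^sub>v (whittaker *\<^sub>v (\<rho> h *\<^sub>v (whittaker *\<^sub>v v)))) =
    vsum d (\<lambda>u. inverse (\<psi> u) \<cdot>\<^sub>v (whittaker *\<^sub>v (\<rho> (g * (u * h)) *\<^sub>v (whittaker *\<^sub>v v)))) (unitriangular n)"
proof -
  let ?U = "unitriangular n :: 'r mat set"
  have w: "whittaker *\<^sub>v v \<in> carrier_vec d" by simp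
  have hw: "\<rho> h *\<^sub>v (whittaker *\<^sub>v v) \<in> carrier_vec d" using rep_vec_carrier h w by auto
  have uc: "\<rho> u *\<^sub>v (\<rho> h *\<^sub>v (whittaker *\<^sub>v v)) \<in> carrier_vec d" if "u \<in> ?U" for u
    using that hw rep_vec_carrier unitriangular_GL by blast
  have "\<rho> g *\<^sub>v (whittaker *\<^sub>v (\<rho> h *\<^sub>v (whittaker *\<^sub>v v))) =
      vsum d (\<lambda>u. \<rho> g *\<^sub>v (inverse (\<psi> u) \<cdot>\<^sub>v (\<rho> u *\<^sub>v (\<rho> h *\<^sub>v (whittaker *\<^sub>v v))))) ?U"
    unfolding whittaker_apply[OF hw] using uc by (intro mult_mat_vsum[OF rep_carrier[OF g]]) auto
  also have "\<dots> = vsum d (\<lambda>u. inverse (\<psi> u) \<cdot>\<^sub>v (\<rho> (g * (u * h)) *\<^sub>v (whittaker *\<^sub>v v))) ?U"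
  proof (rule vsum_cong)
    fix u assume u: "u \<in> ?U"
    then have uG: "u \<in> GL n" using unitriangular_GL by blast
    show "\<rho> g *\<^sub>v (inverse (\<psi> u) \<cdot>\<^sub>v (\<rho> u *\<^sub>v (\<rho> h *\<^sub>v (whittaker *\<^sub>v v)))) =
        inverse (\<psi> u) \<cdot>\<^sub>v (\<rho> (g * (u * h)) *\<^sub>v (whittaker *\<^sub>v v))"
      unfolding rep_vec_smult[OF g uc[OF u]] rep_mult_vec[OF g GL_mult[OF uG h] w] rep_mult_vec[OF uG h w] ..
  qed
  also have "whittaker *\<^sub>v \<dots> =
      vsum d (\<lambda>u. whittaker *\<^sub>v (inverse (\<psi> u) \<cdot>\<^sub>v (\<rho> (g * (u * h)) *\<^sub>v (whittaker *\<^sub>v v)))) ?U"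
    using rep_vec_carrier[OF GL_mult[OF g GL_mult[OF unitriangular_GL h]] w]
    by (intro mult_mat_vsum[OF whittaker_carrier]) auto
  also have "\<dots> = vsum d (\<lambda>u. inverse (\<psi> u) \<cdot>\<^sub>v (whittaker *\<^sub>v (\<rho> (g * (u * h)) *\<^sub>v (whittaker *\<^sub>v v)))) ?U"
    using rep_vec_carrier[OF GL_mult[OF g GL_mult[OF unitriangular_GL h]] w]
    by (intro vsum_cong whittaker_smult) auto
  finally show ?thesis .
qed

text \<open>Gelfand's trick: by the preceding lemmas, the anti-automorphism \<open>anti_transpose\<close> induces the
  identity on the algebra spanned by these operators.\<close>
lemma whittaker_commute:
  assumes g: "g \<in> GL n" and h: "h \<in> GL n" and v: "v \<in> carrier_vec d"
  shows "whittaker *\<^sub>v (\<rho> g *\<^sub>v (whittaker *\<^sub>v (\<rho> h *\<^sub>v (whittaker *\<^sub>v v)))) =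
    whittaker *\<^sub>v (\<rho> h *\<^sub>v (whittaker *\<^sub>v (\<rho> g *\<^sub>v (whittaker *\<^sub>v v))))"
proof -
  let ?U = "unitriangular n :: 'r mat set" and ?t = "anti_transpose n"
  have w: "whittaker *\<^sub>v v \<in> carrier_vec d" by simp
  have c: "g \<in> carrier_mat n n" "h \<in> carrier_mat n n" using g h GL_carrier by auto
  have inj: "inj_on ?t ?U"
    by (rule inj_on_inverseI[of _ ?t]) (use anti_transpose_anti_transpose unitriangular_carrier in blast)
  have "?t ` ?U \<subseteq> ?U" using anti_transpose_unitriangular by auto
  then have im: "?t ` ?U = ?U" using inj finite_unitriangular by (simp add: endo_inj_surj)
  let ?F = "\<lambda>u. inverse (\<psi> u) \<cdot>\<^sub>v (whittaker *\<^sub>v (\<rho> (?t g * (u * ?t h)) *\<^sub>v (whittaker *\<^sub>v v)))"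
  have "whittaker *\<^sub>v (\<rho> h *\<^sub>v (whittaker *\<^sub>v (\<rho> g *\<^sub>v (whittaker *\<^sub>v v)))) =
      vsum d (\<lambda>u. inverse (\<psi> u) \<cdot>\<^sub>v (whittaker *\<^sub>v (\<rho> (h * (u * g)) *\<^sub>v (whittaker *\<^sub>v v)))) ?U"
    by (rule whittaker_triple_sum[OF h g v])
  also have "\<dots> = vsum d (\<lambda>u. ?F (?t u)) ?U"
  proof (rule vsum_cong)
    fix u assume u: "u \<in> ?U"
    then have uG: "u \<in> GL n" and uc: "u \<in> carrier_mat n n" using unitriangular_GL unitriangular_carrier by auto
    \<comment> \<open>Reflection reverses the product and so exchanges the places of
      \<open>g\<close> and \<open>h\<close>; the summation variable absorbs its own
      reflection.\<close>
    have "?t (h * (u * g)) = ?t g * (?t u * ?t h)"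
      using c uc by (simp add: anti_transpose_mult assoc_mult_mat[of _ n n _ n _ n])
    then show "inverse (\<psi> u) \<cdot>\<^sub>v (whittaker *\<^sub>v (\<rho> (h * (u * g)) *\<^sub>v (whittaker *\<^sub>v v))) = ?F (?t u)"
      using whittaker_anti_transpose[OF GL_mult[OF h GL_mult[OF uG g]] v] uc
      by (simp add: \<psi>_def superdiag_sum_anti_transpose)
  qed
  also have "\<dots> = vsum d ?F ?U" using vsum_reindex[OF inj, of d ?F] im by simp
  also have "\<dots> = whittaker *\<^sub>v (\<rho> (?t g) *\<^sub>v (whittaker *\<^sub>v (\<rho> (?t h) *\<^sub>v (whittaker *\<^sub>v v))))"
    by (rule whittaker_triple_sum[OF anti_transpose_GL[OF g] anti_transpose_GL[OF h] v, symmetric])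
  also have "\<dots> = whittaker *\<^sub>v (\<rho> (?t g) *\<^sub>v (whittaker *\<^sub>v (\<rho> h *\<^sub>v (whittaker *\<^sub>v v))))"
    unfolding whittaker_anti_transpose[OF h v] ..
  also have "\<dots> = whittaker *\<^sub>v (\<rho> g *\<^sub>v (whittaker *\<^sub>v (\<rho> h *\<^sub>v (whittaker *\<^sub>v v))))"
    by (rule whittaker_anti_transpose[OF g rep_vec_carrier[OF h w], symmetric])
  finally show ?thesis by simp
qed

text \<open>A Schur argument for commuting operators. Let \<open>y\<close> be an eigenvector of
  \<open>T = P \<rho>(g)\<close> in the image of \<open>P\<close>, with eigenvalue \<open>c\<close>.
  The vectors \<open>v\<close> such that \<open>T\<close> acts as \<open>c\<close> on all
  \<open>P \<rho>(h) v\<close> form an invariant subspace, and commutation puts \<open>y\<close>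
  into it.\<close>

lemma whittaker_scalar:
  assumes g: "g \<in> GL n" and v0: "v0 \<in> carrier_vec d" "whittaker *\<^sub>v v0 \<noteq> 0\<^sub>v d"
  obtains c where "\<And>v. v \<in> carrier_vec d \<Longrightarrow>
    whittaker *\<^sub>v (\<rho> g *\<^sub>v (whittaker *\<^sub>v v)) = c \<cdot>\<^sub>v (whittaker *\<^sub>v v)"
proof -
  let ?P = whittaker
  note add = mult_add_distrib_mat_vec
  define T where "T = ?P * \<rho> g"
  have T: "T \<in> carrier_mat d d" using whittaker_carrier rep_carrier[OF g] by (simp add: T_def)
  have T_apply: "T *\<^sub>v x = ?P *\<^sub>v (\<rho> g *\<^sub>v x)" if "x \<in> carrier_vec d" for x
    unfolding T_def by (rule assoc_mult_mat_vec[OF whittaker_carrier rep_carrier[OF g] that])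
  define W where "W = {?P *\<^sub>v v | v. v \<in> carrier_vec d}"
  have "\<exists>y c. y \<in> W \<and> y \<noteq> 0\<^sub>v d \<and> T *\<^sub>v y = c \<cdot>\<^sub>v y"
  proof (rule invariant_subset_eigenvector[OF T])
    show "?P *\<^sub>v v0 \<in> W" using v0 W_def by blast
    show "?P *\<^sub>v v0 \<noteq> 0\<^sub>v d" by fact
    show "W \<subseteq> carrier_vec d" by (auto simp: W_def)
    show "x + y \<in> W" if xy: "x \<in> W" "y \<in> W" for x y
    proof -
      obtain a b where ab: "x = ?P *\<^sub>v a" "y = ?P *\<^sub>v b" "a \<in> carrier_vec d" "b \<in> carrier_vec d"
        using xy by (auto simp: W_def)
      then have "x + y = ?P *\<^sub>v (a + b)" by (simp add: add[OF whittaker_carrier])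
      moreover have "a + b \<in> carrier_vec d" using ab by simp
      ultimately show ?thesis unfolding W_def by blast
    qed
    show "c \<cdot>\<^sub>v x \<in> W" if x: "x \<in> W" for c x
    proof -
      obtain a where a: "x = ?P *\<^sub>v a" "a \<in> carrier_vec d" using x by (auto simp: W_def)
      then have "c \<cdot>\<^sub>v x = ?P *\<^sub>v (c \<cdot>\<^sub>v a)" by (simp add: whittaker_smult)
      moreover have "c \<cdot>\<^sub>v a \<in> carrier_vec d" using a by simp
      ultimately show ?thesis unfolding W_def by blast
    qed
    show "T *\<^sub>v x \<in> W" if x: "x \<in> W" for x
    proof -
      have xc: "x \<in> carrier_vec d" using x by (auto simp: W_def)
      then show ?thesis unfolding T_apply[OF xc] W_def using rep_vec_carrier[OF g xc] by blast
    qed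
  qed blast
  then obtain y c where y: "y \<in> W" "y \<noteq> 0\<^sub>v d" "T *\<^sub>v y = c \<cdot>\<^sub>v y" by blast
  then obtain v1 where v1: "v1 \<in> carrier_vec d" "y = ?P *\<^sub>v v1" by (auto simp: W_def)
  have yc: "y \<in> carrier_vec d" using v1 by simp
  define S where "S = {v \<in> carrier_vec d. \<forall>h\<in>GL n. T *\<^sub>v (?P *\<^sub>v (\<rho> h *\<^sub>v v)) = c \<cdot>\<^sub>v (?P *\<^sub>v (\<rho> h *\<^sub>v v))}"
  have "S = carrier_vec d"
  proof (rule invariant_subspace_everything)
    show "S \<subseteq> carrier_vec d" by (auto simp: S_def)
    show "y \<noteq> 0\<^sub>v d" by fact
    show "y \<in> S" unfolding S_def
    proof (intro CollectI conjI ballI yc)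
      fix h :: "'r mat" assume h: "h \<in> GL n"
      have hy: "\<rho> h *\<^sub>v y \<in> carrier_vec d" by (rule rep_vec_carrier[OF h yc])
      have "T *\<^sub>v (?P *\<^sub>v (\<rho> h *\<^sub>v y)) = ?P *\<^sub>v (\<rho> g *\<^sub>v (?P *\<^sub>v (\<rho> h *\<^sub>v y)))"
        by (rule T_apply) simp
      also have "\<dots> = ?P *\<^sub>v (\<rho> h *\<^sub>v (?P *\<^sub>v (\<rho> g *\<^sub>v y)))"
        unfolding v1(2) by (rule whittaker_commute[OF g h v1(1)])
      also have "?P *\<^sub>v (\<rho> g *\<^sub>v y) = c \<cdot>\<^sub>v y" using y(3) T_apply[OF yc] by simp
      finally show "T *\<^sub>v (?P *\<^sub>v (\<rho> h *\<^sub>v y)) = c \<cdot>\<^sub>v (?P *\<^sub>v (\<rho> h *\<^sub>v y))"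
        unfolding rep_vec_smult[OF h yc] whittaker_smult[OF hy] .
    qed
    show "v + w \<in> S" if vw: "v \<in> S" "w \<in> S" for v w
    proof -
      have vc: "v \<in> carrier_vec d" "w \<in> carrier_vec d" using vw by (auto simp: S_def)
      have "T *\<^sub>v (?P *\<^sub>v (\<rho> h *\<^sub>v (v + w))) = c \<cdot>\<^sub>v (?P *\<^sub>v (\<rho> h *\<^sub>v (v + w)))" if h: "h \<in> GL n" for h
      proof -
        have hc: "\<rho> h *\<^sub>v v \<in> carrier_vec d" "\<rho> h *\<^sub>v w \<in> carrier_vec d" using rep_vec_carrier[OF h] vc by auto
        show ?thesis using vw h
          unfolding add[OF rep_carrier[OF h] vc] add[OF whittaker_carrier hc]
            add[OF T whittaker_vec_carrier whittaker_vec_carrier]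
          by (simp add: S_def smult_add_distrib_vec[OF whittaker_vec_carrier whittaker_vec_carrier])
      qed
      with vc show ?thesis by (simp add: S_def)
    qed
    show "a \<cdot>\<^sub>v v \<in> S" if v: "v \<in> S" for a v
    proof -
      have vc: "v \<in> carrier_vec d" using v by (auto simp: S_def)
      have "T *\<^sub>v (?P *\<^sub>v (\<rho> h *\<^sub>v (a \<cdot>\<^sub>v v))) = c \<cdot>\<^sub>v (?P *\<^sub>v (\<rho> h *\<^sub>v (a \<cdot>\<^sub>v v)))" if h: "h \<in> GL n" for h
        using v h unfolding rep_vec_smult[OF h vc] whittaker_smult[OF rep_vec_carrier[OF h vc]]
          mult_mat_vec[OF T whittaker_vec_carrier]
        by (simp add: S_def smult_smult_assoc mult.commute)
      with vc show ?thesis by (simp add: S_def)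
    qed
    show "\<rho> k *\<^sub>v v \<in> S" if k: "k \<in> GL n" and v: "v \<in> S" for k v
    proof -
      have vc: "v \<in> carrier_vec d" using v by (auto simp: S_def)
      have "T *\<^sub>v (?P *\<^sub>v (\<rho> h *\<^sub>v (\<rho> k *\<^sub>v v))) = c \<cdot>\<^sub>v (?P *\<^sub>v (\<rho> h *\<^sub>v (\<rho> k *\<^sub>v v)))" if h: "h \<in> GL n" for h
        using v GL_mult[OF h k] by (simp add: S_def rep_mult_vec[OF h k vc, symmetric])
      then show ?thesis using rep_vec_carrier[OF k vc] by (simp add: S_def)
    qed
  qed
  then have "T *\<^sub>v (?P *\<^sub>v (\<rho> (1\<^sub>m n) *\<^sub>v v)) = c \<cdot>\<^sub>v (?P *\<^sub>v (\<rho> (1\<^sub>m n) *\<^sub>v v))"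
    if "v \<in> carrier_vec d" for v
    using that one_GL unfolding S_def by blast
  then have "?P *\<^sub>v (\<rho> g *\<^sub>v (?P *\<^sub>v v)) = c \<cdot>\<^sub>v (?P *\<^sub>v v)" if "v \<in> carrier_vec d" for v
    using that T_apply[OF whittaker_vec_carrier] by (simp add: rep_one_vec)
  with that show thesis by blast
qed

text \<open>All \<open>P \<rho>(h) P\<close> are multiples of \<open>P\<close>, so \<open>P\<close>
  sends the orbit of \<open>w0 = P v0\<close> into the line of \<open>w0\<close>; by irreducibility
  this orbit spans the space.\<close>

lemma whittaker_rank_le_1:
  obtains w0 where "w0 \<in> carrier_vec d" "\<And>v. v \<in> carrier_vec d \<Longrightarrow> \<exists>c. whittaker *\<^sub>v v = c \<cdot>\<^sub>v w0"
proof (cases "\<exists>v0\<in>carrier_vec d. whittaker *\<^sub>v v0 \<noteq> 0\<^sub>v d")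
  case False
  then have "\<exists>c. whittaker *\<^sub>v v = c \<cdot>\<^sub>v 0\<^sub>v d" if "v \<in> carrier_vec d" for v
    using that by (simp add: smult_zero_vec)
  then show thesis by (rule that[OF zero_carrier_vec])
next
  case True
  then obtain v0 where v0: "v0 \<in> carrier_vec d" "whittaker *\<^sub>v v0 \<noteq> 0\<^sub>v d" by blast
  let ?P = whittaker
  define w0 where "w0 = ?P *\<^sub>v v0"
  have w0: "w0 \<in> carrier_vec d" by (simp add: w0_def)
  define S where "S = {v \<in> carrier_vec d. \<forall>h\<in>GL n. \<exists>c. ?P *\<^sub>v (\<rho> h *\<^sub>v v) = c \<cdot>\<^sub>v w0}"
  have "S = carrier_vec d"
  proof (rule invariant_subspace_everything)
    show "S \<subseteq> carrier_vec d" by (auto simp: S_def)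
    show "w0 \<noteq> 0\<^sub>v d" using v0 by (simp add: w0_def)
    show "w0 \<in> S" unfolding S_def
    proof (intro CollectI conjI ballI w0)
      fix h :: "'r mat" assume h: "h \<in> GL n"
      obtain c where "\<And>v. v \<in> carrier_vec d \<Longrightarrow> ?P *\<^sub>v (\<rho> h *\<^sub>v (?P *\<^sub>v v)) = c \<cdot>\<^sub>v (?P *\<^sub>v v)"
        using whittaker_scalar[OF h v0] by blast
      then show "\<exists>c. ?P *\<^sub>v (\<rho> h *\<^sub>v w0) = c \<cdot>\<^sub>v w0" using v0 unfolding w0_def by blast
    qed
    show "v + w \<in> S" if vw: "v \<in> S" "w \<in> S" for v w
    proof -
      have vc: "v \<in> carrier_vec d" "w \<in> carrier_vec d" using vw by (auto simp: S_def)
      have "\<exists>c. ?P *\<^sub>v (\<rho> h *\<^sub>v (v + w)) = c \<cdot>\<^sub>v w0" if h: "h \<in> GL n" for h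
      proof -
        obtain c c' where "?P *\<^sub>v (\<rho> h *\<^sub>v v) = c \<cdot>\<^sub>v w0" "?P *\<^sub>v (\<rho> h *\<^sub>v w) = c' \<cdot>\<^sub>v w0"
          using vw h unfolding S_def by blast
        then have "?P *\<^sub>v (\<rho> h *\<^sub>v (v + w)) = (c + c') \<cdot>\<^sub>v w0"
          unfolding mult_add_distrib_mat_vec[OF rep_carrier[OF h] vc]
            mult_add_distrib_mat_vec[OF whittaker_carrier rep_vec_carrier[OF h vc(1)] rep_vec_carrier[OF h vc(2)]]
          by (simp add: add_smult_distrib_vec)
        then show ?thesis by blast
      qed
      with vc show ?thesis by (simp add: S_def)
    qed
    show "a \<cdot>\<^sub>v v \<in> S" if v: "v \<in> S" for a v
    proof -
      have vc: "v \<in> carrier_vec d" using v by (auto simp: S_def)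
      have "\<exists>c. ?P *\<^sub>v (\<rho> h *\<^sub>v (a \<cdot>\<^sub>v v)) = c \<cdot>\<^sub>v w0" if h: "h \<in> GL n" for h
      proof -
        obtain c where c: "?P *\<^sub>v (\<rho> h *\<^sub>v v) = c \<cdot>\<^sub>v w0" using v h unfolding S_def by blast
        have "?P *\<^sub>v (\<rho> h *\<^sub>v (a \<cdot>\<^sub>v v)) = (a * c) \<cdot>\<^sub>v w0"
          unfolding rep_vec_smult[OF h vc] whittaker_smult[OF rep_vec_carrier[OF h vc]] c
          by (simp add: smult_smult_assoc)
        then show ?thesis by blast
      qed
      with vc show ?thesis by (simp add: S_def)
    qed
    show "\<rho> k *\<^sub>v v \<in> S" if k: "k \<in> GL n" and v: "v \<in> S" for k v
    proof -
      have vc: "v \<in> carrier_vec d" using v by (auto simp: S_def)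
      have "\<exists>c. ?P *\<^sub>v (\<rho> h *\<^sub>v (\<rho> k *\<^sub>v v)) = c \<cdot>\<^sub>v w0" if h: "h \<in> GL n" for h
        using v GL_mult[OF h k] by (simp add: S_def rep_mult_vec[OF h k vc, symmetric])
      then show ?thesis using rep_vec_carrier[OF k vc] by (simp add: S_def)
    qed
  qed
  then have "\<exists>c. ?P *\<^sub>v (\<rho> (1\<^sub>m n) *\<^sub>v v) = c \<cdot>\<^sub>v w0" if "v \<in> carrier_vec d" for v
    using that one_GL unfolding S_def by blast
  then have "\<exists>c. ?P *\<^sub>v v = c \<cdot>\<^sub>v w0" if "v \<in> carrier_vec d" for v
    using that by (simp add: rep_one_vec)
  with w0 that show thesis by blast
qed

end

lemma mat_eq_zero_if_mult_vec:
  fixes M :: "'a::comm_ring_1 mat"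
  assumes M: "M \<in> carrier_mat nr nc" and "\<And>x. x \<in> carrier_vec nc \<Longrightarrow> M *\<^sub>v x = 0\<^sub>v nr"
  shows "M = 0\<^sub>m nr nc"
proof (rule mat_col_eqI)
  fix j assume "j < dim_col (0\<^sub>m nr nc :: 'a mat)"
  then show "col M j = col (0\<^sub>m nr nc) j"
    using assms(2)[of "unit_vec nc j"] mult_mat_unit_vec[OF M, of j] by simp
qed (use M in auto)

lemma smult_mat_mult_vec:
  fixes A :: "'a::comm_ring_1 mat"
  assumes "A \<in> carrier_mat nr nc" "v \<in> carrier_vec nc"
  shows "(c \<cdot>\<^sub>m A) *\<^sub>v v = c \<cdot>\<^sub>v (A *\<^sub>v v)"
  using assms by (intro eq_vecI) auto

context irreducible_GL_rep
begin

text \<open>The vectors whose whole orbit is killed by \<open>P\<close> form an invariant subspace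
  that misses \<open>v0\<close>. The translate is there because \<open>P\<close> itself may kill an
  entire constituent of the restriction to \<open>SL\<close>.\<close>

lemma exists_whittaker_rep_nonzero:
  assumes v0: "v0 \<in> carrier_vec d" "whittaker *\<^sub>v v0 \<noteq> 0\<^sub>v d"
    and v: "v \<in> carrier_vec d" "v \<noteq> 0\<^sub>v d"
  obtains g where "g \<in> GL n" "whittaker *\<^sub>v (\<rho> g *\<^sub>v v) \<noteq> 0\<^sub>v d"
proof (rule ccontr)
  assume "\<not> thesis"
  with that have zero: "whittaker *\<^sub>v (\<rho> g *\<^sub>v v) = 0\<^sub>v d" if "g \<in> GL n" for g using that by blast
  define S where "S = {v \<in> carrier_vec d. \<forall>h\<in>GL n. whittaker *\<^sub>v (\<rho> h *\<^sub>v v) = 0\<^sub>v d}"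
  have "S = carrier_vec d"
  proof (rule invariant_subspace_everything)
    show "S \<subseteq> carrier_vec d" by (auto simp: S_def)
    show "v \<noteq> 0\<^sub>v d" by fact
    show "v \<in> S" using zero v by (simp add: S_def)
    show "x + y \<in> S" if xy: "x \<in> S" "y \<in> S" for x y
    proof -
      have c: "x \<in> carrier_vec d" "y \<in> carrier_vec d" using xy by (auto simp: S_def)
      have "whittaker *\<^sub>v (\<rho> h *\<^sub>v (x + y)) = 0\<^sub>v d" if h: "h \<in> GL n" for h
        unfolding mult_add_distrib_mat_vec[OF rep_carrier[OF h] c]
          mult_add_distrib_mat_vec[OF whittaker_carrier rep_vec_carrier[OF h c(1)] rep_vec_carrier[OF h c(2)]]
        using xy h by (simp add: S_def)
      with c show ?thesis by (simp add: S_def)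
    qed
    show "a \<cdot>\<^sub>v x \<in> S" if x: "x \<in> S" for a x
    proof -
      have c: "x \<in> carrier_vec d" using x by (auto simp: S_def)
      have "whittaker *\<^sub>v (\<rho> h *\<^sub>v (a \<cdot>\<^sub>v x)) = 0\<^sub>v d" if h: "h \<in> GL n" for h
        unfolding rep_vec_smult[OF h c] whittaker_smult[OF rep_vec_carrier[OF h c]]
        using x h by (simp add: S_def smult_zero_vec)
      with c show ?thesis by (simp add: S_def)
    qed
    show "\<rho> k *\<^sub>v x \<in> S" if k: "k \<in> GL n" and x: "x \<in> S" for k x
    proof -
      have c: "x \<in> carrier_vec d" using x by (auto simp: S_def)
      have "whittaker *\<^sub>v (\<rho> h *\<^sub>v (\<rho> k *\<^sub>v x)) = 0\<^sub>v d" if h: "h \<in> GL n" for h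
        using x GL_mult[OF h k] by (simp add: S_def rep_mult_vec[OF h k c, symmetric])
      then show ?thesis using rep_vec_carrier[OF k c] by (simp add: S_def)
    qed
  qed
  then have "whittaker *\<^sub>v (\<rho> (1\<^sub>m n) *\<^sub>v v0) = 0\<^sub>v d" using v0 one_GL unfolding S_def by blast
  with v0 show False by (simp add: rep_one_vec)
qed

text \<open>Two copies of \<open>\<sigma>\<close> in the restriction would put two independent vectors into the image of
  \<open>whittaker\<close>, since that operator lies in the group algebra of \<open>SL\<close>.\<close>
lemma multiplicity_free_if_whittaker_nonzero:
  assumes v0: "v0 \<in> carrier_vec d" "whittaker *\<^sub>v v0 \<noteq> 0\<^sub>v d"
  shows "multiplicity_free_restriction (SL n) n \<rho> d"
  unfolding multiplicity_free_restriction_def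
proof (intro allI impI ballI)
  fix \<sigma> :: "'r mat \<Rightarrow> complex mat" and e T1 T2
  assume irr: "irreducible_rep (SL n) n \<sigma> e"
    and T1: "T1 \<in> intertwiners (SL n) \<sigma> e \<rho> d" and T2: "T2 \<in> intertwiners (SL n) \<sigma> e \<rho> d"
  have sc: "\<sigma> h \<in> carrier_mat e e" if "h \<in> SL n" for h
    using irr that by (simp add: irreducible_rep_def is_rep_def)
  have Tc: "T1 \<in> carrier_mat d e" "T2 \<in> carrier_mat d e" using T1 T2 by (auto simp: intertwiners_def)
  show "\<exists>a b. (a \<noteq> 0 \<or> b \<noteq> 0) \<and> a \<cdot>\<^sub>m T1 + b \<cdot>\<^sub>m T2 = 0\<^sub>m d e"
  proof (cases "\<forall>x\<in>carrier_vec e. T1 *\<^sub>v x = 0\<^sub>v d")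
    case True
    then have "T1 = 0\<^sub>m d e" using mat_eq_zero_if_mult_vec[OF Tc(1)] by blast
    then have "1 \<cdot>\<^sub>m T1 + 0 \<cdot>\<^sub>m T2 = 0\<^sub>m d e" using Tc by (intro eq_matI) auto
    then show ?thesis by (intro exI[of _ 1] exI[of _ 0]) simp
  next
    case False
    then obtain x where x: "x \<in> carrier_vec e" "T1 *\<^sub>v x \<noteq> 0\<^sub>v d" by blast
    obtain g where g: "g \<in> GL n" "whittaker *\<^sub>v (\<rho> g *\<^sub>v (T1 *\<^sub>v x)) \<noteq> 0\<^sub>v d"
      using exists_whittaker_rep_nonzero[OF v0 mult_mat_vec_carrier[OF Tc(1) x(1)] x(2)] by blast
    obtain k where k: "k \<in> GL n" "g * k = 1\<^sub>m n" "k * g = 1\<^sub>m n" using GL_inverse[OF g(1)] by blast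
    have gc: "g \<in> carrier_mat n n" "k \<in> carrier_mat n n" using g k GL_carrier by auto
    let ?U = "unitriangular n :: 'r mat set"
    have conj: "k * (u * g) \<in> SL n" "g * (k * (u * g)) = u * g" if u: "u \<in> ?U" for u
    proof -
      have uc: "u \<in> carrier_mat n n" using u by (rule unitriangular_carrier)
      have "det k * det g = 1" using det_mult[OF gc(2,1)] k(3) by simp
      then show "k * (u * g) \<in> SL n"
        using uc gc unitriangular_det[OF u] by (simp add: SL_def det_mult[of _ n])
      show "g * (k * (u * g)) = u * g"
        using mat_mult_left_cancel[OF gc k(2), of "u * g"] uc gc by simp
    qed
    \<comment> \<open>The average conjugated by \<open>g\<close>, evaluated in
      \<open>\<sigma>\<close>; by normality \<open>k * (u * g)\<close> lies in \<open>SL\<close>. It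
      does not depend on the intertwiner, so \<open>T1\<close> and \<open>T2\<close>, each followed
      by \<open>\<rho> g\<close>, send the same \<open>y\<close> into the image of
      \<open>P\<close>.\<close>
    define y where "y = vsum e (\<lambda>u. inverse (\<psi> u) \<cdot>\<^sub>v (\<sigma> (k * (u * g)) *\<^sub>v x)) ?U"
    have yc: "y \<in> carrier_vec e" by (simp add: y_def)
    have push: "whittaker *\<^sub>v (\<rho> g *\<^sub>v (T *\<^sub>v x)) = \<rho> g *\<^sub>v (T *\<^sub>v y)"
      if T: "T \<in> intertwiners (SL n) \<sigma> e \<rho> d" for T
    proof -
      have Tc: "T \<in> carrier_mat d e" using T by (simp add: intertwiners_def)
      have Tx: "T *\<^sub>v x \<in> carrier_vec d" using Tc x by auto
      have xs: "\<sigma> (k * (u * g)) *\<^sub>v x \<in> carrier_vec e" if "u \<in> ?U" for u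
        using sc[OF conj(1)[OF that]] x by auto
      have Ts: "T *\<^sub>v (inverse (\<psi> u) \<cdot>\<^sub>v (\<sigma> (k * (u * g)) *\<^sub>v x)) =
          inverse (\<psi> u) \<cdot>\<^sub>v (\<rho> (k * (u * g)) *\<^sub>v (T *\<^sub>v x))" if u: "u \<in> ?U" for u
      proof -
        note s = conj(1)[OF u]
        have "T *\<^sub>v (\<sigma> (k * (u * g)) *\<^sub>v x) = (T * \<sigma> (k * (u * g))) *\<^sub>v x"
          using assoc_mult_mat_vec[OF Tc sc[OF s] x(1)] by simp
        also have "T * \<sigma> (k * (u * g)) = \<rho> (k * (u * g)) * T" using T s by (simp add: intertwiners_def)
        also have "\<dots> *\<^sub>v x = \<rho> (k * (u * g)) *\<^sub>v (T *\<^sub>v x)"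
          by (rule assoc_mult_mat_vec[OF rep_carrier[OF SL_GL[OF s]] Tc x(1)])
        finally show ?thesis by (simp add: mult_mat_vec[OF Tc xs[OF u]])
      qed
      have "\<rho> g *\<^sub>v (T *\<^sub>v y) = \<rho> g *\<^sub>v vsum d (\<lambda>u. T *\<^sub>v (inverse (\<psi> u) \<cdot>\<^sub>v (\<sigma> (k * (u * g)) *\<^sub>v x))) ?U"
        unfolding y_def using xs by (subst mult_mat_vsum[OF Tc]) auto
      also have "\<dots> = \<rho> g *\<^sub>v vsum d (\<lambda>u. inverse (\<psi> u) \<cdot>\<^sub>v (\<rho> (k * (u * g)) *\<^sub>v (T *\<^sub>v x))) ?U"
        by (intro arg_cong[where f = "\<lambda>z. \<rho> g *\<^sub>v z"] vsum_cong Ts)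
      also have "\<dots> = vsum d (\<lambda>u. \<rho> g *\<^sub>v (inverse (\<psi> u) \<cdot>\<^sub>v (\<rho> (k * (u * g)) *\<^sub>v (T *\<^sub>v x)))) ?U"
        using rep_vec_carrier[OF SL_GL[OF conj(1)] Tx] by (intro mult_mat_vsum[OF rep_carrier[OF g(1)]]) auto
      also have "\<dots> = vsum d (\<lambda>u. inverse (\<psi> u) \<cdot>\<^sub>v (\<rho> u *\<^sub>v (\<rho> g *\<^sub>v (T *\<^sub>v x)))) ?U"
      proof (rule vsum_cong)
        fix u assume u: "u \<in> ?U"
        note s = SL_GL[OF conj(1)[OF u]]
        show "\<rho> g *\<^sub>v (inverse (\<psi> u) \<cdot>\<^sub>v (\<rho> (k * (u * g)) *\<^sub>v (T *\<^sub>v x))) =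
            inverse (\<psi> u) \<cdot>\<^sub>v (\<rho> u *\<^sub>v (\<rho> g *\<^sub>v (T *\<^sub>v x)))"
          unfolding rep_vec_smult[OF g(1) rep_vec_carrier[OF s Tx]] rep_mult_vec[OF g(1) s Tx, symmetric]
            conj(2)[OF u] rep_mult_vec[OF unitriangular_GL[OF u] g(1) Tx] ..
      qed
      finally show ?thesis unfolding whittaker_apply[OF rep_vec_carrier[OF g(1) Tx]] by simp
    qed
    have y0: "y \<noteq> 0\<^sub>v e"
    proof
      assume "y = 0\<^sub>v e"
      then have "\<rho> g *\<^sub>v (T1 *\<^sub>v y) = 0\<^sub>v d"
        by (simp add: mat_mult_zero_vec[OF Tc(1)] mat_mult_zero_vec[OF rep_carrier[OF g(1)]])
      with push[OF T1] g(2) show False by simp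
    qed
    obtain w0 where w0: "w0 \<in> carrier_vec d" "\<And>v. v \<in> carrier_vec d \<Longrightarrow> \<exists>c. whittaker *\<^sub>v v = c \<cdot>\<^sub>v w0"
      using whittaker_rank_le_1 by blast
    have Txc: "\<rho> g *\<^sub>v (T *\<^sub>v x) \<in> carrier_vec d" if "T \<in> carrier_mat d e" for T
      using rep_vec_carrier[OF g(1) mult_mat_vec_carrier[OF that x(1)]] .
    obtain c1 where c1: "\<rho> g *\<^sub>v (T1 *\<^sub>v y) = c1 \<cdot>\<^sub>v w0" using w0(2)[OF Txc[OF Tc(1)]] push[OF T1] by auto
    obtain c2 where c2: "\<rho> g *\<^sub>v (T2 *\<^sub>v y) = c2 \<cdot>\<^sub>v w0" using w0(2)[OF Txc[OF Tc(2)]] push[OF T2] by auto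
    have c1_0: "c1 \<noteq> 0"
    proof
      assume "c1 = 0"
      then have "\<rho> g *\<^sub>v (T1 *\<^sub>v y) = 0\<^sub>v d" using c1 w0(1) by auto
      with push[OF T1] g(2) show False by simp
    qed
    \<comment> \<open>Both images of \<open>y\<close> are multiples of \<open>w0\<close>, and this
      combination cancels them; its kernel is then a nonzero invariant subspace of
      \<open>\<sigma>\<close>.\<close>
    define M where "M = c2 \<cdot>\<^sub>m T1 + (- c1) \<cdot>\<^sub>m T2"
    have Mc: "M \<in> carrier_mat d e" using Tc by (simp add: M_def)
    have M_apply: "M *\<^sub>v z = c2 \<cdot>\<^sub>v (T1 *\<^sub>v z) + (- c1) \<cdot>\<^sub>v (T2 *\<^sub>v z)" if "z \<in> carrier_vec e" for z
      unfolding M_def using Tc that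
      by (simp add: add_mult_distrib_mat_vec[of _ d e] smult_mat_mult_vec[of _ d e])
    have MI: "M * \<sigma> h = \<rho> h * M" if h: "h \<in> SL n" for h
    proof -
      note hc = sc[OF h] and rc = rep_carrier[OF SL_GL[OF h]]
      have "M * \<sigma> h = c2 \<cdot>\<^sub>m (T1 * \<sigma> h) + (- c1) \<cdot>\<^sub>m (T2 * \<sigma> h)"
        unfolding M_def using Tc hc
        by (simp add: add_mult_distrib_mat[of _ d e _ _ e] mult_smult_assoc_mat[of _ d e _ e])
      also have "\<dots> = c2 \<cdot>\<^sub>m (\<rho> h * T1) + (- c1) \<cdot>\<^sub>m (\<rho> h * T2)"
        using T1 T2 h by (simp add: intertwiners_def)
      also have "\<dots> = \<rho> h * M"
        unfolding M_def using Tc rc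
        by (simp add: mult_add_distrib_mat[of _ d d _ e] mult_smult_distrib[of _ d d _ e])
      finally show ?thesis .
    qed
    have My: "M *\<^sub>v y = 0\<^sub>v d"
    proof -
      have Myc: "M *\<^sub>v y \<in> carrier_vec d" using Mc yc by auto
      have t: "T1 *\<^sub>v y \<in> carrier_vec d" "T2 *\<^sub>v y \<in> carrier_vec d" using Tc yc by auto
      have "\<rho> g *\<^sub>v (M *\<^sub>v y) = c2 \<cdot>\<^sub>v (\<rho> g *\<^sub>v (T1 *\<^sub>v y)) + (- c1) \<cdot>\<^sub>v (\<rho> g *\<^sub>v (T2 *\<^sub>v y))"
        unfolding M_apply[OF yc] using t
        by (simp add: mult_add_distrib_mat_vec[OF rep_carrier[OF g(1)]] rep_vec_smult[OF g(1)])
      also have "\<dots> = 0\<^sub>v d" unfolding c1 c2 using w0(1) by (intro eq_vecI) auto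
      finally have z: "\<rho> g *\<^sub>v (M *\<^sub>v y) = 0\<^sub>v d" .
      have "M *\<^sub>v y = \<rho> (k * g) *\<^sub>v (M *\<^sub>v y)" using Myc by (simp add: k(3) rep_one_vec)
      also have "\<dots> = \<rho> k *\<^sub>v (\<rho> g *\<^sub>v (M *\<^sub>v y))" by (rule rep_mult_vec[OF k(1) g(1) Myc])
      also have "\<dots> = 0\<^sub>v d" unfolding z by (rule mat_mult_zero_vec[OF rep_carrier[OF k(1)]])
      finally show ?thesis .
    qed
    define K where "K = {z \<in> carrier_vec e. M *\<^sub>v z = 0\<^sub>v d}"
    have "invariant_subspace (SL n) \<sigma> e K"
      unfolding invariant_subspace_def
    proof (intro conjI ballI allI)
      show "K \<subseteq> carrier_vec e" by (auto simp: K_def)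
      show "0\<^sub>v e \<in> K" by (simp add: K_def mat_mult_zero_vec[OF Mc])
      show "v + w \<in> K" if "v \<in> K" "w \<in> K" for v w
        using that by (simp add: K_def mult_add_distrib_mat_vec[OF Mc])
      show "c \<cdot>\<^sub>v v \<in> K" if "v \<in> K" for c v
        using that by (simp add: K_def mult_mat_vec[OF Mc] smult_zero_vec)
      show "\<sigma> h *\<^sub>v v \<in> K" if h: "h \<in> SL n" and v: "v \<in> K" for h v
      proof -
        have vc: "v \<in> carrier_vec e" and Mv: "M *\<^sub>v v = 0\<^sub>v d" using v by (auto simp: K_def)
        have "M *\<^sub>v (\<sigma> h *\<^sub>v v) = (M * \<sigma> h) *\<^sub>v v" using assoc_mult_mat_vec[OF Mc sc[OF h] vc] by simp
        also have "\<dots> = \<rho> h *\<^sub>v (M *\<^sub>v v)"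
          unfolding MI[OF h] by (rule assoc_mult_mat_vec[OF rep_carrier[OF SL_GL[OF h]] Mc vc])
        also have "\<dots> = 0\<^sub>v d" unfolding Mv by (rule mat_mult_zero_vec[OF rep_carrier[OF SL_GL[OF h]]])
        finally show ?thesis using sc[OF h] vc by (auto simp: K_def)
      qed
    qed
    then have "K = {0\<^sub>v e} \<or> K = carrier_vec e" using irr by (simp add: irreducible_rep_def)
    moreover have "y \<in> K" using yc My by (simp add: K_def)
    ultimately have "K = carrier_vec e" using y0 by auto
    then have "M = 0\<^sub>m d e" using mat_eq_zero_if_mult_vec[OF Mc] unfolding K_def by blast
    then show ?thesis using c1_0 unfolding M_def by (intro exI[of _ c2] exI[of _ "- c1"]) simp
  qed
qed

end

section \<open>Existence of a generic vector\<close>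

text \<open>Every nonzero \<open>x\<close> is \<open>pw ^ i\<close> times a unit with
  \<open>i < l\<close>, so each nonzero ideal contains the socle generated by
  \<open>pw ^ (l - 1)\<close>, on which \<open>\<phi>\<close> is nontrivial.\<close>

lemma trunc_dvr_primitive:
  fixes pw :: "'r::comm_ring_1" and \<phi> :: "'r \<Rightarrow> complex"
  assumes dvr: "trunc_dvr pw l" and char: "add_char \<phi>" and nt: "\<exists>a. \<phi> (pw ^ (l - 1) * a) \<noteq> 1"
  shows "primitive_char \<phi>"
proof
  show "finite (UNIV :: 'r set)" using dvr by (simp add: trunc_dvr_def)
  show "add_char \<phi>" by fact
  fix x :: 'r assume x: "x \<noteq> 0"
  obtain a where a: "\<phi> (pw ^ (l - 1) * a) \<noteq> 1" using nt by blast
  have bound: "\<forall>i. pw ^ i dvd x \<longrightarrow> i \<le> l"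
  proof (intro allI impI, rule ccontr)
    fix i assume "pw ^ i dvd x" "\<not> i \<le> l"
    then have "pw ^ l dvd x" using le_imp_power_dvd[of l i pw] dvd_trans by fastforce
    with dvr x show False by (simp add: trunc_dvr_def)
  qed
  obtain i where i: "pw ^ i dvd x" "\<And>k. pw ^ k dvd x \<Longrightarrow> k \<le> i"
    using Nat.ex_has_greatest_nat[of "\<lambda>i. pw ^ i dvd x" 0 l] bound by auto
  obtain c where c: "x = pw ^ i * c" using i(1) by (rule dvdE)
  have "\<not> pw dvd c"
  proof
    assume "pw dvd c"
    then have "pw ^ Suc i dvd x" unfolding c power_Suc2 by (rule mult_dvd_mono[OF dvd_refl])
    then show False using i(2) by fastforce
  qed
  then have "c dvd 1" using dvr by (auto simp: trunc_dvr_def)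
  then obtain c' where c': "1 = c * c'" by (rule dvdE)
  have "i < l"
  proof (rule ccontr)
    assume "\<not> i < l"
    then have "i = l" using bound i(1) by (auto simp: not_less intro: antisym)
    then show False using c x dvr by (simp add: trunc_dvr_def)
  qed
  then have "x * (c' * pw ^ (l - 1 - i) * a) = (pw ^ i * pw ^ (l - 1 - i)) * (c * c') * a"
    unfolding c by (simp add: algebra_simps)
  also have "\<dots> = pw ^ (l - 1) * a" using \<open>i < l\<close> c' by (simp flip: power_add)
  finally show "\<exists>r. \<phi> (x * r) \<noteq> 1" using a by metis
qed

section \<open>Congruence subgroups and strictly upper matrices\<close>

lemma one_add_mult_one_add:
  fixes X Y :: "'a::comm_ring_1 mat"
  assumes X: "X \<in> carrier_mat n n" and Y: "Y \<in> carrier_mat n n"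
  shows "(1\<^sub>m n + a \<cdot>\<^sub>m X) * (1\<^sub>m n + b \<cdot>\<^sub>m Y) = 1\<^sub>m n + a \<cdot>\<^sub>m X + b \<cdot>\<^sub>m Y + (a * b) \<cdot>\<^sub>m (X * Y)"
proof -
  have "(1\<^sub>m n + a \<cdot>\<^sub>m X) * (1\<^sub>m n + b \<cdot>\<^sub>m Y) = (1\<^sub>m n + a \<cdot>\<^sub>m X) + (b \<cdot>\<^sub>m Y + a \<cdot>\<^sub>m X * (b \<cdot>\<^sub>m Y))"
    using X Y by (simp add: mult_add_distrib_mat[of _ n n _ n] add_mult_distrib_mat[of _ n n _ _ n])
  also have "a \<cdot>\<^sub>m X * (b \<cdot>\<^sub>m Y) = (a * b) \<cdot>\<^sub>m (X * Y)"
    using X Y by (intro eq_matI) (auto simp: mult.assoc)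
  finally show ?thesis using X Y by (intro eq_matI) (auto simp: add.assoc simp del: index_mult_mat(1))
qed

lemma one_add_commute:
  fixes X Y :: "'a::comm_ring_1 mat"
  assumes X: "X \<in> carrier_mat n n" and Y: "Y \<in> carrier_mat n n" and ab: "a * b = 0"
  shows "(1\<^sub>m n + a \<cdot>\<^sub>m X) * (1\<^sub>m n + b \<cdot>\<^sub>m Y) = (1\<^sub>m n + b \<cdot>\<^sub>m Y) * (1\<^sub>m n + a \<cdot>\<^sub>m X)"
  unfolding one_add_mult_one_add[OF X Y] one_add_mult_one_add[OF Y X]
  using X Y ab by (intro eq_matI) (auto simp: mult.commute simp del: index_mult_mat(1))

lemma strictly_upper_add: "X \<in> strictly_upper n \<Longrightarrow> Y \<in> strictly_upper n \<Longrightarrow> X + Y \<in> strictly_upper n"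
  and strictly_upper_smult: "X \<in> strictly_upper n \<Longrightarrow> a \<cdot>\<^sub>m X \<in> strictly_upper n"
  by (auto simp: strictly_upper_def)

text \<open>Such a product starts two places above the diagonal, so the product term in
  \<open>(1 + X) * (1 + Y)\<close> does not disturb \<open>superdiag_sum\<close>.\<close>

lemma strictly_upper_mult_entry:
  assumes X: "X \<in> strictly_upper n" and Y: "Y \<in> strictly_upper n" and ij: "i < n" "j < n" "j \<le> Suc i"
  shows "(X * Y) $$ (i,j) = 0"
proof -
  have "(X * Y) $$ (i,j) = (\<Sum>k<n. X $$ (i,k) * Y $$ (k,j))"
    using X Y ij by (intro index_mult_mat_sum) (auto simp: strictly_upper_def)
  also have "\<dots> = 0"
  proof (rule sum.neutral, rule ballI)
    fix k assume "k \<in> {..<n}"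
    then show "X $$ (i,k) * Y $$ (k,j) = 0"
      using X Y ij by (cases "k \<le> i") (auto simp: strictly_upper_def)
  qed
  finally show ?thesis .
qed

lemma strictly_upper_mult:
  assumes "X \<in> strictly_upper n" "Y \<in> strictly_upper n" shows "X * Y \<in> strictly_upper n"
  using strictly_upper_mult_entry[OF assms] assms
  by (auto simp: strictly_upper_def[of n] simp del: index_mult_mat(1))

lemma superdiag_sum_strictly_upper_mult:
  assumes X: "X \<in> strictly_upper n" and Y: "Y \<in> strictly_upper n"
  shows "superdiag_sum (X * Y) = 0"
  unfolding superdiag_sum_def
  using strictly_upper_mult_entry[OF assms] strictly_upper_carrier[OF X] by (intro sum.neutral) auto

lemma superdiag_sum_add:
  "A \<in> carrier_mat n n \<Longrightarrow> B \<in> carrier_mat n n \<Longrightarrow> superdiag_sum (A + B) = superdiag_sum A + superdiag_sum B"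
  and superdiag_sum_smult: "A \<in> carrier_mat n n \<Longrightarrow> superdiag_sum (a \<cdot>\<^sub>m A) = a * superdiag_sum A"
  by (simp_all add: superdiag_sum_def sum.distrib sum_distrib_left)

lemma zero_strictly_upper: "0\<^sub>m n n \<in> strictly_upper n"
  by (simp add: strictly_upper_def)

locale trunc_dvr_rep = irreducible_GL_rep \<phi> n d \<rho>
  for \<phi> :: "'r::comm_ring_1 \<Rightarrow> complex" and n d :: nat and \<rho> :: "'r mat \<Rightarrow> complex mat" +
  fixes pw :: 'r and l :: nat and \<pi> :: "'r \<Rightarrow> 'k::field"
  assumes dvr: "trunc_dvr pw l" and residue: "residue_map pw \<pi>" and l_ge_2: "l \<ge> 2"
begin

sublocale residue: comm_ring_hom \<pi>
  using residue by unfold_locales (auto simp: residue_map_def)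

lemma residue_eq_0_iff: "\<pi> a = 0 \<longleftrightarrow> pw dvd a"
  using residue by (simp add: residue_map_def)

text \<open>Multiplication by \<open>pw ^ (l - 1)\<close> embeds the residue field into the ring:
  equations multiplied by it are equations modulo \<open>pw\<close>.\<close>

lemma socle_mult_eq_0_iff: "pw ^ (l - 1) * a = 0 \<longleftrightarrow> pw dvd a"
proof
  assume "pw dvd a"
  then obtain b where "a = pw * b" by (rule dvdE)
  then have "pw ^ (l - 1) * a = pw ^ l * b"
    using l_ge_2 by (simp add: power_eq_if[of pw l] algebra_simps)
  then show "pw ^ (l - 1) * a = 0" using dvr by (simp add: trunc_dvr_def)
next
  assume *: "pw ^ (l - 1) * a = 0"
  show "pw dvd a"
  proof (rule ccontr)
    assume "\<not> pw dvd a"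
    then have "a dvd 1" using dvr by (auto simp: trunc_dvr_def)
    then obtain b where b: "1 = a * b" by (rule dvdE)
    have "pw ^ (l - 1) = pw ^ (l - 1) * a * b" unfolding mult.assoc b[symmetric] by simp
    then show False using * dvr by (simp add: trunc_dvr_def)
  qed
qed

lemma GL_if_residue:
  assumes A: "A \<in> carrier_mat n n" and "det (map_mat \<pi> A) \<noteq> 0"
  shows "A \<in> GL n"
proof -
  have "\<pi> (det A) \<noteq> 0" using assms by simp
  then have "\<not> pw dvd det A" by (simp add: residue_eq_0_iff)
  then have "det A dvd 1" using dvr by (auto simp: trunc_dvr_def)
  with A show ?thesis by (simp add: GL_def)
qed

lemma one_add_GL:
  assumes Y: "Y \<in> carrier_mat n n" and i: "i \<ge> 1"
  shows "1\<^sub>m n + pw ^ i \<cdot>\<^sub>m Y \<in> GL n"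
proof (rule GL_if_residue)
  have "\<pi> pw = 0" by (simp add: residue_eq_0_iff)
  then have "\<pi> (pw ^ i) = 0" using i by (simp add: residue.hom_power)
  then have "map_mat \<pi> (1\<^sub>m n + pw ^ i \<cdot>\<^sub>m Y) = 1\<^sub>m n"
    using Y by (intro eq_matI) (auto simp: residue.hom_mult residue.hom_add)
  then show "det (map_mat \<pi> (1\<^sub>m n + pw ^ i \<cdot>\<^sub>m Y)) \<noteq> 0" by simp
qed (use Y in auto)

lemma socle_mult_power: "i \<ge> 1 \<Longrightarrow> pw ^ (l - 1) * pw ^ i = 0"
  unfolding socle_mult_eq_0_iff by (cases i) auto

text \<open>The average against \<open>\<psi>\<close> over the group of all
  \<open>1 + pw^e X\<close>, up to normalisation. It runs over \<open>X\<close> rather than over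
  group elements: for \<open>e > 0\<close> each element occurs equally often, which contributes only
  a nonzero factor; \<open>e = 0\<close> gives \<open>U\<close> itself.\<close>

definition unipotent_sum :: "nat \<Rightarrow> complex vec \<Rightarrow> complex vec" where
  "unipotent_sum e w = vsum d (\<lambda>X. inverse (\<phi> (pw ^ e * superdiag_sum X)) \<cdot>\<^sub>v
     (\<rho> (1\<^sub>m n + pw ^ e \<cdot>\<^sub>m X) *\<^sub>v w)) (strictly_upper n)"

lemma one_add_strictly_upper_GL:
  "X \<in> strictly_upper n \<Longrightarrow> 1\<^sub>m n + a \<cdot>\<^sub>m X \<in> GL n"
  using one_add_unitriangular[OF strictly_upper_smult] unitriangular_GL by blast

lemma finite_strictly_upper: "finite (strictly_upper n :: 'r mat set)"
  by (rule finite_subset[OF _ finite_carrier_mat[OF finite_ring, of n n]]) (rule subsetI, erule strictly_upper_carrier)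

lemma rep_unipotent_sum:
  assumes A: "A \<in> strictly_upper n" and w: "w \<in> carrier_vec d"
  shows "\<rho> (1\<^sub>m n + pw ^ e \<cdot>\<^sub>m A) *\<^sub>v unipotent_sum e w = \<phi> (pw ^ e * superdiag_sum A) \<cdot>\<^sub>v unipotent_sum e w"
proof -
  let ?N = "strictly_upper n :: 'r mat set"
  let ?u = "\<lambda>X. 1\<^sub>m n + pw ^ e \<cdot>\<^sub>m X"
  let ?c = "\<lambda>X. \<phi> (pw ^ e * superdiag_sum X)"
  \<comment> \<open>Left multiplication by \<open>?u A\<close> in the coordinate \<open>X\<close>.
    It permutes the strictly upper matrices, and \<open>A * X\<close> does not reach the
    superdiagonal.\<close>
  let ?f = "\<lambda>X. A + ?u A * X"
  note G = one_add_strictly_upper_GL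
  have Ac: "A \<in> carrier_mat n n" using A by (rule strictly_upper_carrier)
  have f: "?f X = A + (X + pw ^ e \<cdot>\<^sub>m (A * X))" if "X \<in> ?N" for X
    using Ac strictly_upper_carrier[OF that]
    by (simp add: add_mult_distrib_mat[of _ n n _ _ n] mult_smult_assoc_mat[of _ n n _ n])
  have fN: "?f X \<in> ?N" if X: "X \<in> ?N" for X
    unfolding f[OF X] by (intro strictly_upper_add strictly_upper_smult strictly_upper_mult A X)
  have inj: "inj_on ?f ?N"
  proof (rule inj_onI)
    fix X Y assume XY: "X \<in> ?N" "Y \<in> ?N" "?f X = ?f Y"
    have c: "X \<in> carrier_mat n n" "Y \<in> carrier_mat n n" using XY strictly_upper_carrier by auto
    have "?u A * X = ?u A * Y"
    proof (rule eq_matI)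
      fix i j assume ij: "i < dim_row (?u A * Y)" "j < dim_col (?u A * Y)"
      have "?f X $$ (i,j) = ?f Y $$ (i,j)" using XY by simp
      then show "(?u A * X) $$ (i,j) = (?u A * Y) $$ (i,j)"
        using ij Ac c by (simp del: index_mult_mat(1))
    qed (use Ac c in auto)
    then show "X = Y" using mult_left_inj_on_carrier[OF G[OF A]] c by (meson inj_onD)
  qed
  have "?f ` ?N \<subseteq> ?N" using fN by blast
  then have im: "?f ` ?N = ?N" using inj finite_strictly_upper by (simp add: endo_inj_surj)
  have uf: "?u (?f X) = ?u A * ?u X" if X: "X \<in> ?N" for X
    unfolding f[OF X] one_add_mult_one_add[OF Ac strictly_upper_carrier[OF X]]
    using Ac strictly_upper_carrier[OF X]
    by (intro eq_matI) (auto simp: algebra_simps simp del: index_mult_mat(1))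
  have cf: "?c (?f X) = ?c A * ?c X" if X: "X \<in> ?N" for X
  proof -
    have "superdiag_sum (?f X) = superdiag_sum A + superdiag_sum X"
      unfolding f[OF X] using Ac strictly_upper_carrier[OF X] superdiag_sum_strictly_upper_mult[OF A X]
      by (simp add: superdiag_sum_add[of _ n] superdiag_sum_smult[of _ n])
    then show ?thesis by (simp add: distrib_left char_add)
  qed
  have Xc: "\<rho> (?u X) *\<^sub>v w \<in> carrier_vec d" if "X \<in> ?N" for X
    using rep_vec_carrier[OF G[OF that] w] .
  let ?g = "\<lambda>X. inverse (?c X) \<cdot>\<^sub>v (\<rho> (?u X) *\<^sub>v w)"
  have "\<rho> (?u A) *\<^sub>v unipotent_sum e w = vsum d (\<lambda>X. \<rho> (?u A) *\<^sub>v ?g X) ?N"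
    unfolding unipotent_sum_def using Xc by (intro mult_mat_vsum[OF rep_carrier[OF G[OF A]]]) auto
  also have "\<dots> = vsum d (\<lambda>X. ?c A \<cdot>\<^sub>v ?g (?f X)) ?N"
  proof (rule vsum_cong)
    fix X assume X: "X \<in> ?N"
    show "\<rho> (?u A) *\<^sub>v ?g X = ?c A \<cdot>\<^sub>v ?g (?f X)"
      unfolding rep_vec_smult[OF G[OF A] Xc[OF X]] uf[OF X] cf[OF X] rep_mult_vec[OF G[OF A] G[OF X] w]
      by (simp add: smult_smult_assoc field_simps)
  qed
  also have "\<dots> = ?c A \<cdot>\<^sub>v vsum d (\<lambda>X. ?g (?f X)) ?N"
    using Xc[OF fN] by (intro smult_vsum[symmetric]) auto
  also have "vsum d (\<lambda>X. ?g (?f X)) ?N = unipotent_sum e w"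
    unfolding unipotent_sum_def using vsum_reindex[OF inj, of d ?g] im by simp
  finally show ?thesis .
qed

text \<open>The first unit vector is cyclic for \<open>C\<close>, so modulo \<open>pw\<close> a
  commuting matrix is determined by its first column, and that column of \<open>X\<close> is 0. The
  induction reads this off: modulo \<open>pw\<close>, column \<open>j + 1\<close> of
  \<open>X\<close> is \<open>C\<close> times column \<open>j\<close>.\<close>

lemma commuting_with_companion_residue:
  assumes C: "companion n C" and X: "X \<in> strictly_upper n"
    and comm: "pw ^ (l - 1) \<cdot>\<^sub>m (C * X - X * C) = 0\<^sub>m n n"
  obtains X' where "X' \<in> strictly_upper n" "X = pw \<cdot>\<^sub>m X'"
proof -
  let ?q = "pw ^ (l - 1)"
  have c: "C \<in> carrier_mat n n" "X \<in> carrier_mat n n"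
    using C X by (auto simp: companion_def strictly_upper_def)
  have zero: "\<forall>i<n. ?q * X $$ (i,j) = 0" if "j < n" for j
    using that
  proof (induct j)
    case 0
    then show ?case using X by (auto simp: strictly_upper_def)
  next
    case (Suc j)
    show ?case
    proof (intro allI impI)
      fix i assume i: "i < n"
      have "(?q \<cdot>\<^sub>m (C * X - X * C)) $$ (i,j) = 0" using comm i Suc by simp
      then have "?q * (C * X) $$ (i,j) = ?q * (X * C) $$ (i,j)"
        using c i Suc by (simp add: algebra_simps del: index_mult_mat(1))
      also have "(X * C) $$ (i,j) = X $$ (i, Suc j)"
        using mult_companion[OF c(2) C i] Suc by simp
      also have "(C * X) $$ (i,j) = (\<Sum>k<n. C $$ (i,k) * X $$ (k,j))"
        using i Suc by (intro index_mult_mat_sum c) auto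
      also have "?q * \<dots> = (\<Sum>k<n. C $$ (i,k) * (?q * X $$ (k,j)))"
        by (simp add: sum_distrib_left algebra_simps)
      also have "\<dots> = 0" using Suc by (intro sum.neutral) auto
      finally show "?q * X $$ (i, Suc j) = 0" by simp
    qed
  qed
  \<comment> \<open>Quotients by \<open>pw\<close> are not unique, so one is chosen; the value 0 on
    and below the diagonal keeps \<open>X'\<close> strictly upper.\<close>
  define X' where "X' = mat n n (\<lambda>(i,j). if j \<le> i then 0 else SOME y. X $$ (i,j) = pw * y)"
  have "X $$ (i,j) = pw * X' $$ (i,j)" if ij: "i < n" "j < n" for i j
  proof (cases "j \<le> i")
    case True
    then show ?thesis using X ij by (simp add: X'_def strictly_upper_def)
  next
    case False
    have "pw dvd X $$ (i,j)" using zero[OF ij(2)] ij(1) socle_mult_eq_0_iff by blast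
    then have "\<exists>y. X $$ (i,j) = pw * y" by (auto simp: dvd_def)
    then have "X $$ (i,j) = pw * (SOME y. X $$ (i,j) = pw * y)" by (rule someI_ex)
    then show ?thesis using False ij by (simp add: X'_def)
  qed
  then have "X = pw \<cdot>\<^sub>m X'" using c by (intro eq_matI) (auto simp: X'_def)
  moreover have "X' \<in> strictly_upper n" by (auto simp: X'_def strictly_upper_def)
  ultimately show thesis using that by blast
qed

text \<open>Summing the vanishing assumption over all \<open>Y\<close> kills every term of the sum over
  \<open>X\<close> except those for which \<open>X\<close> commutes with \<open>C\<close> modulo \<open>pw\<close>; such an \<open>X\<close> vanishes modulo
  \<open>pw\<close>, and its term is \<open>v\<close>.\<close>
lemma unipotent_sum_nonzero:
  assumes C: "companion n C" and v: "v \<in> carrier_vec d" "v \<noteq> 0\<^sub>v d"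
    and socle: "\<And>Y. Y \<in> carrier_mat n n \<Longrightarrow>
      \<rho> (1\<^sub>m n + pw ^ (l - 1) \<cdot>\<^sub>m Y) *\<^sub>v v = \<phi> (pw ^ (l - 1) * mat_trace (C * Y)) \<cdot>\<^sub>v v"
    and unip: "\<And>X. X \<in> strictly_upper n \<Longrightarrow>
      \<rho> (1\<^sub>m n + pw ^ j \<cdot>\<^sub>m X) *\<^sub>v v = \<phi> (pw ^ j * superdiag_sum X) \<cdot>\<^sub>v v"
    and j: "1 \<le> j" "j \<le> l - 1"
  obtains Y where "Y \<in> carrier_mat n n"
    "unipotent_sum (j - 1) (\<rho> (1\<^sub>m n + pw ^ (l - j) \<cdot>\<^sub>m Y) *\<^sub>v v) \<noteq> 0\<^sub>v d"
proof (rule ccontr)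
  let ?M = "carrier_mat n n :: 'r mat set"
  let ?N = "strictly_upper n :: 'r mat set"
  let ?q = "pw ^ (l - 1)" and ?a = "pw ^ (j - 1)" and ?b = "pw ^ (l - j)"
  let ?P = "\<lambda>X. 1\<^sub>m n + ?a \<cdot>\<^sub>m X" and ?Q = "\<lambda>Y. 1\<^sub>m n + ?b \<cdot>\<^sub>m Y"
  let ?c = "\<lambda>X. inverse (\<phi> (?a * superdiag_sum X))"
  assume "\<not> thesis"
  with that have zero: "unipotent_sum (j - 1) (\<rho> (?Q Y) *\<^sub>v v) = 0\<^sub>v d" if "Y \<in> ?M" for Y
    using that by blast
  have Cc: "C \<in> ?M" using C by (simp add: companion_def)
  have ab: "?a * ?b = ?q" using j by (simp flip: power_add)
  have bq: "?b * ?q = 0" using socle_mult_power[of "l - j"] j by (simp add: mult.commute)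
  note PG = one_add_strictly_upper_GL[where a = ?a]
  have QG: "?Q Y \<in> GL n" if "Y \<in> ?M" for Y using one_add_GL[OF that, of "l - j"] j by simp
  define R where "R X = (SOME B. B \<in> GL n \<and> ?P X * B = 1\<^sub>m n \<and> B * ?P X = 1\<^sub>m n)" for X
  have R: "R X \<in> GL n" "?P X * R X = 1\<^sub>m n" "R X * ?P X = 1\<^sub>m n" if X: "X \<in> ?N" for X
  proof -
    have "\<exists>B. B \<in> GL n \<and> ?P X * B = 1\<^sub>m n \<and> B * ?P X = 1\<^sub>m n" using GL_inverse[OF PG[OF X]] by metis
    from someI_ex[OF this] show "R X \<in> GL n" "?P X * R X = 1\<^sub>m n" "R X * ?P X = 1\<^sub>m n"
      by (auto simp: R_def)
  qed
  have Rc: "R X \<in> ?M" if "X \<in> ?N" for X using R(1)[OF that] by (rule GL_carrier)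
  have PR: "?P X * R X = 1\<^sub>m n" if "X \<in> ?N" for X using R[OF that] by simp
  \<comment> \<open>Read off from the trace of \<open>C * (R X * (X * Y - Y * X))\<close>: as
    \<open>R X\<close> commutes with \<open>X\<close>, cyclic rotation turns it into the trace of
    \<open>Y * Z X\<close>.\<close>
  define Z where "Z X = (C * X - X * C) * R X" for X
  have Zc: "Z X \<in> ?M" if "X \<in> ?N" for X
    using Cc Rc[OF that] strictly_upper_carrier[OF that] by (simp add: Z_def minus_carrier_mat)
  have RX: "R X * X = X * R X" if X: "X \<in> ?N" for X
  proof -
    have Xc: "X \<in> ?M" using X by (rule strictly_upper_carrier)
    have Pc: "?P X \<in> ?M" using Xc by simp
    have PX: "?P X * X = X * ?P X"
      using Xc by (simp add: mult_add_distrib_mat[of _ n n _ n] add_mult_distrib_mat[of _ n n _ _ n]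
        mult_smult_distrib[of _ n n _ n] mult_smult_assoc_mat[of _ n n _ n])
    have "R X * X = R X * (X * (?P X * R X))" using PR[OF X] Xc by simp
    also have "X * (?P X * R X) = ?P X * (X * R X)"
      using assoc_mult_mat[OF Xc Pc Rc[OF X]] assoc_mult_mat[OF Pc Xc Rc[OF X]] PX by simp
    also have "R X * (?P X * (X * R X)) = X * R X"
      using mat_mult_left_cancel[OF Rc[OF X] Pc R(3)[OF X], of "X * R X"] Xc Rc[OF X] by simp
    finally show ?thesis .
  qed
  have key: "\<rho> (?P X) *\<^sub>v (\<rho> (?Q Y) *\<^sub>v v) =
      \<phi> (mat_trace (Y * (?q \<cdot>\<^sub>m Z X))) \<cdot>\<^sub>v (\<rho> (?Q Y) *\<^sub>v (\<rho> (?P X) *\<^sub>v v))"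
    if X: "X \<in> ?N" and Y: "Y \<in> ?M" for X Y
  proof -
    have Xc: "X \<in> ?M" using X by (rule strictly_upper_carrier)
    note Rc = Rc[OF X]
    define D where "D = X * Y - Y * X"
    have Dc: "D \<in> ?M" using Xc Y by (simp add: D_def minus_carrier_mat)
    have RDc: "R X * D \<in> ?M" using Rc Dc by simp
    \<comment> \<open>The correction in \<open>?P X * ?Q Y = ?Q Y * (?P X * \<kappa>)\<close>. It
      lies in the socle group, hence acts on \<open>v\<close> by the given character.\<close>
    define \<kappa> where "\<kappa> = 1\<^sub>m n + ?q \<cdot>\<^sub>m (R X * D)"
    have \<kappa>G: "\<kappa> \<in> GL n" unfolding \<kappa>_def using one_add_GL[OF RDc, of "l - 1"] l_ge_2 by simp
    have Pc: "?P X \<in> ?M" and Qc: "?Q Y \<in> ?M" using Xc Y by auto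
    have "?P X * \<kappa> = ?P X + ?q \<cdot>\<^sub>m (?P X * (R X * D))"
      unfolding \<kappa>_def using mult_add_distrib_mat[OF Pc one_carrier_mat, of "?q \<cdot>\<^sub>m (R X * D)"]
        mult_smult_distrib[OF Pc RDc] RDc right_mult_one_mat[OF Pc] by simp
    also have "?P X * (R X * D) = D"
      by (rule mat_mult_left_cancel[OF Pc Rc PR[OF X] Dc])
    finally have P\<kappa>: "?P X * \<kappa> = ?P X + ?q \<cdot>\<^sub>m D" .
    have "?Q Y * (?q \<cdot>\<^sub>m D) = ?q \<cdot>\<^sub>m D + (?b \<cdot>\<^sub>m Y) * (?q \<cdot>\<^sub>m D)"
      using Y Dc by (simp add: add_mult_distrib_mat[of _ n n _ _ n])
    also have "(?b \<cdot>\<^sub>m Y) * (?q \<cdot>\<^sub>m D) = (?b * ?q) \<cdot>\<^sub>m (Y * D)"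
      using Y Dc by (intro eq_matI) (auto simp: mult.assoc)
    also have "?q \<cdot>\<^sub>m D + \<dots> = ?q \<cdot>\<^sub>m D"
      unfolding bq using Y Dc by (intro eq_matI) auto
    finally have QqD: "?Q Y * (?q \<cdot>\<^sub>m D) = ?q \<cdot>\<^sub>m D" .
    have "?Q Y * (?P X * \<kappa>) = ?Q Y * ?P X + ?q \<cdot>\<^sub>m D"
      unfolding P\<kappa> using mult_add_distrib_mat[OF Qc Pc, of "?q \<cdot>\<^sub>m D"] QqD Dc by simp
    also have "\<dots> = ?P X * ?Q Y"
      unfolding one_add_mult_one_add[OF Y Xc] one_add_mult_one_add[OF Xc Y] D_def ab
        mult.commute[of ?b ?a]
      using Xc Y by (intro eq_matI) (auto simp: algebra_simps simp del: index_mult_mat(1))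
    finally have eq: "?P X * ?Q Y = ?Q Y * (?P X * \<kappa>)" by simp
    have tr: "?q * mat_trace (C * (R X * D)) = mat_trace (Y * (?q \<cdot>\<^sub>m Z X))"
    proof -
      have "C * (R X * D) = C * (R X * (X * Y)) - C * (R X * (Y * X))"
        unfolding D_def using Cc Rc Xc Y by (simp add: mult_minus_distrib_mat[of _ n n _ n])
      then have "mat_trace (C * (R X * D)) = mat_trace (C * (R X * (X * Y))) - mat_trace (C * (R X * (Y * X)))"
        using Cc Rc Xc Y by (simp add: mat_trace_minus[of _ n])
      also have "C * (R X * (X * Y)) = (C * X * R X) * Y"
      proof -
        have "C * (R X * (X * Y)) = C * ((R X * X) * Y)" using Rc Xc Y by (simp add: assoc_mult_mat[of _ n n _ n _ n])
        then show ?thesis unfolding RX[OF X] using Cc Rc Xc Y by (simp add: assoc_mult_mat[of _ n n _ n _ n])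
      qed
      also have "C * (R X * (Y * X)) = (C * R X * Y) * X"
        using Cc Rc Xc Y by (simp add: assoc_mult_mat[of _ n n _ n _ n])
      also have "mat_trace ((C * R X * Y) * X) = mat_trace (X * (C * R X * Y))"
        using Cc Rc Xc Y by (intro mat_trace_comm[of _ n]) auto
      also have "X * (C * R X * Y) = (X * C * R X) * Y"
        using Cc Rc Xc Y by (simp add: assoc_mult_mat[of _ n n _ n _ n])
      also have "mat_trace ((C * X * R X) * Y) - mat_trace ((X * C * R X) * Y) = mat_trace (Z X * Y)"
        unfolding Z_def using Cc Rc Xc Y
        by (simp add: minus_mult_distrib_mat[of _ n n _ _ n] mat_trace_minus[of _ n])
      also have "\<dots> = mat_trace (Y * Z X)" by (rule mat_trace_comm[OF Zc[OF X] Y])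
      finally show ?thesis
        using mult_smult_distrib[OF Y Zc[OF X]] mat_trace_smult[of "Y * Z X" n] Y Zc[OF X] by simp
    qed
    have "\<rho> (?P X) *\<^sub>v (\<rho> (?Q Y) *\<^sub>v v) = \<rho> (?Q Y) *\<^sub>v (\<rho> (?P X) *\<^sub>v (\<rho> \<kappa> *\<^sub>v v))"
      unfolding rep_mult_vec[OF PG[OF X] QG[OF Y] v(1), symmetric] eq
        rep_mult_vec[OF QG[OF Y] GL_mult[OF PG[OF X] \<kappa>G] v(1)] rep_mult_vec[OF PG[OF X] \<kappa>G v(1)] ..
    also have "\<rho> \<kappa> *\<^sub>v v = \<phi> (mat_trace (Y * (?q \<cdot>\<^sub>m Z X))) \<cdot>\<^sub>v v"
      unfolding \<kappa>_def socle[OF RDc] tr ..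
    finally show ?thesis
      unfolding rep_vec_smult[OF PG[OF X] v(1)] rep_vec_smult[OF QG[OF Y] rep_vec_carrier[OF PG[OF X] v(1)]] .
  qed
  let ?t = "\<lambda>X Y. (?c X * \<phi> (mat_trace (Y * (?q \<cdot>\<^sub>m Z X)))) \<cdot>\<^sub>v (\<rho> (?P X) *\<^sub>v v)"
  have Pv: "\<rho> (?P X) *\<^sub>v v \<in> carrier_vec d" if "X \<in> ?N" for X
    using rep_vec_carrier[OF PG[OF that] v(1)] .
  \<comment> \<open>By \<open>key\<close>, the operator of \<open>?Q Y\<close> can be pulled to the
    front of the vanishing sum and cancelled.\<close>
  have inner: "vsum d (\<lambda>X. ?t X Y) ?N = 0\<^sub>v d" if Y: "Y \<in> ?M" for Y
  proof -
    let ?s = "vsum d (\<lambda>X. ?t X Y) ?N"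
    have "\<rho> (?Q Y) *\<^sub>v ?s = vsum d (\<lambda>X. \<rho> (?Q Y) *\<^sub>v ?t X Y) ?N"
      using Pv by (intro mult_mat_vsum[OF rep_carrier[OF QG[OF Y]]]) auto
    also have "\<dots> = unipotent_sum (j - 1) (\<rho> (?Q Y) *\<^sub>v v)"
      unfolding unipotent_sum_def
    proof (rule vsum_cong)
      fix X assume X: "X \<in> ?N"
      show "\<rho> (?Q Y) *\<^sub>v ?t X Y = ?c X \<cdot>\<^sub>v (\<rho> (?P X) *\<^sub>v (\<rho> (?Q Y) *\<^sub>v v))"
        unfolding rep_vec_smult[OF QG[OF Y] Pv[OF X]] key[OF X Y] smult_smult_assoc ..
    qed
    finally have z: "\<rho> (?Q Y) *\<^sub>v ?s = 0\<^sub>v d" using zero[OF Y] by simp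
    obtain k where k: "k \<in> GL n" "k * ?Q Y = 1\<^sub>m n" using GL_inverse[OF QG[OF Y]] by blast
    have "?s = \<rho> (k * ?Q Y) *\<^sub>v ?s" by (simp add: k(2) rep_one_vec)
    also have "\<dots> = \<rho> k *\<^sub>v (\<rho> (?Q Y) *\<^sub>v ?s)" by (rule rep_mult_vec[OF k(1) QG[OF Y]]) simp
    also have "\<dots> = 0\<^sub>v d" unfolding z by (rule mat_mult_zero_vec[OF rep_carrier[OF k(1)]])
    finally show ?thesis .
  qed
  have "vsum d (\<lambda>Y. vsum d (\<lambda>X. ?t X Y) ?N) ?M = vsum d (\<lambda>Y. 0\<^sub>v d) ?M"
    by (rule vsum_cong) (rule inner)
  also have "\<dots> = 0\<^sub>v d" by (auto simp: vsum_def)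
  \<comment> \<open>With \<open>Y\<close> as the inner variable, orthogonality keeps only those
    \<open>X\<close> for which \<open>?q \<cdot>\<^sub>m Z X\<close> is 0.\<close>
  finally have total: "vsum d (\<lambda>X. vsum d (\<lambda>Y. ?t X Y) ?M) ?N = 0\<^sub>v d" by (subst vsum_swap)
  let ?B = "\<lambda>X. ?q \<cdot>\<^sub>m Z X = 0\<^sub>m n n"
  have summand: "vsum d (\<lambda>Y. ?t X Y) ?M = (if ?B X then of_nat (card ?M) else 0) \<cdot>\<^sub>v v" if X: "X \<in> ?N" for X
  proof -
    have "vsum d (\<lambda>Y. ?t X Y) ?M = (?c X * (\<Sum>Y\<in>?M. \<phi> (mat_trace (Y * (?q \<cdot>\<^sub>m Z X))))) \<cdot>\<^sub>v (\<rho> (?P X) *\<^sub>v v)"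
      unfolding vsum_smult_const[OF Pv[OF X]] sum_distrib_left ..
    also have "(\<Sum>Y\<in>?M. \<phi> (mat_trace (Y * (?q \<cdot>\<^sub>m Z X)))) = (if ?B X then of_nat (card ?M) else 0)"
      by (rule char_sum_carrier) (use Zc[OF X] in simp)
    finally have e: "vsum d (\<lambda>Y. ?t X Y) ?M =
        (?c X * (if ?B X then of_nat (card ?M) else 0)) \<cdot>\<^sub>v (\<rho> (?P X) *\<^sub>v v)" .
    show ?thesis
    proof (cases "?B X")
      case False
      then show ?thesis unfolding e
        using smult_vec_eq_zero_iff[OF Pv[OF X], of 0] smult_vec_eq_zero_iff[OF v(1), of 0] by simp
    next
      case True
      have Xc: "X \<in> ?M" using X by (rule strictly_upper_carrier)
      have Wc: "C * X - X * C \<in> ?M" using Cc Xc by (simp add: minus_carrier_mat)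
      \<comment> \<open>Multiplying by \<open>?P X\<close> removes \<open>R X\<close> and leaves the
        commutator with \<open>C\<close>.\<close>
      have "?q \<cdot>\<^sub>m (C * X - X * C) = (?q \<cdot>\<^sub>m Z X) * ?P X"
      proof -
        have "Z X * ?P X = C * X - X * C"
          unfolding Z_def using assoc_mult_mat[OF Wc Rc[OF X], of "?P X" n] R(3)[OF X] Xc
            right_mult_one_mat[OF Wc] by simp
        then show ?thesis using mult_smult_assoc_mat[OF Zc[OF X], of "?P X" n] Xc by simp
      qed
      also have "\<dots> = 0\<^sub>m n n" unfolding True using Xc by simp
      finally obtain X' where X': "X' \<in> ?N" "X = pw \<cdot>\<^sub>m X'"
        using commuting_with_companion_residue[OF C X] by blast
      \<comment> \<open>The factor \<open>pw\<close> of \<open>X\<close> raises the exponent from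
        \<open>j - 1\<close> to \<open>j\<close>, where \<open>unip\<close> describes the action on
        \<open>v\<close>.\<close>
      have aj: "?a * pw = pw ^ j" using j by (cases j) auto
      have "?P X = 1\<^sub>m n + pw ^ j \<cdot>\<^sub>m X'"
        unfolding X'(2) aj[symmetric] using strictly_upper_carrier[OF X'(1)] by (intro eq_matI) (auto simp: mult.assoc)
      moreover have "?a * superdiag_sum X = pw ^ j * superdiag_sum X'"
        unfolding X'(2) aj[symmetric] using superdiag_sum_smult[OF strictly_upper_carrier[OF X'(1)]]
        by (simp add: mult.assoc)
      ultimately have "?c X \<cdot>\<^sub>v (\<rho> (?P X) *\<^sub>v v) = v" using unip[OF X'(1)] by (simp add: smult_smult_assoc)
      then have "of_nat (card ?M) \<cdot>\<^sub>v (?c X \<cdot>\<^sub>v (\<rho> (?P X) *\<^sub>v v)) = of_nat (card ?M) \<cdot>\<^sub>v v" by simp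
      then show ?thesis unfolding e using True by (simp add: smult_smult_assoc mult.commute)
    qed
  qed
  have "0\<^sub>v d = vsum d (\<lambda>X. (if ?B X then of_nat (card ?M) else 0) \<cdot>\<^sub>v v) ?N"
    using total vsum_cong[of ?N, OF summand] by simp
  also have "\<dots> = (\<Sum>X\<in>?N. if ?B X then of_nat (card ?M) else 0) \<cdot>\<^sub>v v"
    by (rule vsum_smult_const[OF v(1)])
  finally have "(\<Sum>X\<in>?N. if ?B X then of_nat (card ?M) else 0) = (0 :: complex)"
    using smult_vec_eq_zero_iff[OF v(1)] v(2) by metis
  then have "of_nat (card {X \<in> ?N. ?B X} * card ?M) = (0 :: complex)"
    by (simp add: sum.inter_filter[OF finite_strictly_upper, symmetric])
  then have "card {X \<in> ?N. ?B X} * card ?M = 0" by (simp only: of_nat_eq_0_iff)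
  moreover have "card {X \<in> ?N. ?B X} \<noteq> 0"
  proof
    assume "card {X \<in> ?N. ?B X} = 0"
    then have empty: "{X \<in> ?N. ?B X} = {}" using finite_strictly_upper by simp
    have "C * 0\<^sub>m n n - 0\<^sub>m n n * C = 0\<^sub>m n n" using Cc by (intro eq_matI) auto
    then have "?B (0\<^sub>m n n)" unfolding Z_def using Rc[OF zero_strictly_upper]
      by (simp del: right_mult_zero_mat' left_mult_zero_mat' add: left_mult_zero_mat[of _ n n])
    then show False using zero_strictly_upper empty by blast
  qed
  moreover have "card ?M \<noteq> 0"
    using card_gt_0_iff[of ?M] finite_carrier_mat[OF finite_ring, of n n] zero_carrier_mat[of n n] by fastforce
  ultimately show False by simp
qed

text \<open>For \<open>e \<ge> 1\<close> the averaging group commutes with the socle group, because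
  \<open>pw ^ (l - 1) * pw ^ e\<close> is 0.\<close>

lemma socle_character_unipotent_sum:
  assumes w: "w \<in> carrier_vec d" and e: "e \<ge> 1"
    and socle: "\<And>Y. Y \<in> carrier_mat n n \<Longrightarrow>
      \<rho> (1\<^sub>m n + pw ^ (l - 1) \<cdot>\<^sub>m Y) *\<^sub>v w = f Y \<cdot>\<^sub>v w"
    and Y: "Y \<in> carrier_mat n n"
  shows "\<rho> (1\<^sub>m n + pw ^ (l - 1) \<cdot>\<^sub>m Y) *\<^sub>v unipotent_sum e w = f Y \<cdot>\<^sub>v unipotent_sum e w"
proof -
  let ?N = "strictly_upper n :: 'r mat set"
  let ?k = "1\<^sub>m n + pw ^ (l - 1) \<cdot>\<^sub>m Y" and ?P = "\<lambda>X. 1\<^sub>m n + pw ^ e \<cdot>\<^sub>m X"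
  note PG = one_add_strictly_upper_GL[where a = "pw ^ e"]
  have kG: "?k \<in> GL n" using one_add_GL[OF Y, of "l - 1"] l_ge_2 by simp
  have Pv: "\<rho> (?P X) *\<^sub>v w \<in> carrier_vec d" if "X \<in> ?N" for X
    using rep_vec_carrier[OF PG[OF that] w] .
  have "\<rho> ?k *\<^sub>v unipotent_sum e w =
      vsum d (\<lambda>X. \<rho> ?k *\<^sub>v (inverse (\<phi> (pw ^ e * superdiag_sum X)) \<cdot>\<^sub>v (\<rho> (?P X) *\<^sub>v w))) ?N"
    unfolding unipotent_sum_def using Pv by (intro mult_mat_vsum[OF rep_carrier[OF kG]]) auto
  also have "\<dots> = vsum d (\<lambda>X. f Y \<cdot>\<^sub>v (inverse (\<phi> (pw ^ e * superdiag_sum X)) \<cdot>\<^sub>v (\<rho> (?P X) *\<^sub>v w))) ?N"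
  proof (rule vsum_cong)
    fix X assume X: "X \<in> ?N"
    have "?k * ?P X = ?P X * ?k"
      by (rule one_add_commute[OF Y strictly_upper_carrier[OF X] socle_mult_power[OF e]])
    then have "\<rho> ?k *\<^sub>v (\<rho> (?P X) *\<^sub>v w) = \<rho> (?P X) *\<^sub>v (\<rho> ?k *\<^sub>v w)"
      using rep_mult_vec[OF kG PG[OF X] w] rep_mult_vec[OF PG[OF X] kG w] by simp
    also have "\<dots> = f Y \<cdot>\<^sub>v (\<rho> (?P X) *\<^sub>v w)" unfolding socle[OF Y] by (rule rep_vec_smult[OF PG[OF X] w])
    finally show "\<rho> ?k *\<^sub>v (inverse (\<phi> (pw ^ e * superdiag_sum X)) \<cdot>\<^sub>v (\<rho> (?P X) *\<^sub>v w)) =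
        f Y \<cdot>\<^sub>v (inverse (\<phi> (pw ^ e * superdiag_sum X)) \<cdot>\<^sub>v (\<rho> (?P X) *\<^sub>v w))"
      unfolding rep_vec_smult[OF kG Pv[OF X]] by (simp add: smult_smult_assoc mult.commute)
  qed
  also have "\<dots> = f Y \<cdot>\<^sub>v unipotent_sum e w"
    unfolding unipotent_sum_def using Pv by (intro smult_vsum[symmetric]) auto
  finally show ?thesis .
qed

text \<open>The descent from exponent \<open>l - 1\<close> to 1 carries the socle character along,
  since each further step relies on it. The passage from 1 to 0 stands apart: \<open>U\<close> does
  not in general centralise the socle group, so only the \<open>\<psi>\<close>-property survives
  there.\<close>

lemma whittaker_nonzero_if_companion:
  assumes C: "companion n C" and v: "v \<in> carrier_vec d" "v \<noteq> 0\<^sub>v d"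
    and socle: "\<And>Y. Y \<in> carrier_mat n n \<Longrightarrow>
      \<rho> (1\<^sub>m n + pw ^ (l - 1) \<cdot>\<^sub>m Y) *\<^sub>v v = \<phi> (pw ^ (l - 1) * mat_trace (C * Y)) \<cdot>\<^sub>v v"
  obtains w where "w \<in> carrier_vec d" "whittaker *\<^sub>v w \<noteq> 0\<^sub>v d"
proof -
  define good where "good j w \<longleftrightarrow> w \<in> carrier_vec d \<and> w \<noteq> 0\<^sub>v d \<and>
    (\<forall>Y\<in>carrier_mat n n. \<rho> (1\<^sub>m n + pw ^ (l - 1) \<cdot>\<^sub>m Y) *\<^sub>v w = \<phi> (pw ^ (l - 1) * mat_trace (C * Y)) \<cdot>\<^sub>v w) \<and>
    (\<forall>X\<in>strictly_upper n. \<rho> (1\<^sub>m n + pw ^ j \<cdot>\<^sub>m X) *\<^sub>v w = \<phi> (pw ^ j * superdiag_sum X) \<cdot>\<^sub>v w)" for j w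
  have QG: "1\<^sub>m n + pw ^ (l - j) \<cdot>\<^sub>m Y \<in> GL n" if "Y \<in> carrier_mat n n" "j \<le> l - 1" for Y j
    using one_add_GL[OF that(1), of "l - j"] that(2) l_ge_2 by simp
  \<comment> \<open>At this exponent the unipotent group lies in the socle group, and the Hessenberg
    shape of \<open>C\<close> makes the socle character restrict to \<open>\<psi>\<close>.\<close>
  have "good (l - 1) v"
    unfolding good_def
  proof (intro conjI ballI v)
    fix X :: "'r mat" assume X: "X \<in> strictly_upper n"
    show "\<rho> (1\<^sub>m n + pw ^ (l - 1) \<cdot>\<^sub>m X) *\<^sub>v v = \<phi> (pw ^ (l - 1) * superdiag_sum X) \<cdot>\<^sub>v v"
      using socle[OF strictly_upper_carrier[OF X]] mat_trace_hessenberg[OF companion_hessenberg[OF C] X] by simp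
  qed (rule socle)
  then have "\<exists>w. good (l - 1 - i) w" if "i \<le> l - 2" for i
    using that
  proof (induct i)
    case 0
    then show ?case by auto
  next
    case (Suc i)
    let ?j = "l - 1 - i"
    obtain w where w: "good ?j w" using Suc by auto
    have j: "1 \<le> ?j" "?j \<le> l - 1" "?j - 1 \<ge> 1" using Suc(3) l_ge_2 by auto
    obtain Y where Y: "Y \<in> carrier_mat n n"
      "unipotent_sum (?j - 1) (\<rho> (1\<^sub>m n + pw ^ (l - ?j) \<cdot>\<^sub>m Y) *\<^sub>v w) \<noteq> 0\<^sub>v d"
      using unipotent_sum_nonzero[OF C _ _ _ _ j(1,2), of w] w unfolding good_def by blast
    define w1 where "w1 = \<rho> (1\<^sub>m n + pw ^ (l - ?j) \<cdot>\<^sub>m Y) *\<^sub>v w"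
    have wc: "w \<in> carrier_vec d" using w by (simp add: good_def)
    have w1: "w1 \<in> carrier_vec d" unfolding w1_def by (rule rep_vec_carrier[OF QG[OF Y(1) j(2)] wc])
    have soc1: "\<rho> (1\<^sub>m n + pw ^ (l - 1) \<cdot>\<^sub>m A) *\<^sub>v w1 = \<phi> (pw ^ (l - 1) * mat_trace (C * A)) \<cdot>\<^sub>v w1"
      if A: "A \<in> carrier_mat n n" for A
    proof -
      let ?k = "1\<^sub>m n + pw ^ (l - 1) \<cdot>\<^sub>m A" and ?Q = "1\<^sub>m n + pw ^ (l - ?j) \<cdot>\<^sub>m Y"
      have kG: "?k \<in> GL n" using one_add_GL[OF A, of "l - 1"] l_ge_2 by simp
      have "pw ^ (l - 1) * pw ^ (l - ?j) = 0" using j by (intro socle_mult_power) auto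
      then have "?k * ?Q = ?Q * ?k" by (rule one_add_commute[OF A Y(1)])
      then have "\<rho> ?k *\<^sub>v w1 = \<rho> ?Q *\<^sub>v (\<rho> ?k *\<^sub>v w)"
        using rep_mult_vec[OF kG QG[OF Y(1) j(2)] wc] rep_mult_vec[OF QG[OF Y(1) j(2)] kG wc]
        by (simp add: w1_def)
      also have "\<rho> ?k *\<^sub>v w = \<phi> (pw ^ (l - 1) * mat_trace (C * A)) \<cdot>\<^sub>v w" using w A by (simp add: good_def)
      finally show ?thesis unfolding w1_def rep_vec_smult[OF QG[OF Y(1) j(2)] wc] .
    qed
    have "good (?j - 1) (unipotent_sum (?j - 1) w1)"
      unfolding good_def
    proof (intro conjI ballI)
      show "unipotent_sum (?j - 1) w1 \<in> carrier_vec d" by (simp add: unipotent_sum_def)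
      show "unipotent_sum (?j - 1) w1 \<noteq> 0\<^sub>v d" using Y(2) by (simp add: w1_def)
      show "\<rho> (1\<^sub>m n + pw ^ (?j - 1) \<cdot>\<^sub>m X) *\<^sub>v unipotent_sum (?j - 1) w1 =
        \<phi> (pw ^ (?j - 1) * superdiag_sum X) \<cdot>\<^sub>v unipotent_sum (?j - 1) w1" if "X \<in> strictly_upper n" for X
        by (rule rep_unipotent_sum[OF that w1])
      show "\<rho> (1\<^sub>m n + pw ^ (l - 1) \<cdot>\<^sub>m A) *\<^sub>v unipotent_sum (?j - 1) w1 =
        \<phi> (pw ^ (l - 1) * mat_trace (C * A)) \<cdot>\<^sub>v unipotent_sum (?j - 1) w1" if "A \<in> carrier_mat n n" for A
        by (rule socle_character_unipotent_sum[OF w1 j(3) soc1 that])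
    qed
    moreover have "?j - 1 = l - 1 - Suc i" by simp
    ultimately show ?case by metis
  qed
  from this[of "l - 2"] obtain w where "good (l - 1 - (l - 2)) w" by auto
  moreover have "l - 1 - (l - 2) = 1" using l_ge_2 by simp
  ultimately have w: "good 1 w" by simp
  have "1 \<le> l - 1" using l_ge_2 by simp
  \<comment> \<open>The case \<open>j = 1\<close>: the average now runs over all of
    \<open>U\<close>.\<close>
  then obtain Y where Y: "Y \<in> carrier_mat n n"
    "unipotent_sum (1 - 1) (\<rho> (1\<^sub>m n + pw ^ (l - 1) \<cdot>\<^sub>m Y) *\<^sub>v w) \<noteq> 0\<^sub>v d"
    using unipotent_sum_nonzero[OF C _ _ _ _ order_refl, of w] w unfolding good_def by blast
  define w1 where "w1 = \<rho> (1\<^sub>m n + pw ^ (l - 1) \<cdot>\<^sub>m Y) *\<^sub>v w"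
  have w1: "w1 \<in> carrier_vec d"
    unfolding w1_def using w QG[OF Y(1), of 1] l_ge_2 by (intro rep_vec_carrier) (auto simp: good_def)
  define y where "y = unipotent_sum 0 w1"
  have y: "y \<in> carrier_vec d" "y \<noteq> 0\<^sub>v d" using Y(2) by (auto simp: y_def unipotent_sum_def w1_def)
  have "inverse (\<psi> u) \<cdot>\<^sub>v (\<rho> u *\<^sub>v y) = y" if u: "u \<in> unitriangular n" for u
  proof -
    define X where "X = u - 1\<^sub>m n"
    have uc: "u \<in> carrier_mat n n" using u by (rule unitriangular_carrier)
    have X: "X \<in> strictly_upper n" using u by (auto simp: X_def strictly_upper_def unitriangular_def)
    have uX: "u = 1\<^sub>m n + X" unfolding X_def using uc by (intro eq_matI) auto
    have X1: "pw ^ 0 \<cdot>\<^sub>m X = X" by (intro eq_matI) auto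
    have "\<rho> u *\<^sub>v y = \<phi> (superdiag_sum X) \<cdot>\<^sub>v y"
      using rep_unipotent_sum[OF X w1, of 0] unfolding X1 uX y_def by simp
    moreover have "\<psi> u = \<phi> (superdiag_sum X)"
      unfolding \<psi>_def uX superdiag_sum_one_add[OF strictly_upper_carrier[OF X]] ..
    ultimately show ?thesis by (simp add: smult_smult_assoc)
  qed
  then have "whittaker *\<^sub>v y = of_nat (card (unitriangular n :: 'r mat set)) \<cdot>\<^sub>v y"
    unfolding whittaker_apply[OF y(1)] vsum_const[OF y(1), symmetric] by (intro vsum_cong) auto
  moreover have "card (unitriangular n :: 'r mat set) \<noteq> 0"
    using finite_unitriangular one_unitriangular by (auto simp: card_eq_0_iff)
  ultimately have "whittaker *\<^sub>v y \<noteq> 0\<^sub>v d" using smult_vec_eq_zero_iff[OF y(1)] y(2) by simp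
  with y(1) that show thesis by blast
qed

text \<open>A cyclic vector over the residue field lifts: the Krylov determinant of any lift is
  nonzero modulo \<open>pw\<close>, hence a unit. This base change brings \<open>x\<close> into
  companion form over the ring itself, and \<open>\<rho> L\<close> carries the eigenvector
  along.\<close>

lemma whittaker_nonzero_if_regular:
  assumes x: "x \<in> carrier_mat n n" and reg: "regular_mat (map_mat \<pi> x)"
    and cont: "contains_phi_x pw l \<phi> n \<rho> d x"
  obtains w where "w \<in> carrier_vec d" "whittaker *\<^sub>v w \<noteq> 0\<^sub>v d"
proof -
  have xc: "map_mat \<pi> x \<in> carrier_mat n n" using x by simp
  obtain b where b: "b \<in> carrier_vec n" "det (krylov n (map_mat \<pi> x) b) \<noteq> 0"
    using regular_mat_krylov[OF xc reg] by blast
  have surj: "surj \<pi>" using residue by (simp add: residue_map_def)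
  define a where "a = vec n (\<lambda>i. inv_into UNIV \<pi> (b $ i))"
  have a: "a \<in> carrier_vec n" by (simp add: a_def)
  have ab: "map_vec \<pi> a = b" using b surj by (intro eq_vecI) (auto simp: a_def f_inv_into_f)
  have iter: "map_vec \<pi> (((*\<^sub>v) x ^^ k) a) = ((*\<^sub>v) (map_mat \<pi> x) ^^ k) b" for k
  proof (induct k)
    case (Suc k)
    then show ?case using residue.mult_mat_vec_hom[OF x iter_mult_mat_vec_carrier[OF x a, of k]] by simp
  qed (simp add: ab)
  let ?K = "krylov n x a"
  have "map_mat \<pi> ?K = krylov n (map_mat \<pi> x) b"
  proof (rule eq_matI)
    fix i j assume "i < dim_row (krylov n (map_mat \<pi> x) b)" "j < dim_col (krylov n (map_mat \<pi> x) b)"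
    then have ij: "i < n" "j < n" by (auto simp: krylov_def)
    have "map_vec \<pi> (((*\<^sub>v) x ^^ j) a) $ i = \<pi> ((((*\<^sub>v) x ^^ j) a) $ i)"
      using iter_mult_mat_vec_carrier[OF x a, of j] ij by (intro index_map_vec) auto
    then show "map_mat \<pi> ?K $$ (i,j) = krylov n (map_mat \<pi> x) b $$ (i,j)"
      using ij iter[of j] by (simp add: krylov_def)
  qed (auto simp: krylov_def)
  then have KG: "?K \<in> GL n" using b(2) by (intro GL_if_residue) auto
  obtain L where L: "L \<in> GL n" "?K * L = 1\<^sub>m n" "L * ?K = 1\<^sub>m n" using GL_inverse[OF KG] by blast
  have Lc: "L \<in> carrier_mat n n" and Kc: "?K \<in> carrier_mat n n" using L GL_carrier by auto
  define C where "C = L * (x * ?K)"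
  have C: "companion n C" unfolding C_def by (rule companion_krylov[OF x a Lc L(3)])
  obtain v where v: "v \<in> carrier_vec d" "v \<noteq> 0\<^sub>v d"
    "\<And>y. y \<in> carrier_mat n n \<Longrightarrow>
      \<rho> (1\<^sub>m n + pw ^ (l - 1) \<cdot>\<^sub>m y) *\<^sub>v v = \<phi> (pw ^ (l - 1) * mat_trace (x * y)) \<cdot>\<^sub>v v"
    using cont unfolding contains_phi_x_def by blast
  let ?v = "\<rho> L *\<^sub>v v"
  have vc: "?v \<in> carrier_vec d" by (rule rep_vec_carrier[OF L(1) v(1)])
  have v0: "?v \<noteq> 0\<^sub>v d"
  proof
    assume z: "?v = 0\<^sub>v d"
    have "v = \<rho> (?K * L) *\<^sub>v v" using v by (simp add: L(2) rep_one_vec)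
    also have "\<dots> = \<rho> ?K *\<^sub>v ?v" by (rule rep_mult_vec[OF KG L(1) v(1)])
    also have "\<dots> = 0\<^sub>v d" unfolding z by (rule mat_mult_zero_vec[OF rep_carrier[OF KG]])
    finally show False using v by simp
  qed
  have "\<rho> (1\<^sub>m n + pw ^ (l - 1) \<cdot>\<^sub>m Y) *\<^sub>v ?v = \<phi> (pw ^ (l - 1) * mat_trace (C * Y)) \<cdot>\<^sub>v ?v"
    if Y: "Y \<in> carrier_mat n n" for Y
  proof -
    \<comment> \<open>\<open>?Y\<close> is \<open>Y\<close> conjugated back, so that
      \<open>?k * L = L * ?k'\<close>; cyclicity of the trace then turns \<open>x\<close> into
      \<open>C\<close>.\<close>
    let ?k = "1\<^sub>m n + pw ^ (l - 1) \<cdot>\<^sub>m Y" and ?Y = "?K * (Y * L)"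
    have Yc: "?Y \<in> carrier_mat n n" using Y Lc Kc by simp
    let ?k' = "1\<^sub>m n + pw ^ (l - 1) \<cdot>\<^sub>m ?Y"
    have kG: "?k \<in> GL n" "?k' \<in> GL n"
      using one_add_GL[OF Y, of "l - 1"] one_add_GL[OF Yc, of "l - 1"] l_ge_2 by auto
    have "L * ?Y = Y * L"
      using mat_mult_left_cancel[OF Lc Kc L(3), of "Y * L"] Y Lc by simp
    then have "?k * L = L * ?k'"
      using Y Lc Yc by (simp add: mult_add_distrib_mat[of _ n n _ n] add_mult_distrib_mat[of _ n n _ _ n]
        mult_smult_distrib[of _ n n _ n] mult_smult_assoc_mat[of _ n n _ n])
    then have "\<rho> ?k *\<^sub>v ?v = \<rho> L *\<^sub>v (\<rho> ?k' *\<^sub>v v)"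
      using rep_mult_vec[OF kG(1) L(1) v(1)] rep_mult_vec[OF L(1) kG(2) v(1)] by simp
    also have "\<dots> = \<phi> (pw ^ (l - 1) * mat_trace (x * ?Y)) \<cdot>\<^sub>v ?v"
      unfolding v(3)[OF Yc] by (rule rep_vec_smult[OF L(1) v(1)])
    also have "mat_trace (x * ?Y) = mat_trace (C * Y)"
    proof -
      have "x * ?Y = (x * (?K * Y)) * L" using x Kc Y Lc by (simp add: assoc_mult_mat[of _ n n _ n _ n])
      then have "mat_trace (x * ?Y) = mat_trace (L * (x * (?K * Y)))"
        using mat_trace_comm[of "x * (?K * Y)" n L] x Kc Y Lc by simp
      also have "L * (x * (?K * Y)) = C * Y"
        unfolding C_def using x Kc Y Lc by (simp add: assoc_mult_mat[of _ n n _ n _ n])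
      finally show ?thesis .
    qed
    finally show ?thesis .
  qed
  then show thesis using whittaker_nonzero_if_companion[OF C vc v0] that by blast
qed

end

theorem theorem1p4:
  fixes pw :: "'r::comm_ring_1" and \<pi> :: "'r \<Rightarrow> 'k::field" and \<phi> :: "'r \<Rightarrow> complex"
    and l n d :: nat and \<rho> :: "'r mat \<Rightarrow> complex mat"
  assumes "trunc_dvr pw l"
    and "residue_map pw \<pi>"
    and "add_char \<phi>"
    and "\<exists>a. \<phi> (pw ^ (l - 1) * a) \<noteq> 1"
    and "l \<ge> 2"
    and "regular_rep pw l \<pi> \<phi> n \<rho> d"
  shows "multiplicity_free_restriction (SL n) n \<rho> d"
proof -
  interpret primitive_char \<phi> by (rule trunc_dvr_primitive[OF assms(1,3,4)])
  obtain x where irr: "irreducible_rep (GL n) n \<rho> d" and x: "x \<in> carrier_mat n n"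
    "regular_mat (map_mat \<pi> x)" "contains_phi_x pw l \<phi> n \<rho> d x"
    using assms(6) unfolding regular_rep_def by blast
  interpret trunc_dvr_rep \<phi> n d \<rho> pw l \<pi>
    by unfold_locales (use irr assms in auto)
  show ?thesis
    using whittaker_nonzero_if_regular[OF x] multiplicity_free_if_whittaker_nonzero by blast
qed

end
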